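(* Let $G$ be a locally contractible compactly Hausdorff generated topological group with open identity neighbourhood filterbase $\mathcal{U}_1$, such that all finite products $G^{p+1}$ are $k$-spaces, and let $V$ be a loop contractible abelian $k$-group. Then the morphisms $A_{kc}^*(\mathfrak{U}_U;V)\hookrightarrow A^*(\mathfrak{U}_U;V)$ and $C(\lambda^*_{\mathfrak{U}_U},V):A_{kc}^*(\mathfrak{U}_U;V)\to S^*(\mathfrak{U}_U;V)$ for all $U\in\mathcal{U}_1$ induce isomorphisms $$\operatorname{colim}_{U\in\mathcal{U}_1}H_{kc}(\mathfrak{U}_U;V)\cong\operatorname{colim}_{U\in\mathcal{U}_1}H(\mathfrak{U}_U;V)\cong H_{sing}(G;V)$$ in cohomology.
   Context: The $k$-topology on a topological space $X$ is the final topology with respect to all continuous maps from compact Hausdorff spaces into $X$; $\mathrm{k}X$ denotes $X$ with this topology. $X$ is a $k$-space (compactly Hausdorff generated) if $\mathrm{k}X=X$. The category of $k$-spaces has products $\mathrm{k}(\prod X_i)$; a $k$-group is a group object in this category. A $k$-group $V$ is loop contractible if there is a contraction $\Phi:V\times[0,1]\to V$ to the identity (a continuous homotopy between $\mathrm{id}_V$ and the constant map to the identity element, the product being that of $k$-spaces) such that each $\Phi_t=\Phi(-,t)$ is a group homomorphism. For an open identity neighbourhood $U$ of $G$, $\mathfrak{U}_U:=\{gU\mid g\in G\}$. For an open covering $\mathfrak{U}$ of a space $X$ put $\mathfrak{U}[q]:=\bigcup_{U\in\mathfrak{U}}U^{q+1}\subseteq X^{q+1}$. $A^q(\mathfrak{U};V)$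 is the group of all functions $\mathfrak{U}[q]\to V$ and $A_{kc}^q(\mathfrak{U};V):=C(\mathrm{k}\,\mathfrak{U}[q],V)$ the subgroup of functions continuous for the $k$-topology; both form cochain complexes with $df(u_0,\dots,u_{q+1})=\sum_j(-1)^jf(u_0,\dots,\hat u_j,\dots,u_{q+1})$, with cohomologies $H(\mathfrak{U};V)$ and $H_{kc}(\mathfrak{U};V)$. $S^*(\mathfrak{U};V)$ is the complex of $V$-valued cochains on $\mathfrak{U}$-small singular simplices of $X$ (those with image in some member of $\mathfrak{U}$); its cohomology is canonically (via restriction) the singular cohomology $H_{sing}(X;V)$. $C(\lambda_{\mathfrak{U}}^*,V)$ sends $f\in A^n(\mathfrak{U};V)$ to $\tau\mapsto f(\tau(\vec e_0),\dots,\tau(\vec e_n))$, where $\vec e_0,\dots,\vec e_n$ are the vertices of the standard simplex $\Delta^n$. The colimits are over $\mathcal{U}_1$ directed by reverse inclusion, with transition maps given by restriction of cochains. *)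

theory Defs
  imports "HOL-Analysis.Analysis" "HOL-Homology.Homology"
begin

section \<open>The k-topology\<close>

text \<open>The final topology with respect to all continuous maps from compact Hausdorff spaces. HOL
  cannot quantify over spaces of all types inside a definition, so the definition quantifies over
  the compact Hausdorff spaces carried by \<^typ>\<open>(nat \<times> 'a) set set\<close>. Nothing is lost: by
  \<open>openin_k_topology_preimage\<close> below, every continuous map into \<open>X\<close> from a compact Hausdorff space
  of any type is still continuous for this topology. The library's \<open>k_space\<close> is a different notion
  (it tests on compact, not necessarily Hausdorff, subspaces) and is not used.\<close>

definition k_open :: "'a topology \<Rightarrow> 'a set \<Rightarrow> bool" where
  "k_open X U \<longleftrightarrow> U \<subseteq> topspace X \<and>
     (\<forall>(K :: (nat \<times> 'a) set set topology) \<phi>.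
        compact_space K \<longrightarrow> Hausdorff_space K \<longrightarrow> continuous_map K X \<phi> \<longrightarrow>
        openin K {x \<in> topspace K. \<phi> x \<in> U})"

definition k_topology :: "'a topology \<Rightarrow> 'a topology" where
  "k_topology X = topology (k_open X)"

lemma istopology_k_open: "istopology (k_open X)"
  unfolding istopology_def
proof (intro conjI allI impI)
  fix S T assume "k_open X S" "k_open X T"
  then show "k_open X (S \<inter> T)"
    unfolding k_open_def
  proof (intro conjI allI impI)
    fix K :: "(nat \<times> 'a) set set topology" and \<phi>
    assume K: "compact_space K" "Hausdorff_space K" "continuous_map K X \<phi>"
    assume *: "S \<subseteq> topspace X \<and> (\<forall>(K :: (nat \<times> 'a) set set topology) \<phi>.
        compact_space K \<longrightarrow> Hausdorff_space K \<longrightarrow> continuous_map K X \<phi> \<longrightarrow>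
        openin K {x \<in> topspace K. \<phi> x \<in> S})"
     "T \<subseteq> topspace X \<and> (\<forall>(K :: (nat \<times> 'a) set set topology) \<phi>.
        compact_space K \<longrightarrow> Hausdorff_space K \<longrightarrow> continuous_map K X \<phi> \<longrightarrow>
        openin K {x \<in> topspace K. \<phi> x \<in> T})"
    have "openin K ({x \<in> topspace K. \<phi> x \<in> S} \<inter> {x \<in> topspace K. \<phi> x \<in> T})"
      using * K by (intro openin_Int) blast+
    moreover have "{x \<in> topspace K. \<phi> x \<in> S} \<inter> {x \<in> topspace K. \<phi> x \<in> T} =
                   {x \<in> topspace K. \<phi> x \<in> S \<inter> T}"
      by blast
    ultimately show "openin K {x \<in> topspace K. \<phi> x \<in> S \<inter> T}" by simp
  qed blast
next
  fix \<K> assume *: "\<forall>S\<in>\<K>. k_open X S"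
  show "k_open X (\<Union>\<K>)"
    unfolding k_open_def
  proof (intro conjI allI impI)
    show "\<Union>\<K> \<subseteq> topspace X" using * unfolding k_open_def by blast
    fix K :: "(nat \<times> 'a) set set topology" and \<phi>
    assume K: "compact_space K" "Hausdorff_space K" "continuous_map K X \<phi>"
    have "openin K (\<Union>S\<in>\<K>. {x \<in> topspace K. \<phi> x \<in> S})"
      using * K unfolding k_open_def by (intro openin_Union) blast
    moreover have "(\<Union>S\<in>\<K>. {x \<in> topspace K. \<phi> x \<in> S}) = {x \<in> topspace K. \<phi> x \<in> \<Union>\<K>}"
      by blast
    ultimately show "openin K {x \<in> topspace K. \<phi> x \<in> \<Union>\<K>}" by simp
  qed
qed

lemma openin_k_topology: "openin (k_topology X) U \<longleftrightarrow> k_open X U"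
  unfolding k_topology_def by (simp add: istopology_k_open topology_inverse')

lemma openin_imp_openin_k_topology: "openin X U \<Longrightarrow> openin (k_topology X) U"
  unfolding openin_k_topology k_open_def
  by (auto simp: openin_subset dest: openin_continuous_map_preimage)

lemma topspace_k_topology [simp]: "topspace (k_topology X) = topspace X"
proof
  show "topspace (k_topology X) \<subseteq> topspace X"
    using openin_topspace[of "k_topology X"] unfolding openin_k_topology k_open_def by blast
  show "topspace X \<subseteq> topspace (k_topology X)"
    by (simp add: openin_imp_openin_k_topology openin_subset)
qed

subsection \<open>The choice of test spaces loses nothing\<close>

text \<open>Given a compact Hausdorff space \<open>K\<close> of any type, a continuous \<open>\<phi> : K \<rightarrow> X\<close> and \<open>U\<close> with
  \<open>\<phi>\<inverse>(U)\<close> not open, choose a point \<open>p\<close> of \<open>\<phi>\<inverse>(U)\<close> that is not interior. A small normal lattice of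
  closed subsets of \<open>K\<close> (containing \<open>{p}\<close>, the preimages of closed sets, and enough points outside
  \<open>\<phi>\<inverse>(U)\<close>) has a Wallman space, which is a compact Hausdorff space of bounded size; one lifts its
  points to \<open>K\<close> so that \<open>\<phi>\<close> stays continuous and \<open>\<phi>\<inverse>(U)\<close> stays non-open. The terms below name the
  members of the lattice.\<close>

datatype 'a lat_term =
    Point
  | Preimage "'a set"
  | Node nat "'a lat_term" "'a lat_term"

primrec lat_code :: "'a lat_term \<Rightarrow> (nat \<times> 'a) set" where
  "lat_code Point = {(prod_encode (5, 0), undefined)}"
| "lat_code (Preimage Z) = insert (prod_encode (4, 0), undefined) ((\<lambda>a. (prod_encode (3, 0), a)) ` Z)"
| "lat_code (Node n l r) = insert (prod_encode (0, n), undefined)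
     ((\<lambda>(m, a). (prod_encode (1, m), a)) ` lat_code l \<union>
      (\<lambda>(m, a). (prod_encode (2, m), a)) ` lat_code r)"

lemma lat_code_inject: "lat_code s = lat_code t \<longleftrightarrow> s = t"
proof
  assume "lat_code s = lat_code t"
  then show "s = t"
  proof (induction s arbitrary: t)
    case Point
    then have "(prod_encode (5, 0), undefined) \<in> lat_code t" by auto
    then show ?case by (cases t) auto
  next
    case (Preimage Z)
    have "(prod_encode (4, 0), undefined) \<in> lat_code (Preimage Z)" by simp
    then have "(prod_encode (4, 0), undefined) \<in> lat_code t" using Preimage by metis
    then obtain Z' where t: "t = Preimage Z'" by (cases t) auto
    have "Z = {a. (prod_encode (3, 0), a) \<in> lat_code (Preimage Z)}" by auto
    also have "\<dots> = {a. (prod_encode (3, 0), a) \<in> lat_code (Preimage Z')}"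
      using Preimage t by metis
    also have "\<dots> = Z'" by auto
    finally show ?case using t by simp
  next
    case (Node n l r)
    have "(prod_encode (0, n), undefined) \<in> lat_code (Node n l r)" by simp
    then have "(prod_encode (0, n), undefined) \<in> lat_code t" using Node.prems by metis
    then obtain l' r' where t: "t = Node n l' r'" by (cases t) auto
    have L: "lat_code l = {(m, a). (prod_encode (1, m), a) \<in> lat_code (Node n l r)}" for l r :: "'a lat_term"
      by auto
    have R: "lat_code r = {(m, a). (prod_encode (2, m), a) \<in> lat_code (Node n l r)}" for l r :: "'a lat_term"
      by auto
    have "lat_code l = lat_code l'" using L[of l r] L[of l' r'] Node.prems t by metis
    moreover have "lat_code r = lat_code r'" using R[of r l] R[of r' l'] Node.prems t by metis
    ultimately show ?case using Node.IH t by blast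
  qed
qed simp

primrec lat_eval :: "'b set \<Rightarrow> ('a set \<Rightarrow> 'b set) \<Rightarrow> (nat \<Rightarrow> 'b set \<Rightarrow> 'b set \<Rightarrow> 'b set) \<Rightarrow>
    'a lat_term \<Rightarrow> 'b set" where
  "lat_eval P B f Point = P"
| "lat_eval P B f (Preimage Z) = B Z"
| "lat_eval P B f (Node n l r) = f n (lat_eval P B f l) (lat_eval P B f r)"

lemma openin_k_topology_preimage:
  fixes K :: "'b topology" and X :: "'a topology"
  assumes U: "openin (k_topology X) U"
    and K: "compact_space K" "Hausdorff_space K"
    and \<phi>: "continuous_map K X \<phi>"
  shows "openin K {x \<in> topspace K. \<phi> x \<in> U}"
proof (rule ccontr)
  assume nopen: "\<not> openin K {x \<in> topspace K. \<phi> x \<in> U}"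
  then obtain p where p: "p \<in> topspace K" "\<phi> p \<in> U"
    and pint: "\<And>W. openin K W \<Longrightarrow> p \<in> W \<Longrightarrow> \<not> W \<subseteq> {x \<in> topspace K. \<phi> x \<in> U}"
    by (subst (asm) openin_subopen) auto
  define d where "d C = (SOME x. x \<in> topspace K - C \<and> \<phi> x \<notin> U)" for C
  have d: "d C \<in> topspace K - C \<and> \<phi> (d C) \<notin> U" if "closedin K C" "p \<notin> C" for C
  proof -
    have "openin K (topspace K - C)" using that by blast
    then have "\<exists>x. x \<in> topspace K - C \<and> \<phi> x \<notin> U" using pint[of "topspace K - C"] p that by blast
    then show ?thesis unfolding d_def by (rule someI_ex)
  qed
  define sep where "sep C E Q \<longleftrightarrow> closedin K (fst Q) \<and> closedin K (snd Q) \<and>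
      fst Q \<union> snd Q = topspace K \<and> fst Q \<inter> C = {} \<and> snd Q \<inter> E = {}" for C E and Q :: "'b set \<times> 'b set"
  have "normal_space K" using K compact_Hausdorff_or_regular_imp_normal_space by blast
  then have sep_ex: "\<exists>Q. sep C E Q" if CE: "closedin K C" "closedin K E" "C \<inter> E = {}" for C E
  proof -
    obtain N1 N2 where N: "openin K N1" "openin K N2" "C \<subseteq> N1" "E \<subseteq> N2" "disjnt N1 N2"
      using \<open>normal_space K\<close> CE unfolding normal_space_def disjnt_def by meson
    have "sep C E (topspace K - N1, topspace K - N2)"
      using N unfolding sep_def disjnt_def by auto
    then show ?thesis by blast
  qed
  define f where "f n C E =
     (if n = 0 then C \<inter> E else if n = 1 then C \<union> E
      else if n = 2 then (if C \<inter> E = {} then fst (SOME Q. sep C E Q) else {})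
      else if n = 3 then (if C \<inter> E = {} then snd (SOME Q. sep C E Q) else {})
      else (if p \<notin> C then {d C} else {}))" for n :: nat and C E
  define B where "B Z = (if closedin X Z then {x \<in> topspace K. \<phi> x \<in> Z} else {})" for Z
  define ev where "ev = lat_eval {p} B f"
  define L where "L = range ev"
  have ev_simps: "ev Point = {p}" "ev (Preimage Z) = B Z" "ev (Node n l r) = f n (ev l) (ev r)"
    for Z n l r unfolding ev_def by simp_all
  have closed1: "closedin K {x}" if "x \<in> topspace K" for x
    using K(2) that by (simp add: Hausdorff_imp_t1_space closedin_t1_singleton)
  have ev_closed: "closedin K (ev t)" for t
  proof (induction t)
    case Point
    then show ?case using closed1 p by (simp add: ev_simps)
  next
    case (Preimage Z)
    then show ?case using \<phi> by (auto simp: ev_simps B_def closedin_continuous_map_preimage)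
  next
    case (Node n l r)
    then show ?case
      using someI_ex[OF sep_ex[OF Node.IH]] d[OF Node.IH(1)] closed1
      unfolding ev_simps f_def sep_def by auto
  qed
  have Lclosed: "closedin K C" if "C \<in> L" for C using that ev_closed unfolding L_def by auto
  have Lf: "f n C E \<in> L" if "C \<in> L" "E \<in> L" for n C E
    using that ev_simps(3) unfolding L_def by (metis imageE rangeI)
  have LInt: "C \<inter> E \<in> L" if "C \<in> L" "E \<in> L" for C E
    using Lf[OF that, of 0] by (simp add: f_def)
  have LUn: "C \<union> E \<in> L" if "C \<in> L" "E \<in> L" for C E
    using Lf[OF that, of 1] by (simp add: f_def)
  have Lsep: "\<exists>C' E'. C' \<in> L \<and> E' \<in> L \<and> C' \<union> E' = topspace K \<and> C' \<inter> C = {} \<and> E' \<inter> E = {}"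
    if "C \<in> L" "E \<in> L" "C \<inter> E = {}" for C E
  proof -
    have "sep C E (SOME Q. sep C E Q)"
      by (rule someI_ex[OF sep_ex[OF Lclosed[OF that(1)] Lclosed[OF that(2)] that(3)]])
    then show ?thesis
      using Lf[OF that(1,2), of 2] Lf[OF that(1,2), of 3] that(3)
      unfolding sep_def f_def by auto
  qed
  have Lp: "{p} \<in> L" using ev_simps(1) unfolding L_def by (metis rangeI)
  have LB: "B Z \<in> L" for Z using ev_simps(2) unfolding L_def by (metis rangeI)
  have Ltop: "topspace K \<in> L" 
  proof -
    have "B (topspace X) = topspace K"
      using \<phi> unfolding B_def continuous_map_def by auto
    then show ?thesis using LB by metis
  qed
  have Lempty: "{} \<in> L"
    using LB[of "{}"] by (simp add: B_def)
  have Ld: "{d C} \<in> L" if "C \<in> L" "p \<notin> C" for C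
    using Lf[OF that(1) that(1), of 4] that(2) by (simp add: f_def)

  define \<Lambda> where "\<Lambda> x = {C \<in> L. x \<in> C}" for x
  define M where "M = {x \<in> topspace K. \<forall>y \<in> topspace K. \<Lambda> x \<subseteq> \<Lambda> y \<longrightarrow> \<Lambda> y = \<Lambda> x}"
  have fip: "\<exists>x \<in> topspace K. F \<subseteq> \<Lambda> x"
    if F: "F \<subseteq> L" and ne: "\<And>\<F>. finite \<F> \<Longrightarrow> \<F> \<subseteq> F \<Longrightarrow> topspace K \<inter> \<Inter>\<F> \<noteq> {}" for F
  proof -
    have "\<Inter>(insert (topspace K) F) \<noteq> {}"
    proof (rule K(1)[unfolded compact_space_fip, rule_format], intro conjI ballI allI impI)
      fix C assume "C \<in> insert (topspace K) F"
      then show "closedin K C" using F Lclosed by auto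
    next
      fix \<F> assume \<F>: "finite \<F> \<and> \<F> \<subseteq> insert (topspace K) F"
      then have "topspace K \<inter> \<Inter>(\<F> - {topspace K}) \<noteq> {}" by (intro ne) auto
      then show "\<Inter>\<F> \<noteq> {}" by blast
    qed
    then obtain x where "x \<in> topspace K" "\<forall>C\<in>F. x \<in> C" by auto
    then show ?thesis using F unfolding \<Lambda>_def by blast
  qed
  have maxi: "\<exists>x \<in> M. F \<subseteq> \<Lambda> x" if F: "x0 \<in> topspace K" "F \<subseteq> \<Lambda> x0" for F x0
  proof -
    let ?A = "{\<Lambda> x | x. x \<in> topspace K \<and> F \<subseteq> \<Lambda> x}"
    have "\<exists>m\<in>?A. \<forall>X\<in>?A. m \<subseteq> X \<longrightarrow> X = m"
    proof (rule subset_Zorn)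
      fix \<C> assume ch: "subset.chain ?A \<C>"
      show "\<exists>U\<in>?A. \<forall>X\<in>\<C>. X \<subseteq> U"
      proof (cases "\<C> = {}")
        case True
        then show ?thesis using F by blast
      next
        case False
        have sub: "\<C> \<subseteq> ?A" and lin: "\<And>X Y. X \<in> \<C> \<Longrightarrow> Y \<in> \<C> \<Longrightarrow> X \<subseteq> Y \<or> Y \<subseteq> X"
          using ch unfolding subset.chain_def by blast+
        have "\<exists>x \<in> topspace K. \<Union>\<C> \<subseteq> \<Lambda> x"
        proof (rule fip)
          show "\<Union>\<C> \<subseteq> L" using sub unfolding \<Lambda>_def by blast
          fix \<F> assume "finite \<F>" "\<F> \<subseteq> \<Union>\<C>"
          then have "\<exists>Y\<in>\<C>. \<F> \<subseteq> Y"
            using finite_subset_Union_chain[of \<F> \<C> ?A] False ch by metis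
          then obtain x where "x \<in> topspace K" "\<F> \<subseteq> \<Lambda> x" using sub by blast
          then show "topspace K \<inter> \<Inter>\<F> \<noteq> {}" unfolding \<Lambda>_def by blast
        qed
        then obtain x where x: "x \<in> topspace K" "\<Union>\<C> \<subseteq> \<Lambda> x" by (elim bexE)
        obtain Y where Y: "Y \<in> \<C>" using False by blast
        then have "F \<subseteq> Y" using sub by blast
        then have "F \<subseteq> \<Lambda> x" using x(2) Y by (meson Sup_upper order_trans)
        then have "\<Lambda> x \<in> ?A" using x(1) by blast
        moreover have "\<forall>X\<in>\<C>. X \<subseteq> \<Lambda> x" using x(2) by (meson Sup_le_iff)
        ultimately show ?thesis by (rule bexI[rotated])
      qed
    qed
    then obtain x where x: "x \<in> topspace K" "F \<subseteq> \<Lambda> x" and m: "\<forall>X\<in>?A. \<Lambda> x \<subseteq> X \<longrightarrow> X = \<Lambda> x"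
      by (elim bexE CollectE exE conjE) simp
    have "\<Lambda> y = \<Lambda> x" if "y \<in> topspace K" "\<Lambda> x \<subseteq> \<Lambda> y" for y
    proof -
      have "\<Lambda> y \<in> ?A" using that x(2) by auto
      from m[rule_format, OF this that(2)] show ?thesis .
    qed
    then have "x \<in> M" using x(1) unfolding M_def by simp
    then show ?thesis using x(2) by (rule bexI[rotated])
  qed
  have \<Lambda>_fin: "topspace K \<inter> \<Inter>\<F> \<in> \<Lambda> x" if "finite \<F>" "\<F> \<subseteq> \<Lambda> x" "x \<in> topspace K" for \<F> x
    using that
  proof (induction \<F>)
    case empty
    then show ?case using Ltop by (simp add: \<Lambda>_def)
  next
    case (insert C \<F>)
    then have "C \<in> \<Lambda> x" "topspace K \<inter> \<Inter>\<F> \<in> \<Lambda> x" by auto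
    moreover have "topspace K \<inter> \<Inter>(insert C \<F>) = C \<inter> (topspace K \<inter> \<Inter>\<F>)" by blast
    ultimately show ?case using LInt unfolding \<Lambda>_def by auto
  qed
  have sepM: "\<exists>E \<in> L. x \<in> E \<and> C \<inter> E = {}" if x: "x \<in> M" and C: "C \<in> L" "x \<notin> C" for x C
  proof (rule ccontr)
    assume no: "\<not> (\<exists>E \<in> L. x \<in> E \<and> C \<inter> E = {})"
    have xK: "x \<in> topspace K" using x unfolding M_def by blast
    have "\<exists>y \<in> topspace K. insert C (\<Lambda> x) \<subseteq> \<Lambda> y"
    proof (rule fip)
      show "insert C (\<Lambda> x) \<subseteq> L" using C unfolding \<Lambda>_def by blast
      fix \<F> assume \<F>: "finite \<F>" "\<F> \<subseteq> insert C (\<Lambda> x)"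
      have "topspace K \<inter> \<Inter>(\<F> - {C}) \<in> \<Lambda> x" using \<F> xK by (intro \<Lambda>_fin) auto
      then have "topspace K \<inter> \<Inter>(\<F> - {C}) \<in> L" "x \<in> topspace K \<inter> \<Inter>(\<F> - {C})"
        unfolding \<Lambda>_def by simp_all
      then have "C \<inter> (topspace K \<inter> \<Inter>(\<F> - {C})) \<noteq> {}" using no by metis
      then obtain y where "y \<in> C" "y \<in> topspace K" "y \<in> \<Inter>(\<F> - {C})" by auto
      then have "y \<in> topspace K \<inter> \<Inter>\<F>" by auto
      then show "topspace K \<inter> \<Inter>\<F> \<noteq> {}" by (metis empty_iff)
    qed
    then obtain y where y: "y \<in> topspace K" "C \<in> \<Lambda> y" "\<Lambda> x \<subseteq> \<Lambda> y" by auto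
    then have "\<Lambda> y = \<Lambda> x" using x unfolding M_def by simp
    then have "C \<in> \<Lambda> x" using y(2) by simp
    then show False using C(2) unfolding \<Lambda>_def by simp
  qed
  have singleM: "x \<in> M" "\<And>y. y \<in> topspace K \<Longrightarrow> \<Lambda> y = \<Lambda> x \<Longrightarrow> y = x"
    if "{x} \<in> L" "x \<in> topspace K" for x
  proof -
    have eq: "y = x" if "y \<in> topspace K" "\<Lambda> x \<subseteq> \<Lambda> y" for y
    proof -
      have "{x} \<in> \<Lambda> x" using \<open>{x} \<in> L\<close> unfolding \<Lambda>_def by simp
      then have "{x} \<in> \<Lambda> y" using that(2) by (rule subsetD[rotated])
      then show "y = x" unfolding \<Lambda>_def by simp
    qed
    then show "y = x" if "y \<in> topspace K" "\<Lambda> y = \<Lambda> x" for y using that by simp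
    show "x \<in> M" unfolding M_def using eq \<open>x \<in> topspace K\<close> by auto
  qed

  define j where "j C = lat_code (SOME t. ev t = C)" for C
  have jinj: "inj_on j L"
  proof (rule inj_onI)
    fix C E assume "C \<in> L" "E \<in> L" "j C = j E"
    have ev_some: "ev (SOME t. ev t = D) = D" if "D \<in> L" for D
    proof (rule someI_ex)
      show "\<exists>t. ev t = D" using that unfolding L_def by (metis imageE)
    qed
    have "ev (SOME t. ev t = C) = C" "ev (SOME t. ev t = E) = E"
      using ev_some \<open>C \<in> L\<close> \<open>E \<in> L\<close> by blast+
    then show "C = E" using \<open>j C = j E\<close> unfolding j_def lat_code_inject by metis
  qed
  define c where "c x = j ` \<Lambda> x" for x
  have c_eq: "c x = c y \<longleftrightarrow> \<Lambda> x = \<Lambda> y" for x y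
    unfolding c_def by (rule inj_on_image_eq_iff[OF jinj]) (auto simp: \<Lambda>_def)
  define s where "s z = (SOME x. x \<in> M \<and> c x = z)" for z
  have s: "s z \<in> M" "c (s z) = z" if "z \<in> c ` M" for z
  proof -
    have "\<exists>x. x \<in> M \<and> c x = z" using that by blast
    then have "s z \<in> M \<and> c (s z) = z" unfolding s_def by (rule someI_ex)
    then show "s z \<in> M" "c (s z) = z" by auto
  qed
  have sc: "\<Lambda> (s (c x)) = \<Lambda> x" if "x \<in> M" for x
    using s(2)[of "c x"] that c_eq by blast
  have sc_in: "s (c x) \<in> C \<longleftrightarrow> x \<in> C" if "x \<in> M" "C \<in> L" for x C
    using sc[OF that(1)] that(2) unfolding \<Lambda>_def by blast
  define op where "op W \<longleftrightarrow> W \<subseteq> c ` M \<and>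
     (\<forall>y\<in>W. \<exists>C\<in>L. s y \<notin> C \<and> {z \<in> c ` M. s z \<notin> C} \<subseteq> W)" for W
  have opD: "\<exists>C\<in>L. s y \<notin> C \<and> {z \<in> c ` M. s z \<notin> C} \<subseteq> W" if "op W" "y \<in> W" for W y
    using that unfolding op_def by simp
  have "istopology op"
    unfolding istopology_def
  proof (intro conjI allI impI)
    fix S T assume ST: "op S" "op T"
    show "op (S \<inter> T)"
      unfolding op_def
    proof (intro conjI ballI)
      show "S \<inter> T \<subseteq> c ` M" using ST unfolding op_def by blast
      fix y assume y: "y \<in> S \<inter> T"
      obtain C where C: "C\<in>L" "s y \<notin> C" "{z \<in> c ` M. s z \<notin> C} \<subseteq> S"
        using opD[OF ST(1), of y] y by auto
      obtain E where E: "E\<in>L" "s y \<notin> E" "{z \<in> c ` M. s z \<notin> E} \<subseteq> T"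
        using opD[OF ST(2), of y] y by auto
      have "{z \<in> c ` M. s z \<notin> C \<union> E} \<subseteq> S \<inter> T" using C(3) E(3) by auto
      then show "\<exists>C\<in>L. s y \<notin> C \<and> {z \<in> c ` M. s z \<notin> C} \<subseteq> S \<inter> T"
        using LUn[OF C(1) E(1)] C(2) E(2) by (intro bexI[of _ "C \<union> E"] conjI) simp_all
    qed
  next
    fix \<K> assume *: "\<forall>S\<in>\<K>. op S"
    show "op (\<Union>\<K>)"
      unfolding op_def
    proof (intro conjI ballI)
      show "\<Union>\<K> \<subseteq> c ` M" using * unfolding op_def by blast
      fix y assume "y \<in> \<Union>\<K>"
      then obtain S where S: "S \<in> \<K>" "y \<in> S" by blast
      then obtain C where C: "C\<in>L" "s y \<notin> C" "{z \<in> c ` M. s z \<notin> C} \<subseteq> S"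
        using * opD[of S y] by auto
      then have "{z \<in> c ` M. s z \<notin> C} \<subseteq> \<Union>\<K>" using S(1) by (meson Sup_upper order_trans)
      then show "\<exists>C\<in>L. s y \<notin> C \<and> {z \<in> c ` M. s z \<notin> C} \<subseteq> \<Union>\<K>"
        using C(1,2) by (intro bexI[OF _ C(1)] conjI)
    qed
  qed
  define K' where "K' = topology op"
  have openK': "openin K' W \<longleftrightarrow> op W" for W
    unfolding K'_def using \<open>istopology op\<close> by (simp add: topology_inverse')
  have basic: "openin K' {z \<in> c ` M. s z \<notin> C}" if "C \<in> L" for C
    unfolding openK' op_def using that by auto
  have topK': "topspace K' = c ` M"
  proof
    show "topspace K' \<subseteq> c ` M" using openin_topspace[of K'] unfolding openK' op_def by blast
    show "c ` M \<subseteq> topspace K'" using openin_subset[OF basic[OF Lempty]] by auto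
  qed
  have "compact_space K'"
    unfolding compact_space_alt
  proof (intro allI impI, elim conjE)
    fix \<W> assume \<W>: "\<forall>W\<in>\<W>. openin K' W" "topspace K' \<subseteq> \<Union>\<W>"
    show "\<exists>\<F>. finite \<F> \<and> \<F> \<subseteq> \<W> \<and> topspace K' \<subseteq> \<Union>\<F>"
    proof (rule ccontr)
      assume no: "\<not> (\<exists>\<F>. finite \<F> \<and> \<F> \<subseteq> \<W> \<and> topspace K' \<subseteq> \<Union>\<F>)"
      define F where "F = {C \<in> L. \<exists>W\<in>\<W>. {z \<in> c ` M. s z \<notin> C} \<subseteq> W}"
      have "\<exists>x \<in> topspace K. F \<subseteq> \<Lambda> x"
      proof (rule fip)
        show "F \<subseteq> L" unfolding F_def by blast
        fix \<F> assume \<F>: "finite \<F>" "\<F> \<subseteq> F"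
        have "\<forall>C\<in>\<F>. \<exists>W\<in>\<W>. {z \<in> c ` M. s z \<notin> C} \<subseteq> W" using \<F> unfolding F_def by blast
        then have "\<exists>w. \<forall>C\<in>\<F>. w C \<in> \<W> \<and> {z \<in> c ` M. s z \<notin> C} \<subseteq> w C"
          unfolding Bex_def by (rule bchoice)
        then obtain w where w: "\<forall>C\<in>\<F>. w C \<in> \<W> \<and> {z \<in> c ` M. s z \<notin> C} \<subseteq> w C"
          by (elim exE)
        have "finite (w ` \<F>)" "w ` \<F> \<subseteq> \<W>" using \<F>(1) w by auto
        then have "\<not> topspace K' \<subseteq> \<Union>(w ` \<F>)" using no by simp
        then obtain z where z: "z \<in> c ` M" "z \<notin> \<Union>(w ` \<F>)" unfolding topK' by auto
        have "s z \<in> C" if "C \<in> \<F>" for C using w z that by auto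
        moreover have "s z \<in> topspace K" using s(1)[OF z(1)] unfolding M_def by simp
        ultimately have "s z \<in> topspace K \<inter> \<Inter>\<F>" by simp
        then show "topspace K \<inter> \<Inter>\<F> \<noteq> {}" by (metis empty_iff)
      qed
      then obtain x where x: "x \<in> M" "F \<subseteq> \<Lambda> x" using maxi by metis
      then have "c x \<in> \<Union>\<W>" using \<W>(2) unfolding topK' by auto
      then obtain W where W: "W \<in> \<W>" "c x \<in> W" by auto
      then have "op W" using \<W>(1) unfolding openK' by simp
      then obtain C where C: "C\<in>L" "s (c x) \<notin> C" "{z \<in> c ` M. s z \<notin> C} \<subseteq> W"
        using opD[OF _ W(2)] by auto
      then have "C \<in> F" using W(1) unfolding F_def by auto
      then have "C \<in> \<Lambda> x" using x(2) by auto
      then show False using C(1,2) sc_in[OF x(1)] unfolding \<Lambda>_def by simp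
    qed
  qed
  moreover have "Hausdorff_space K'"
    unfolding Hausdorff_space_def topK'
  proof (intro allI impI)
    fix y z assume yz: "y \<in> c ` M \<and> z \<in> c ` M \<and> y \<noteq> z"
    then have M: "s y \<in> M" "s z \<in> M" using s by auto
    have "\<Lambda> (s y) \<noteq> \<Lambda> (s z)" using yz s(2)[of y] s(2)[of z] c_eq by metis
    then have "\<not> \<Lambda> (s y) \<subseteq> \<Lambda> (s z)" using M unfolding M_def by auto
    then obtain C where C: "C \<in> L" "s y \<in> C" "s z \<notin> C" unfolding \<Lambda>_def by auto
    then obtain E where E: "E \<in> L" "s z \<in> E" "C \<inter> E = {}" using sepM[OF M(2)] by auto
    obtain C' E' where CE: "C' \<in> L" "E' \<in> L" "C' \<union> E' = topspace K" "C' \<inter> C = {}" "E' \<inter> E = {}"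
      using Lsep[OF C(1) E(1,3)] by (elim exE conjE)
    have "disjnt {w \<in> c ` M. s w \<notin> C'} {w \<in> c ` M. s w \<notin> E'}"
      using s(1) CE(3) unfolding disjnt_def M_def by auto
    moreover have "y \<in> {w \<in> c ` M. s w \<notin> C'}" "z \<in> {w \<in> c ` M. s w \<notin> E'}"
      using yz C(2) E(2) CE(4,5) by auto
    ultimately show "\<exists>U V. openin K' U \<and> openin K' V \<and> y \<in> U \<and> z \<in> V \<and> disjnt U V"
      using basic[OF CE(1)] basic[OF CE(2)] by (intro exI conjI)
  qed
  moreover have "continuous_map K' X (\<phi> \<circ> s)"
    unfolding continuous_map_def
  proof (intro conjI allI impI)
    have sK: "s z \<in> topspace K" if "z \<in> c ` M" for z
      using s(1)[OF that] unfolding M_def by simp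
    have \<phi>X: "\<phi> x \<in> topspace X" if "x \<in> topspace K" for x
      using \<phi> that unfolding continuous_map_def by auto
    show "\<phi> \<circ> s \<in> topspace K' \<rightarrow> topspace X"
      unfolding topK' using sK \<phi>X by auto
    fix O' assume O': "openin X O'"
    have "{z \<in> topspace K'. (\<phi> \<circ> s) z \<in> O'} = {z \<in> c ` M. s z \<notin> B (topspace X - O')}"
      unfolding topK' using sK \<phi>X O' by (auto simp: B_def)
    then show "openin K' {z \<in> topspace K'. (\<phi> \<circ> s) z \<in> O'}" using basic LB by simp
  qed
  ultimately have "openin K' {z \<in> topspace K'. (\<phi> \<circ> s) z \<in> U}"
    using U[unfolded openin_k_topology k_open_def, THEN conjunct2, rule_format, of K' "\<phi> \<circ> s"] by metis
  then have opU: "op {z \<in> c ` M. \<phi> (s z) \<in> U}" unfolding openK' topK' by simp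
  have s_single: "s (c x) = x" "x \<in> M" if "{x} \<in> L" "x \<in> topspace K" for x
  proof -
    show M: "x \<in> M" by (rule singleM(1)[OF that])
    show "s (c x) = x"
      using sc_in[OF M that(1)] by simp
  qed
  have cp: "c p \<in> {z \<in> c ` M. \<phi> (s z) \<in> U}" using s_single[OF Lp p(1)] p by auto
  obtain C where C: "C \<in> L" "s (c p) \<notin> C" "{z \<in> c ` M. s z \<notin> C} \<subseteq> {z \<in> c ` M. \<phi> (s z) \<in> U}"
    using opD[OF opU cp] by (elim bexE conjE)
  have pC: "p \<notin> C" using C s_single[OF Lp p(1)] by simp
  have dC: "d C \<in> topspace K - C" "\<phi> (d C) \<notin> U" using d[OF Lclosed[OF C(1)] pC] by auto
  have "s (c (d C)) = d C" "d C \<in> M" using s_single[OF Ld[OF C(1) pC]] dC by auto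
  then show False using C(3) dC by auto
qed

lemma closedin_k_topology_iff:
  "closedin (k_topology X) A \<longleftrightarrow> A \<subseteq> topspace X \<and>
     (\<forall>(K :: (nat \<times> 'a) set set topology) \<phi>.
        compact_space K \<longrightarrow> Hausdorff_space K \<longrightarrow> continuous_map K X \<phi> \<longrightarrow>
        closedin K {x \<in> topspace K. \<phi> x \<in> A})" for X :: "'a topology"
proof -
  have eq: "{x \<in> topspace K. \<phi> x \<in> topspace X - A} = topspace K - {x \<in> topspace K. \<phi> x \<in> A}"
    if "continuous_map K X \<phi>" for K :: "(nat \<times> 'a) set set topology" and \<phi>
    using that unfolding continuous_map_def by auto
  show ?thesis
    unfolding closedin_def openin_k_topology k_open_def topspace_k_topology
    using eq by fastforce
qed

definition compactly_Hausdorff_generated :: "'a topology \<Rightarrow> bool" where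
  "compactly_Hausdorff_generated X \<longleftrightarrow> k_topology X = X"

section \<open>Groups\<close>

text \<open>\<open>V\<close> is a topology on the whole type of an abelian group; addition only has to be continuous on
  the product of k-spaces.\<close>

definition abelian_k_group :: "'v::ab_group_add topology \<Rightarrow> bool" where
  "abelian_k_group V \<longleftrightarrow> topspace V = UNIV \<and> compactly_Hausdorff_generated V \<and>
     continuous_map (k_topology (prod_topology V V)) V (\<lambda>(x, y). x + y) \<and>
     continuous_map V V uminus"

definition loop_contractible :: "'v::ab_group_add topology \<Rightarrow> bool" where
  "loop_contractible V \<longleftrightarrow>
     (\<exists>\<Phi>. continuous_map (k_topology (prod_topology V (top_of_set {0..1::real}))) V \<Phi> \<and>
          (\<forall>v. \<Phi> (v, 0) = v) \<and> (\<forall>v. \<Phi> (v, 1) = 0) \<and>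
          (\<forall>t\<in>{0..1}. \<forall>v w. \<Phi> (v + w, t) = \<Phi> (v, t) + \<Phi> (w, t)))"

text \<open>The usual, weaker form of local contractibility; it is implied by the existence of a
  neighbourhood base of contractible sets.\<close>

definition locally_contractible_space :: "'a topology \<Rightarrow> bool" where
  "locally_contractible_space X \<longleftrightarrow>
     (\<forall>x U. openin X U \<and> x \<in> U \<longrightarrow>
        (\<exists>W. openin X W \<and> x \<in> W \<and> W \<subseteq> U \<and>
           (\<exists>c. homotopic_with (\<lambda>_. True) (subtopology X W) (subtopology X U) id (\<lambda>_. c))))"

text \<open>Topological groups are written additively, as in the library class
  \<^class>\<open>topological_group_add\<close>, but are not assumed to be commutative.\<close>

definition open_identity_filterbase :: "'g::topological_group_add set set \<Rightarrow> bool" where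
  "open_identity_filterbase \<B> \<longleftrightarrow>
     (\<forall>U\<in>\<B>. open U \<and> 0 \<in> U) \<and> (\<forall>N. open N \<and> 0 \<in> N \<longrightarrow> (\<exists>U\<in>\<B>. U \<subseteq> N))"

definition coset_cover :: "'g::group_add set \<Rightarrow> 'g set set" where
  "coset_cover U = range (\<lambda>g. (\<lambda>u. g + u) ` U)"

section \<open>Cochain complexes and their cohomology\<close>

text \<open>A cochain complex consists of groups \<open>C q\<close> and differentials \<open>d q\<close> from \<open>C q\<close> to \<open>C (Suc q)\<close>.\<close>

definition cocycles :: "(nat \<Rightarrow> 'c monoid) \<Rightarrow> (nat \<Rightarrow> 'c \<Rightarrow> 'c) \<Rightarrow> nat \<Rightarrow> 'c set" where
  "cocycles C d q = {z \<in> carrier (C q). d q z = \<one>\<^bsub>C (Suc q)\<^esub>}"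

definition coboundaries :: "(nat \<Rightarrow> 'c monoid) \<Rightarrow> (nat \<Rightarrow> 'c \<Rightarrow> 'c) \<Rightarrow> nat \<Rightarrow> 'c set" where
  "coboundaries C d q = (case q of 0 \<Rightarrow> {\<one>\<^bsub>C 0\<^esub>} | Suc p \<Rightarrow> d p ` carrier (C p))"

definition cohomology :: "(nat \<Rightarrow> 'c monoid) \<Rightarrow> (nat \<Rightarrow> 'c \<Rightarrow> 'c) \<Rightarrow> nat \<Rightarrow> 'c set monoid" where
  "cohomology C d q = (C q)\<lparr>carrier := cocycles C d q\<rparr> Mod coboundaries C d q"

text \<open>The map in cohomology induced by a cochain map whose component in degree \<open>q\<close> is \<open>h\<close> and
  whose target is the complex \<open>C'\<close>, \<open>d'\<close>: the class of \<open>z\<close> goes to the class of \<open>h z\<close>.\<close>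

definition cohomology_map ::
    "(nat \<Rightarrow> 'e monoid) \<Rightarrow> (nat \<Rightarrow> 'e \<Rightarrow> 'e) \<Rightarrow> nat \<Rightarrow> ('c \<Rightarrow> 'e) \<Rightarrow> 'c set \<Rightarrow> 'e set" where
  "cohomology_map C' d' q h c = (\<Union>z\<in>c. coboundaries C' d' q #>\<^bsub>C' q\<^esub> h z)"

definition coefficient_group :: "'v::ab_group_add topology \<Rightarrow> 'v monoid" where
  "coefficient_group V = \<lparr>carrier = topspace V, monoid.mult = (+), one = 0\<rparr>"

text \<open>The group of all functions on an index set, and the alternating coboundary for index sets
  \<open>I q\<close> with face maps \<open>face q j\<close> from \<open>I (Suc q)\<close> to \<open>I q\<close>.\<close>

abbreviation function_group :: "'i set \<Rightarrow> 'v::ab_group_add topology \<Rightarrow> ('i \<Rightarrow> 'v) monoid" where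
  "function_group I V \<equiv> product_group I (\<lambda>_. coefficient_group V)"

definition coboundary ::
    "(nat \<Rightarrow> 'i set) \<Rightarrow> (nat \<Rightarrow> nat \<Rightarrow> 'i \<Rightarrow> 'i) \<Rightarrow> nat \<Rightarrow> ('i \<Rightarrow> 'v::ab_group_add) \<Rightarrow> 'i \<Rightarrow> 'v" where
  "coboundary I face q f =
     (\<lambda>s\<in>I (Suc q). \<Sum>j\<le>Suc q. if even j then f (face q j s) else - f (face q j s))"

subsection \<open>Cochains on a covering\<close>

text \<open>\<open>tuples \<UU> q\<close> is \<open>\<UU>[q]\<close>; a point of \<open>X\<^sup>q\<^sup>+\<^sup>1\<close> is an extensional function on \<open>{..q}\<close>.\<close>

definition tuples :: "'a set set \<Rightarrow> nat \<Rightarrow> (nat \<Rightarrow> 'a) set" where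
  "tuples \<UU> q = (\<Union>U\<in>\<UU>. {..q} \<rightarrow>\<^sub>E U)"

definition omit :: "nat \<Rightarrow> nat \<Rightarrow> (nat \<Rightarrow> 'a) \<Rightarrow> nat \<Rightarrow> 'a" where
  "omit q j u = (\<lambda>i\<in>{..q}. u (if i < j then i else Suc i))"

definition cover_cochains ::
    "'a set set \<Rightarrow> 'v::ab_group_add topology \<Rightarrow> nat \<Rightarrow> ((nat \<Rightarrow> 'a) \<Rightarrow> 'v) monoid" where
  "cover_cochains \<UU> V q = function_group (tuples \<UU> q) V"

definition kc_cochains ::
    "'a topology \<Rightarrow> 'a set set \<Rightarrow> 'v::ab_group_add topology \<Rightarrow> nat \<Rightarrow> ((nat \<Rightarrow> 'a) \<Rightarrow> 'v) monoid" where
  "kc_cochains X \<UU> V q = (cover_cochains \<UU> V q)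
     \<lparr>carrier := {f \<in> carrier (cover_cochains \<UU> V q).
        continuous_map
          (k_topology (subtopology (product_topology (\<lambda>_. X) {..q}) (tuples \<UU> q))) V f}\<rparr>"

definition cover_d ::
    "'a set set \<Rightarrow> nat \<Rightarrow> ((nat \<Rightarrow> 'a) \<Rightarrow> 'v::ab_group_add) \<Rightarrow> (nat \<Rightarrow> 'a) \<Rightarrow> 'v" where
  "cover_d \<UU> = coboundary (tuples \<UU>) omit"

subsection \<open>Singular cochains\<close>

definition small_simplices :: "'a topology \<Rightarrow> 'a set set \<Rightarrow> nat \<Rightarrow> ((nat \<Rightarrow> real) \<Rightarrow> 'a) set" where
  "small_simplices X \<UU> q =
     {\<tau>. singular_simplex q X \<tau> \<and> (\<exists>U\<in>\<UU>. \<tau> ` standard_simplex q \<subseteq> U)}"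

definition small_cochains ::
    "'a topology \<Rightarrow> 'a set set \<Rightarrow> 'v::ab_group_add topology \<Rightarrow> nat \<Rightarrow>
      (((nat \<Rightarrow> real) \<Rightarrow> 'a) \<Rightarrow> 'v) monoid" where
  "small_cochains X \<UU> V q = function_group (small_simplices X \<UU> q) V"

definition small_d ::
    "'a topology \<Rightarrow> 'a set set \<Rightarrow> nat \<Rightarrow> (((nat \<Rightarrow> real) \<Rightarrow> 'a) \<Rightarrow> 'v::ab_group_add) \<Rightarrow>
      ((nat \<Rightarrow> real) \<Rightarrow> 'a) \<Rightarrow> 'v" where
  "small_d X \<UU> = coboundary (small_simplices X \<UU>) (\<lambda>q. singular_face (Suc q))"

definition singular_cohomology ::
    "'a topology \<Rightarrow> 'v::ab_group_add topology \<Rightarrow> nat \<Rightarrow> (((nat \<Rightarrow> real) \<Rightarrow> 'a) \<Rightarrow> 'v) set monoid" where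
  "singular_cohomology X V =
     cohomology (\<lambda>q. function_group (singular_simplex_set q X) V)
       (coboundary (\<lambda>q. singular_simplex_set q X) (\<lambda>q. singular_face (Suc q)))"

definition simplex_vertex :: "nat \<Rightarrow> nat \<Rightarrow> real" where
  "simplex_vertex i = (\<lambda>j. if j = i then 1 else 0)"

text \<open>The cochain map \<open>C(\<lambda>\<^sup>*, V)\<close>: evaluate a cochain at the vertices of a small simplex.\<close>

definition vertex_map ::
    "'a topology \<Rightarrow> 'a set set \<Rightarrow> nat \<Rightarrow> ((nat \<Rightarrow> 'a) \<Rightarrow> 'v) \<Rightarrow> ((nat \<Rightarrow> real) \<Rightarrow> 'a) \<Rightarrow> 'v" where
  "vertex_map X \<UU> q f =
     (\<lambda>\<tau>\<in>small_simplices X \<UU> q. f (\<lambda>i\<in>{..q}. \<tau> (simplex_vertex i)))"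

section \<open>Colimits\<close>

text \<open>The colimit of groups \<open>H U\<close> indexed by a family of sets \<open>\<B>\<close> directed by reverse inclusion, with
  transition maps \<open>r U W\<close> from \<open>H U\<close> to \<open>H W\<close> for \<open>W \<subseteq> U\<close>. Its elements are classes of pairs
  \<open>(U, x)\<close> with \<open>x\<close> in \<open>H U\<close>. The product and the unit are written as unions over all
  representatives; all members of these unions coincide.\<close>

definition colim_rel ::
    "'i set set \<Rightarrow> ('i set \<Rightarrow> 'h monoid) \<Rightarrow> ('i set \<Rightarrow> 'i set \<Rightarrow> 'h \<Rightarrow> 'h) \<Rightarrow> ('i set \<times> 'h) rel" where
  "colim_rel \<B> H r =
     {((U, x), (W, y)) | U x W y. U \<in> \<B> \<and> x \<in> carrier (H U) \<and> W \<in> \<B> \<and> y \<in> carrier (H W) \<and>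
        (\<exists>O'\<in>\<B>. O' \<subseteq> U \<and> O' \<subseteq> W \<and> r U O' x = r W O' y)}"

definition colim_class ::
    "'i set set \<Rightarrow> ('i set \<Rightarrow> 'h monoid) \<Rightarrow> ('i set \<Rightarrow> 'i set \<Rightarrow> 'h \<Rightarrow> 'h) \<Rightarrow>
      'i set \<Rightarrow> 'h \<Rightarrow> ('i set \<times> 'h) set" where
  "colim_class \<B> H r U x = colim_rel \<B> H r `` {(U, x)}"

definition colim ::
    "'i set set \<Rightarrow> ('i set \<Rightarrow> 'h monoid) \<Rightarrow> ('i set \<Rightarrow> 'i set \<Rightarrow> 'h \<Rightarrow> 'h) \<Rightarrow>
      ('i set \<times> 'h) set monoid" where
  "colim \<B> H r =
     \<lparr>carrier = (SIGMA U:\<B>. carrier (H U)) // colim_rel \<B> H r,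
      monoid.mult = (\<lambda>P Q. \<Union>{colim_class \<B> H r W (r U W x \<otimes>\<^bsub>H W\<^esub> r U' W y) | U x U' y W.
         (U, x) \<in> P \<and> (U', y) \<in> Q \<and> W \<in> \<B> \<and> W \<subseteq> U \<and> W \<subseteq> U'}),
      one = (\<Union>U\<in>\<B>. colim_class \<B> H r U \<one>\<^bsub>H U\<^esub>)\<rparr>"

text \<open>The map induced on colimits by maps \<open>f U\<close> on the terms; \<open>H'\<close>, \<open>r'\<close> is the target system.\<close>

definition colim_map ::
    "'i set set \<Rightarrow> ('i set \<Rightarrow> 'k monoid) \<Rightarrow> ('i set \<Rightarrow> 'i set \<Rightarrow> 'k \<Rightarrow> 'k) \<Rightarrow>
      ('i set \<Rightarrow> 'h \<Rightarrow> 'k) \<Rightarrow> ('i set \<times> 'h) set \<Rightarrow> ('i set \<times> 'k) set" where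
  "colim_map \<B> H' r' f P = (\<Union>(U, x)\<in>P. colim_class \<B> H' r' U (f U x))"

section \<open>The cohomology groups attached to the coverings by cosets\<close>

definition H_cover ::
    "'v::ab_group_add topology \<Rightarrow> nat \<Rightarrow> 'g::topological_group_add set \<Rightarrow>
      ((nat \<Rightarrow> 'g) \<Rightarrow> 'v) set monoid" where
  "H_cover V q U = cohomology (cover_cochains (coset_cover U) V) (cover_d (coset_cover U)) q"

definition H_kc ::
    "'v::ab_group_add topology \<Rightarrow> nat \<Rightarrow> 'g::topological_group_add set \<Rightarrow>
      ((nat \<Rightarrow> 'g) \<Rightarrow> 'v) set monoid" where
  "H_kc V q U = cohomology (kc_cochains euclidean (coset_cover U) V) (cover_d (coset_cover U)) q"

definition H_small ::
    "'v::ab_group_add topology \<Rightarrow> nat \<Rightarrow> 'g::topological_group_add set \<Rightarrow>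
      (((nat \<Rightarrow> real) \<Rightarrow> 'g) \<Rightarrow> 'v) set monoid" where
  "H_small V q U =
     cohomology (small_cochains euclidean (coset_cover U) V) (small_d euclidean (coset_cover U)) q"

text \<open>Transition maps, induced by restriction of cochains to the covering for \<open>W\<close>.\<close>

definition res_cover ::
    "'v::ab_group_add topology \<Rightarrow> nat \<Rightarrow> 'g::topological_group_add set \<Rightarrow> 'g set \<Rightarrow>
      ((nat \<Rightarrow> 'g) \<Rightarrow> 'v) set \<Rightarrow> ((nat \<Rightarrow> 'g) \<Rightarrow> 'v) set" where
  "res_cover V q U W = cohomology_map (cover_cochains (coset_cover W) V) (cover_d (coset_cover W)) q
     (\<lambda>f. restrict f (tuples (coset_cover W) q))"

definition res_kc ::
    "'v::ab_group_add topology \<Rightarrow> nat \<Rightarrow> 'g::topological_group_add set \<Rightarrow> 'g set \<Rightarrow>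
      ((nat \<Rightarrow> 'g) \<Rightarrow> 'v) set \<Rightarrow> ((nat \<Rightarrow> 'g) \<Rightarrow> 'v) set" where
  "res_kc V q U W =
     cohomology_map (kc_cochains euclidean (coset_cover W) V) (cover_d (coset_cover W)) q
       (\<lambda>f. restrict f (tuples (coset_cover W) q))"

text \<open>The restriction to the small simplices for \<open>W\<close> does not depend on its source, so the same map
  also serves as the restriction from the singular cohomology of the whole group.\<close>

definition res_small ::
    "'v::ab_group_add topology \<Rightarrow> nat \<Rightarrow> 'g::topological_group_add set \<Rightarrow>
      (((nat \<Rightarrow> real) \<Rightarrow> 'g) \<Rightarrow> 'v) set \<Rightarrow> (((nat \<Rightarrow> real) \<Rightarrow> 'g) \<Rightarrow> 'v) set" where
  "res_small V q W =
     cohomology_map (small_cochains euclidean (coset_cover W) V) (small_d euclidean (coset_cover W)) q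
       (\<lambda>f. restrict f (small_simplices euclidean (coset_cover W) q))"

abbreviation colim_H_cover where
  "colim_H_cover \<B> V q \<equiv> colim \<B> (H_cover V q) (res_cover V q)"

abbreviation colim_H_kc where
  "colim_H_kc \<B> V q \<equiv> colim \<B> (H_kc V q) (res_kc V q)"

abbreviation colim_H_small where
  "colim_H_small \<B> V q \<equiv> colim \<B> (H_small V q) (\<lambda>U W. res_small V q W)"

subsection \<open>The comparison maps\<close>

definition kc_to_cover ::
    "'g::topological_group_add set set \<Rightarrow> 'v::ab_group_add topology \<Rightarrow> nat \<Rightarrow>
      ('g set \<times> ((nat \<Rightarrow> 'g) \<Rightarrow> 'v) set) set \<Rightarrow> ('g set \<times> ((nat \<Rightarrow> 'g) \<Rightarrow> 'v) set) set" where
  "kc_to_cover \<B> V q = colim_map \<B> (H_cover V q) (res_cover V q)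
     (\<lambda>U. cohomology_map (cover_cochains (coset_cover U) V) (cover_d (coset_cover U)) q (\<lambda>f. f))"

text \<open>Induced by \<open>C(\<lambda>\<^sup>*, V)\<close>; used both on the colimit for all cochains and on the one for the
  continuous cochains.\<close>

definition vertex_to_small ::
    "'g::topological_group_add set set \<Rightarrow> 'v::ab_group_add topology \<Rightarrow> nat \<Rightarrow>
      ('g set \<times> ((nat \<Rightarrow> 'g) \<Rightarrow> 'v) set) set \<Rightarrow>
      ('g set \<times> (((nat \<Rightarrow> real) \<Rightarrow> 'g) \<Rightarrow> 'v) set) set" where
  "vertex_to_small \<B> V q = colim_map \<B> (H_small V q) (\<lambda>U W. res_small V q W)
     (\<lambda>U. cohomology_map (small_cochains euclidean (coset_cover U) V)
            (small_d euclidean (coset_cover U)) q (vertex_map euclidean (coset_cover U) q))"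

text \<open>The canonical map from singular cohomology given by restriction to small simplices.\<close>

definition sing_to_small ::
    "'g::topological_group_add set set \<Rightarrow> 'v::ab_group_add topology \<Rightarrow> nat \<Rightarrow>
      (((nat \<Rightarrow> real) \<Rightarrow> 'g) \<Rightarrow> 'v) set \<Rightarrow> ('g set \<times> (((nat \<Rightarrow> real) \<Rightarrow> 'g) \<Rightarrow> 'v) set) set" where
  "sing_to_small \<B> V q c =
     (\<Union>U\<in>\<B>. colim_class \<B> (H_small V q) (\<lambda>U W. res_small V q W) U (res_small V q U c))"

definition vertex_to_sing ::
    "'g::topological_group_add set set \<Rightarrow> 'v::ab_group_add topology \<Rightarrow> nat \<Rightarrow>
      ('g set \<times> ((nat \<Rightarrow> 'g) \<Rightarrow> 'v) set) set \<Rightarrow> (((nat \<Rightarrow> real) \<Rightarrow> 'g) \<Rightarrow> 'v) set" where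
  "vertex_to_sing \<B> V q =
     inv_into (carrier (singular_cohomology euclidean V q)) (sing_to_small \<B> V q) \<circ>
     vertex_to_small \<B> V q"

end

theory Submission
  imports Defs
begin

text \<open>
  Fix the degree. Four cohomology groups are compared: that of all cochains on the coset coverings, that of the
  k-continuous ones, that of the cochains on small singular simplices, and singular cohomology. All comparison
  maps are induced by cochain maps, so it suffices to find inverses up to homotopy, where each inverse may go
  from the covering by cosets of \<open>U\<close> to that by cosets of a smaller \<open>W\<close> (\<open>colim_hmap_iso\<close>).

  Singular cohomology agrees with that of the small simplices for every single \<open>U\<close>, by barycentric subdivision:
  the small chains are a deformation retract of all chains (\<open>deformation_to_small_simplices\<close>,
  \<open>sing_to_small_bij\<close>).

  All cochains agree with small singular cochains because the group is locally contractible. There is a chain map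
  from tuples of points that are close to each other into small simplices: a tuple is filled degree by degree,
  each time with a chain in a slightly larger neighbourhood of its first point, in which the cycle to be filled
  bounds (\<open>close_tuples_fill\<close>). The same argument yields homotopies between its composites with taking
  vertices and the identities (\<open>close_simplices_homotopy\<close>, \<open>list_homotopy_boundary\<close>). Only finitely many
  degrees matter, so a finite tower of neighbourhoods suffices (\<open>small_fillings\<close>).

  Continuous cochains agree with all cochains because arbitrary cochains can be smoothed. The coset covering of a
  topological group is refined by the balls of a continuous pseudometric (\<open>group_pseudometric\<close>), and Stone's
  argument then provides centres and times that cut the unit interval into steps over each point
  (\<open>step_partition_exists\<close>). If \<open>\<Psi> t\<close>, for \<open>t\<close> from 0 to 1, are the endomorphisms of \<open>V\<close> given by the loop contraction,
  starting at 0 and ending at the identity, then the value \<open>v\<close> at the centre of the step from \<open>s\<close> to \<open>t\<close> enters the average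
  with weight \<open>\<Psi> t v - \<Psi> s v\<close>. Averages are additive, the average of a constant is that constant by telescoping, and the
  average over the centres near a point depends continuously on the point however wild the averaged function is.
  Averaging in every coordinate therefore commutes with the coboundary, turns any cochain into a k-continuous
  one (\<open>k_cochain_smooth\<close>), and is homotopic to the identity by a prism operator that preserves
  continuity (\<open>prism_boundary\<close>, \<open>k_cochain_prism\<close>).
\<close>

section \<open>Cohomology of cochain complexes\<close>

definition cochain_complex :: "(nat \<Rightarrow> 'c monoid) \<Rightarrow> (nat \<Rightarrow> 'c \<Rightarrow> 'c) \<Rightarrow> bool" where
  "cochain_complex C d \<longleftrightarrow> (\<forall>q. comm_group (C q)) \<and> (\<forall>q. d q \<in> hom (C q) (C (Suc q))) \<and>
     (\<forall>q. \<forall>x\<in>carrier (C q). d (Suc q) (d q x) = \<one>\<^bsub>C (Suc (Suc q))\<^esub>)"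

definition cochain_map ::
  "(nat \<Rightarrow> 'c monoid) \<Rightarrow> (nat \<Rightarrow> 'c \<Rightarrow> 'c) \<Rightarrow> (nat \<Rightarrow> 'e monoid) \<Rightarrow> (nat \<Rightarrow> 'e \<Rightarrow> 'e) \<Rightarrow>
    (nat \<Rightarrow> 'c \<Rightarrow> 'e) \<Rightarrow> bool" where
  "cochain_map C d C' d' h \<longleftrightarrow> (\<forall>q. h q \<in> hom (C q) (C' q)) \<and>
     (\<forall>q. \<forall>x\<in>carrier (C q). h (Suc q) (d q x) = d' q (h q x))"

definition cohomology_class ::
  "(nat \<Rightarrow> 'c monoid) \<Rightarrow> (nat \<Rightarrow> 'c \<Rightarrow> 'c) \<Rightarrow> nat \<Rightarrow> 'c \<Rightarrow> 'c set" where
  "cohomology_class C d q z = coboundaries C d q #>\<^bsub>C q\<^esub> z"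

lemma cochain_complexD:
  assumes "cochain_complex C d"
  shows "comm_group (C q)" "Group.group (C q)" "d q \<in> hom (C q) (C (Suc q))"
    "x \<in> carrier (C q) \<Longrightarrow> d (Suc q) (d q x) = \<one>\<^bsub>C (Suc (Suc q))\<^esub>"
  using assms unfolding cochain_complex_def comm_group_def by auto

lemma group_hom_differential:
  assumes "cochain_complex C d"
  shows "group_hom (C q) (C (Suc q)) (d q)"
  using cochain_complexD[OF assms] by (simp add: group_hom_def group_hom_axioms_def)

lemma subgroup_cocycles:
  assumes "cochain_complex C d"
  shows "subgroup (cocycles C d q) (C q)"
proof -
  interpret group_hom "C q" "C (Suc q)" "d q" by (rule group_hom_differential[OF assms])
  have "cocycles C d q = kernel (C q) (C (Suc q)) (d q)" by (simp add: cocycles_def kernel_def)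
  then show ?thesis using subgroup_kernel by simp
qed

lemma subgroup_coboundaries:
  assumes "cochain_complex C d"
  shows "subgroup (coboundaries C d q) (C q)"
proof (cases q)
  case 0
  then show ?thesis
    using group.triv_subgroup[OF cochain_complexD(2)[OF assms]] by (simp add: coboundaries_def)
next
  case (Suc p)
  interpret group_hom "C p" "C (Suc p)" "d p" by (rule group_hom_differential[OF assms])
  show ?thesis using img_is_subgroup by (simp add: Suc coboundaries_def)
qed

lemma coboundaries_subset_cocycles:
  assumes "cochain_complex C d"
  shows "coboundaries C d q \<subseteq> cocycles C d q"
proof (cases q)
  case 0
  then show ?thesis
    using subgroup.one_closed[OF subgroup_cocycles[OF assms, of 0]] by (simp add: coboundaries_def)
next
  case (Suc p)
  show ?thesis
    using cochain_complexD(4)[OF assms] hom_in_carrier[OF cochain_complexD(3)[OF assms]]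
    by (auto simp: Suc coboundaries_def cocycles_def)
qed

lemma
  assumes "cochain_complex C d"
  shows carrier_cohomology: "carrier (cohomology C d q) = cohomology_class C d q ` cocycles C d q"
    and one_cohomology: "\<one>\<^bsub>cohomology C d q\<^esub> = cohomology_class C d q \<one>\<^bsub>C q\<^esub>"
    and mult_cohomology: "\<And>z w. z \<in> cocycles C d q \<Longrightarrow> w \<in> cocycles C d q \<Longrightarrow>
      cohomology_class C d q z \<otimes>\<^bsub>cohomology C d q\<^esub> cohomology_class C d q w =
      cohomology_class C d q (z \<otimes>\<^bsub>C q\<^esub> w)"
    and comm_group_cohomology: "comm_group (cohomology C d q)"
    and cohomology_class_eq_iff: "\<And>z w. z \<in> cocycles C d q \<Longrightarrow> w \<in> cocycles C d q \<Longrightarrow>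
      cohomology_class C d q z = cohomology_class C d q w \<longleftrightarrow>
      (\<exists>b\<in>coboundaries C d q. z = b \<otimes>\<^bsub>C q\<^esub> w)"
proof -
  let ?Z = "cocycles C d q" and ?B = "coboundaries C d q"
  let ?G = "(C q)\<lparr>carrier := ?Z\<rparr>"
  note Z = subgroup_cocycles[OF assms, of q] and B = subgroup_coboundaries[OF assms, of q]
  interpret C: comm_group "C q" by (rule cochain_complexD(1)[OF assms])
  interpret G: comm_group ?G
    using subgroup.subset[OF Z] C.m_comm
    by (intro group.group_comm_groupI subgroup.subgroup_is_group[OF Z C.is_group]) auto
  have BG: "subgroup ?B ?G"
    by (rule C.subgroup_incl[OF B Z coboundaries_subset_cocycles[OF assms]])
  then have n: "?B \<lhd> ?G" by (simp add: G.normal_iff_subgroup)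
  have rc: "?B #>\<^bsub>?G\<^esub> z = cohomology_class C d q z" for z
    by (simp add: r_coset_def cohomology_class_def)
  show "carrier (cohomology C d q) = cohomology_class C d q ` ?Z"
    by (auto simp: cohomology_def carrier_FactGroup rc cohomology_class_def)
  show "\<one>\<^bsub>cohomology C d q\<^esub> = cohomology_class C d q \<one>\<^bsub>C q\<^esub>"
    using subgroup.subset[OF B] by (simp add: cohomology_def cohomology_class_def C.coset_mult_one)
  show "comm_group (cohomology C d q)"
    unfolding cohomology_def by (rule G.abelian_FactGroup[OF BG])
  show "cohomology_class C d q z \<otimes>\<^bsub>cohomology C d q\<^esub> cohomology_class C d q w =
      cohomology_class C d q (z \<otimes>\<^bsub>C q\<^esub> w)" if "z \<in> ?Z" "w \<in> ?Z" for z w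
    using normal.rcos_sum[OF n, of z w] that by (simp add: cohomology_def cohomology_class_def)
  show "cohomology_class C d q z = cohomology_class C d q w \<longleftrightarrow> (\<exists>b\<in>?B. z = b \<otimes>\<^bsub>C q\<^esub> w)"
    if zw: "z \<in> ?Z" "w \<in> ?Z" for z w
  proof -
    have "z \<in> carrier (C q)" "w \<in> carrier (C q)" using zw subgroup.subset[OF Z] by auto
    then have "cohomology_class C d q z = cohomology_class C d q w \<longleftrightarrow> z \<in> cohomology_class C d q w"
      unfolding cohomology_class_def
      by (metis C.repr_independence C.rcos_self B)
    then show ?thesis by (auto simp: cohomology_class_def r_coset_def)
  qed
qed

lemma cohomology_class_eq_one_iff:
  assumes c: "cochain_complex C d" and z: "z \<in> cocycles C d q"
  shows "cohomology_class C d q z = \<one>\<^bsub>cohomology C d q\<^esub> \<longleftrightarrow> z \<in> coboundaries C d q"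
proof -
  have one: "\<one>\<^bsub>C q\<^esub> \<in> cocycles C d q" by (rule subgroup.one_closed[OF subgroup_cocycles[OF c]])
  have "b \<otimes>\<^bsub>C q\<^esub> \<one>\<^bsub>C q\<^esub> = b" if "b \<in> coboundaries C d q" for b
    using subgroup.mem_carrier[OF subgroup_coboundaries[OF c] that]
    by (simp add: monoid.r_one[OF group.is_monoid[OF cochain_complexD(2)[OF c]]])
  then show ?thesis
    unfolding one_cohomology[OF c] cohomology_class_eq_iff[OF c z one] by metis
qed

lemma cochain_mapD:
  assumes "cochain_map C d C' d' h"
  shows "h q \<in> hom (C q) (C' q)"
    and "x \<in> carrier (C q) \<Longrightarrow> h (Suc q) (d q x) = d' q (h q x)"
  using assms unfolding cochain_map_def by auto

lemma cochain_map_cocycles: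
  assumes "cochain_complex C d" "cochain_complex C' d'" "cochain_map C d C' d' h"
    and "z \<in> cocycles C d q"
  shows "h q z \<in> cocycles C' d' q"
proof -
  have z: "z \<in> carrier (C q)" "d q z = \<one>\<^bsub>C (Suc q)\<^esub>" using assms(4) by (auto simp: cocycles_def)
  have "d' q (h q z) = h (Suc q) \<one>\<^bsub>C (Suc q)\<^esub>" using cochain_mapD(2)[OF assms(3)] z by metis
  also have "\<dots> = \<one>\<^bsub>C' (Suc q)\<^esub>"
    using cochain_mapD(1)[OF assms(3)] cochain_complexD(2)[OF assms(1)] cochain_complexD(2)[OF assms(2)]
    by (meson hom_one)
  finally show ?thesis
    using hom_in_carrier[OF cochain_mapD(1)[OF assms(3)] z(1)] by (simp add: cocycles_def)
qed

lemma cochain_map_coboundaries: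
  assumes "cochain_complex C d" "cochain_complex C' d'" "cochain_map C d C' d' h"
    and "b \<in> coboundaries C d q"
  shows "h q b \<in> coboundaries C' d' q"
proof (cases q)
  case 0
  have "h 0 \<one>\<^bsub>C 0\<^esub> = \<one>\<^bsub>C' 0\<^esub>"
    using cochain_mapD(1)[OF assms(3)] cochain_complexD(2)[OF assms(1)] cochain_complexD(2)[OF assms(2)]
    by (meson hom_one)
  then show ?thesis using assms(4) 0 by (auto simp: coboundaries_def)
next
  case (Suc p)
  then obtain a where a: "a \<in> carrier (C p)" "b = d p a" using assms(4) by (auto simp: coboundaries_def)
  then have "h q b = d' p (h p a)" using cochain_mapD(2)[OF assms(3)] Suc by simp
  then show ?thesis
    using hom_in_carrier[OF cochain_mapD(1)[OF assms(3)] a(1)] Suc by (auto simp: coboundaries_def)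
qed

lemma cohomology_map_class:
  assumes "cochain_complex C d" "cochain_complex C' d'" "cochain_map C d C' d' h"
    and z: "z \<in> cocycles C d q"
  shows "cohomology_map C' d' q (h q) (cohomology_class C d q z) = cohomology_class C' d' q (h q z)"
proof -
  let ?c = "cohomology_class C d q z"
  have zC: "z \<in> carrier (C q)" using z by (auto simp: cocycles_def)
  have "z \<in> ?c"
    unfolding cohomology_class_def
    using group.rcos_self[OF cochain_complexD(2)[OF assms(1)] zC subgroup_coboundaries[OF assms(1)]] .
  moreover have "cohomology_class C' d' q (h q w) = cohomology_class C' d' q (h q z)" if w: "w \<in> ?c" for w
  proof -
    obtain b where b: "b \<in> coboundaries C d q" "w = b \<otimes>\<^bsub>C q\<^esub> z"
      using w by (auto simp: cohomology_class_def r_coset_def)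
    have bZ: "b \<in> cocycles C d q" using b coboundaries_subset_cocycles[OF assms(1)] by blast
    then have bC: "b \<in> carrier (C q)" by (auto simp: cocycles_def)
    have wZ: "w \<in> cocycles C d q"
      using b(2) subgroup.m_closed[OF subgroup_cocycles[OF assms(1)] bZ z] by simp
    have "h q w = h q b \<otimes>\<^bsub>C' q\<^esub> h q z"
      using hom_mult[OF cochain_mapD(1)[OF assms(3)] bC zC] b(2) by simp
    moreover have "h q b \<in> coboundaries C' d' q" by (rule cochain_map_coboundaries[OF assms(1-3) b(1)])
    ultimately show ?thesis
      using cohomology_class_eq_iff[OF assms(2) cochain_map_cocycles[OF assms(1-3) wZ]
          cochain_map_cocycles[OF assms(1-3) z]] by blast
  qed
  ultimately show ?thesis
    unfolding cohomology_map_def cohomology_class_def[symmetric] by blast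
qed

lemma cohomology_map_hom:
  assumes "cochain_complex C d" "cochain_complex C' d'" "cochain_map C d C' d' h"
  shows "cohomology_map C' d' q (h q) \<in> hom (cohomology C d q) (cohomology C' d' q)"
proof (rule homI)
  fix x assume "x \<in> carrier (cohomology C d q)"
  then show "cohomology_map C' d' q (h q) x \<in> carrier (cohomology C' d' q)"
    by (auto simp: carrier_cohomology[OF assms(1)] carrier_cohomology[OF assms(2)]
        cohomology_map_class[OF assms] cochain_map_cocycles[OF assms])
next
  fix x y assume "x \<in> carrier (cohomology C d q)" "y \<in> carrier (cohomology C d q)"
  then obtain z w where z: "z \<in> cocycles C d q" "x = cohomology_class C d q z"
    and w: "w \<in> cocycles C d q" "y = cohomology_class C d q w"
    by (auto simp: carrier_cohomology[OF assms(1)])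
  have zw: "z \<otimes>\<^bsub>C q\<^esub> w \<in> cocycles C d q"
    by (rule subgroup.m_closed[OF subgroup_cocycles[OF assms(1)] z(1) w(1)])
  have "h q (z \<otimes>\<^bsub>C q\<^esub> w) = h q z \<otimes>\<^bsub>C' q\<^esub> h q w"
    by (rule hom_mult[OF cochain_mapD(1)[OF assms(3)]]) (use z(1) w(1) in \<open>auto simp: cocycles_def\<close>)
  then show "cohomology_map C' d' q (h q) (x \<otimes>\<^bsub>cohomology C d q\<^esub> y) =
      cohomology_map C' d' q (h q) x \<otimes>\<^bsub>cohomology C' d' q\<^esub> cohomology_map C' d' q (h q) y"
    using z w zw by (simp add: mult_cohomology[OF assms(1)] mult_cohomology[OF assms(2)]
        cohomology_map_class[OF assms] cochain_map_cocycles[OF assms])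
qed

section \<open>Colimits\<close>

locale direct_system =
  fixes \<B> :: "'i set set" and H :: "'i set \<Rightarrow> 'h monoid" and r :: "'i set \<Rightarrow> 'i set \<Rightarrow> 'h \<Rightarrow> 'h"
  assumes nonempty: "\<B> \<noteq> {}"
    and directed: "\<And>U W. U \<in> \<B> \<Longrightarrow> W \<in> \<B> \<Longrightarrow> \<exists>O'\<in>\<B>. O' \<subseteq> U \<and> O' \<subseteq> W"
    and comm_group_H: "\<And>U. U \<in> \<B> \<Longrightarrow> comm_group (H U)"
    and r_hom: "\<And>U W. U \<in> \<B> \<Longrightarrow> W \<in> \<B> \<Longrightarrow> W \<subseteq> U \<Longrightarrow> r U W \<in> hom (H U) (H W)"
    and r_r: "\<And>U W O' x. U \<in> \<B> \<Longrightarrow> W \<in> \<B> \<Longrightarrow> O' \<in> \<B> \<Longrightarrow> W \<subseteq> U \<Longrightarrow> O' \<subseteq> W \<Longrightarrow>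
      x \<in> carrier (H U) \<Longrightarrow> r W O' (r U W x) = r U O' x"
begin

abbreviation "cls \<equiv> colim_class \<B> H r"

lemma group_H: "U \<in> \<B> \<Longrightarrow> Group.group (H U)"
  using comm_group_H comm_group_def by blast

lemma r_carrier: "U \<in> \<B> \<Longrightarrow> W \<in> \<B> \<Longrightarrow> W \<subseteq> U \<Longrightarrow> x \<in> carrier (H U) \<Longrightarrow> r U W x \<in> carrier (H W)"
  using r_hom hom_in_carrier by metis

lemma colim_rel_iff:
  "((U, x), (W, y)) \<in> colim_rel \<B> H r \<longleftrightarrow> U \<in> \<B> \<and> x \<in> carrier (H U) \<and> W \<in> \<B> \<and> y \<in> carrier (H W) \<and>
     (\<exists>O'\<in>\<B>. O' \<subseteq> U \<and> O' \<subseteq> W \<and> r U O' x = r W O' y)"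
  by (simp add: colim_rel_def)

lemma equiv_colim_rel: "equiv (SIGMA U:\<B>. carrier (H U)) (colim_rel \<B> H r)"
proof (rule equivI)
  show "colim_rel \<B> H r \<subseteq> (SIGMA U:\<B>. carrier (H U)) \<times> (SIGMA U:\<B>. carrier (H U))"
    by (auto simp: colim_rel_def)
  show "refl_on (SIGMA U:\<B>. carrier (H U)) (colim_rel \<B> H r)"
  proof (rule refl_onI)
    fix a assume "a \<in> (SIGMA U:\<B>. carrier (H U))"
    then show "(a, a) \<in> colim_rel \<B> H r" by (cases a) (auto simp: colim_rel_iff)
  qed
  show "sym (colim_rel \<B> H r)"
  proof (rule symI)
    fix a b assume ab: "(a, b) \<in> colim_rel \<B> H r"
    obtain U x W y where eqs: "a = (U, x)" "b = (W, y)" by (cases a, cases b)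
    from ab[unfolded eqs colim_rel_iff] obtain O' where
      *: "U \<in> \<B>" "x \<in> carrier (H U)" "W \<in> \<B>" "y \<in> carrier (H W)"
      and O': "O' \<in> \<B>" "O' \<subseteq> U" "O' \<subseteq> W" "r U O' x = r W O' y" by (elim conjE bexE)
    from O' have "\<exists>O'\<in>\<B>. O' \<subseteq> W \<and> O' \<subseteq> U \<and> r W O' y = r U O' x" by (intro bexI[of _ O']) auto
    then show "(b, a) \<in> colim_rel \<B> H r" unfolding eqs colim_rel_iff using * by simp
  qed
  show "trans (colim_rel \<B> H r)"
  proof (rule transI)
    fix a b c assume abc: "(a, b) \<in> colim_rel \<B> H r" "(b, c) \<in> colim_rel \<B> H r"
    obtain U x W y Y z where eqs: "a = (U, x)" "b = (W, y)" "c = (Y, z)"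
      by (cases a, cases b, cases c)
    from abc[unfolded eqs colim_rel_iff] obtain O1 O2 where
      *: "U \<in> \<B>" "x \<in> carrier (H U)" "W \<in> \<B>" "y \<in> carrier (H W)" "Y \<in> \<B>" "z \<in> carrier (H Y)"
      and O1: "O1 \<in> \<B>" "O1 \<subseteq> U" "O1 \<subseteq> W" "r U O1 x = r W O1 y"
      and O2: "O2 \<in> \<B>" "O2 \<subseteq> W" "O2 \<subseteq> Y" "r W O2 y = r Y O2 z"
      by (elim conjE bexE)
    obtain O3 where O3: "O3 \<in> \<B>" "O3 \<subseteq> O1" "O3 \<subseteq> O2" using directed O1 O2 by meson
    have "r U O3 x = r O1 O3 (r U O1 x)" using r_r[of U O1 O3 x] * O1 O3 by simp
    also have "\<dots> = r W O3 y" unfolding O1(4) using r_r[of W O1 O3 y] * O1 O3 by simp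
    also have "\<dots> = r O2 O3 (r W O2 y)" using r_r[of W O2 O3 y] * O2 O3 by simp
    also have "\<dots> = r Y O3 z" unfolding O2(4) using r_r[of Y O2 O3 z] * O2 O3 by simp
    finally have e: "r U O3 x = r Y O3 z" .
    have "O3 \<subseteq> U" "O3 \<subseteq> Y" using O1 O2 O3 by auto
    with e O3(1) have "\<exists>O'\<in>\<B>. O' \<subseteq> U \<and> O' \<subseteq> Y \<and> r U O' x = r Y O' z" by blast
    then show "(a, c) \<in> colim_rel \<B> H r" unfolding eqs colim_rel_iff using * by simp
  qed
qed

lemma carrier_colim: "carrier (colim \<B> H r) = {cls U x | U x. U \<in> \<B> \<and> x \<in> carrier (H U)}"
  by (auto simp: colim_def quotient_def colim_class_def)

lemma cls_eq_iff:
  assumes "U \<in> \<B>" "x \<in> carrier (H U)" "W \<in> \<B>" "y \<in> carrier (H W)"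
  shows "cls U x = cls W y \<longleftrightarrow> (\<exists>O'\<in>\<B>. O' \<subseteq> U \<and> O' \<subseteq> W \<and> r U O' x = r W O' y)"
proof -
  have "cls U x = cls W y \<longleftrightarrow> ((U, x), (W, y)) \<in> colim_rel \<B> H r"
    unfolding colim_class_def by (rule eq_equiv_class_iff[OF equiv_colim_rel]) (use assms in auto)
  then show ?thesis using assms unfolding colim_rel_iff by simp
qed

lemma mem_cls:
  assumes "U \<in> \<B>" "x \<in> carrier (H U)"
  shows "(W, y) \<in> cls U x \<longleftrightarrow> W \<in> \<B> \<and> y \<in> carrier (H W) \<and> cls W y = cls U x"
proof -
  have "(W, y) \<in> cls U x \<longleftrightarrow> W \<in> \<B> \<and> y \<in> carrier (H W) \<and>
      (\<exists>O'\<in>\<B>. O' \<subseteq> U \<and> O' \<subseteq> W \<and> r U O' x = r W O' y)"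
    using assms by (simp add: colim_class_def colim_rel_iff)
  then show ?thesis using cls_eq_iff[OF assms, of W y] by (auto simp: eq_commute[of "cls W y"])
qed

lemma cls_r:
  assumes "U \<in> \<B>" "W \<in> \<B>" "W \<subseteq> U" "x \<in> carrier (H U)"
  shows "cls W (r U W x) = cls U x"
  using assms by (subst cls_eq_iff) (auto simp: r_carrier r_r intro!: bexI[of _ W])

text \<open>The product is defined as a union over all representatives and all common smaller indices. Two such
  choices agree after restriction to an index below both, so the union has a single member.\<close>

lemma mult_colim:
  assumes U: "U \<in> \<B>" "x \<in> carrier (H U)" and U': "U' \<in> \<B>" "x' \<in> carrier (H U')"
    and W: "W \<in> \<B>" "W \<subseteq> U" "W \<subseteq> U'"
  shows "cls U x \<otimes>\<^bsub>colim \<B> H r\<^esub> cls U' x' = cls W (r U W x \<otimes>\<^bsub>H W\<^esub> r U' W x')"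
proof -
  let ?S = "{cls Y (r T Y y \<otimes>\<^bsub>H Y\<^esub> r T' Y y') | T y T' y' Y.
         (T, y) \<in> cls U x \<and> (T', y') \<in> cls U' x' \<and> Y \<in> \<B> \<and> Y \<subseteq> T \<and> Y \<subseteq> T'}"
  let ?P = "cls W (r U W x \<otimes>\<^bsub>H W\<^esub> r U' W x')"
  have push: "r A D (r B A y \<otimes>\<^bsub>H A\<^esub> r B' A y') = r B D y \<otimes>\<^bsub>H D\<^esub> r B' D y'"
    if "A \<in> \<B>" "D \<in> \<B>" "B \<in> \<B>" "B' \<in> \<B>" "D \<subseteq> A" "A \<subseteq> B" "A \<subseteq> B'"
      "y \<in> carrier (H B)" "y' \<in> carrier (H B')" for A D B B' y y'
    using hom_mult[OF r_hom[of A D]] that by (simp add: r_carrier r_r)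
  have closed: "r B A y \<otimes>\<^bsub>H A\<^esub> r B' A y' \<in> carrier (H A)"
    if "A \<in> \<B>" "B \<in> \<B>" "B' \<in> \<B>" "A \<subseteq> B" "A \<subseteq> B'"
      "y \<in> carrier (H B)" "y' \<in> carrier (H B')" for A B B' y y'
    using that by (simp add: group.is_monoid[OF group_H] monoid.m_closed r_carrier)
  have "c = ?P" if c: "c \<in> ?S" for c
  proof -
    obtain T y T' y' Y where c: "c = cls Y (r T Y y \<otimes>\<^bsub>H Y\<^esub> r T' Y y')"
      and T: "(T, y) \<in> cls U x" "(T', y') \<in> cls U' x'" and Y: "Y \<in> \<B>" "Y \<subseteq> T" "Y \<subseteq> T'"
      using c by blast
    have T1: "T \<in> \<B>" "y \<in> carrier (H T)" "cls T y = cls U x" using T mem_cls[OF U] by auto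
    have T2: "T' \<in> \<B>" "y' \<in> carrier (H T')" "cls T' y' = cls U' x'" using T mem_cls[OF U'] by auto
    obtain D1 where D1: "D1 \<in> \<B>" "D1 \<subseteq> T" "D1 \<subseteq> U" "r T D1 y = r U D1 x"
      using T1 cls_eq_iff U by meson
    obtain D2 where D2: "D2 \<in> \<B>" "D2 \<subseteq> T'" "D2 \<subseteq> U'" "r T' D2 y' = r U' D2 x'"
      using T2 cls_eq_iff U' by meson
    obtain D3 where D3: "D3 \<in> \<B>" "D3 \<subseteq> D1" "D3 \<subseteq> D2" using directed D1 D2 by meson
    obtain D4 where D4: "D4 \<in> \<B>" "D4 \<subseteq> Y" "D4 \<subseteq> W" using directed Y W by meson
    obtain D where D: "D \<in> \<B>" "D \<subseteq> D3" "D \<subseteq> D4" using directed D3 D4 by meson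
    have "r T D y = r D1 D (r T D1 y)" using T1 D1 D D3 by (subst r_r) auto
    also have "\<dots> = r U D x" unfolding D1(4) using U D1 D D3 by (subst r_r) auto
    finally have e1: "r T D y = r U D x" .
    have "r T' D y' = r D2 D (r T' D2 y')" using T2 D2 D D3 by (subst r_r) auto
    also have "\<dots> = r U' D x'" unfolding D2(4) using U' D2 D D3 by (subst r_r) auto
    finally have e2: "r T' D y' = r U' D x'" .
    have DYW: "D \<subseteq> Y" "D \<subseteq> W" using D D4 by auto
    have "r Y D (r T Y y \<otimes>\<^bsub>H Y\<^esub> r T' Y y') = r W D (r U W x \<otimes>\<^bsub>H W\<^esub> r U' W x')"
      using push[of Y D T T' y y'] push[of W D U U' x x'] e1 e2 DYW Y W D T1 T2 U U' by simp
    then show ?thesis unfolding c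
      using closed[of Y T T' y y'] closed[of W U U' x x'] DYW Y W D T1 T2 U U'
      by (subst cls_eq_iff) auto
  qed
  moreover have "?P \<in> ?S"
    using W mem_cls[OF U] mem_cls[OF U'] U U' by blast
  ultimately have "?S = {?P}" by blast
  then show ?thesis by (simp add: colim_def)
qed

lemma mult_cls:
  assumes "U \<in> \<B>" "x \<in> carrier (H U)" "y \<in> carrier (H U)"
  shows "cls U x \<otimes>\<^bsub>colim \<B> H r\<^esub> cls U y = cls U (x \<otimes>\<^bsub>H U\<^esub> y)"
proof -
  have "cls U x \<otimes>\<^bsub>colim \<B> H r\<^esub> cls U y = cls U (r U U x \<otimes>\<^bsub>H U\<^esub> r U U y)"
    using assms by (intro mult_colim) auto
  also have "\<dots> = cls U (r U U (x \<otimes>\<^bsub>H U\<^esub> y))"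
    using hom_mult[OF r_hom[of U U]] assms by simp
  also have "\<dots> = cls U (x \<otimes>\<^bsub>H U\<^esub> y)"
    using assms by (simp add: cls_r group.is_monoid[OF group_H] monoid.m_closed)
  finally show ?thesis .
qed

lemma two_cls:
  assumes "P \<in> carrier (colim \<B> H r)" "Q \<in> carrier (colim \<B> H r)"
  obtains U x y where "U \<in> \<B>" "x \<in> carrier (H U)" "y \<in> carrier (H U)" "P = cls U x" "Q = cls U y"
proof -
  obtain U x where U: "U \<in> \<B>" "x \<in> carrier (H U)" "P = cls U x"
    using assms by (auto simp: carrier_colim)
  obtain W y where W: "W \<in> \<B>" "y \<in> carrier (H W)" "Q = cls W y"
    using assms by (auto simp: carrier_colim)
  obtain Y where Y: "Y \<in> \<B>" "Y \<subseteq> U" "Y \<subseteq> W" using directed U W by meson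
  show ?thesis
    by (rule that[of Y "r U Y x" "r W Y y"]) (use U W Y in \<open>auto simp: r_carrier cls_r\<close>)
qed

lemma mult_closed_colim:
  assumes "P \<in> carrier (colim \<B> H r)" "Q \<in> carrier (colim \<B> H r)"
  shows "P \<otimes>\<^bsub>colim \<B> H r\<^esub> Q \<in> carrier (colim \<B> H r)"
proof -
  obtain U x y where U: "U \<in> \<B>" "x \<in> carrier (H U)" "y \<in> carrier (H U)" and PQ: "P = cls U x" "Q = cls U y"
    using assms by (rule two_cls)
  have "x \<otimes>\<^bsub>H U\<^esub> y \<in> carrier (H U)" by (rule monoid.m_closed[OF group.is_monoid[OF group_H[OF U(1)]] U(2,3)])
  then show ?thesis unfolding PQ mult_cls[OF U] carrier_colim using U(1) by blast
qed

end

lemma colim_map_class: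
  fixes H :: "'i set \<Rightarrow> 'h monoid" and H' :: "'i set \<Rightarrow> 'k monoid"
  assumes "direct_system \<B> H r" "direct_system \<B> H' r'"
    and f_hom: "\<And>U. U \<in> \<B> \<Longrightarrow> f U \<in> hom (H U) (H' U)"
    and f_r: "\<And>U W x. U \<in> \<B> \<Longrightarrow> W \<in> \<B> \<Longrightarrow> W \<subseteq> U \<Longrightarrow> x \<in> carrier (H U) \<Longrightarrow> f W (r U W x) = r' U W (f U x)"
    and U: "U \<in> \<B>" "x \<in> carrier (H U)"
  shows "colim_map \<B> H' r' f (colim_class \<B> H r U x) = colim_class \<B> H' r' U (f U x)"
proof -
  interpret S: direct_system \<B> H r by fact
  interpret S': direct_system \<B> H' r' by fact
  have fc: "f U x \<in> carrier (H' U)" if "U \<in> \<B>" "x \<in> carrier (H U)" for U x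
    using f_hom that hom_in_carrier by metis
  have "S'.cls W (f W y) = S'.cls U (f U x)" if W: "(W, y) \<in> S.cls U x" for W y
  proof -
    have W: "W \<in> \<B>" "y \<in> carrier (H W)" "S.cls W y = S.cls U x" using W S.mem_cls[OF U] by auto
    then obtain D where D: "D \<in> \<B>" "D \<subseteq> W" "D \<subseteq> U" "r W D y = r U D x"
      using S.cls_eq_iff U by meson
    have "r' W D (f W y) = r' U D (f U x)" using f_r[of W D y] f_r[of U D x] U W D by simp
    then show ?thesis using U W D fc by (subst S'.cls_eq_iff) auto
  qed
  moreover have "(U, x) \<in> S.cls U x" using S.mem_cls U by auto
  ultimately show ?thesis unfolding colim_map_def by fast
qed

text \<open>Both criteria allow a passage to a smaller index. For injectivity, two elements with the same image are
  first brought to one index where their images agree; then the second criterion kills their difference.\<close>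

lemma colim_map_iso:
  fixes H :: "'i set \<Rightarrow> 'h monoid" and H' :: "'i set \<Rightarrow> 'k monoid"
  assumes "direct_system \<B> H r" "direct_system \<B> H' r'"
    and f_hom: "\<And>U. U \<in> \<B> \<Longrightarrow> f U \<in> hom (H U) (H' U)"
    and f_r: "\<And>U W x. U \<in> \<B> \<Longrightarrow> W \<in> \<B> \<Longrightarrow> W \<subseteq> U \<Longrightarrow> x \<in> carrier (H U) \<Longrightarrow> f W (r U W x) = r' U W (f U x)"
    and surj: "\<And>U y. U \<in> \<B> \<Longrightarrow> y \<in> carrier (H' U) \<Longrightarrow>
      \<exists>W\<in>\<B>. W \<subseteq> U \<and> (\<exists>x\<in>carrier (H W). f W x = r' U W y)"
    and inj: "\<And>U x. U \<in> \<B> \<Longrightarrow> x \<in> carrier (H U) \<Longrightarrow> f U x = \<one>\<^bsub>H' U\<^esub> \<Longrightarrow>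
      \<exists>W\<in>\<B>. W \<subseteq> U \<and> r U W x = \<one>\<^bsub>H W\<^esub>"
  shows "colim_map \<B> H' r' f \<in> iso (colim \<B> H r) (colim \<B> H' r')"
proof -
  interpret S: direct_system \<B> H r by fact
  interpret S': direct_system \<B> H' r' by fact
  have fc: "f U x \<in> carrier (H' U)" if "U \<in> \<B>" "x \<in> carrier (H U)" for U x
    using f_hom that hom_in_carrier by metis
  have cm: "colim_map \<B> H' r' f (S.cls U x) = S'.cls U (f U x)"
    if "U \<in> \<B>" "x \<in> carrier (H U)" for U x
    by (rule colim_map_class[OF assms(1,2) _ _ that]) (fact f_hom f_r)+
  have hom: "colim_map \<B> H' r' f \<in> hom (colim \<B> H r) (colim \<B> H' r')"
  proof (rule homI)
    fix P assume "P \<in> carrier (colim \<B> H r)"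
    then obtain U x where U: "U \<in> \<B>" "x \<in> carrier (H U)" "P = S.cls U x"
      unfolding S.carrier_colim by blast
    show "colim_map \<B> H' r' f P \<in> carrier (colim \<B> H' r')"
      unfolding U(3) cm[OF U(1,2)] S'.carrier_colim using U(1) fc[OF U(1,2)] by blast
  next
    fix P Q assume "P \<in> carrier (colim \<B> H r)" "Q \<in> carrier (colim \<B> H r)"
    then obtain U x y where U: "U \<in> \<B>" "x \<in> carrier (H U)" "y \<in> carrier (H U)"
      and PQ: "P = S.cls U x" "Q = S.cls U y" by (rule S.two_cls)
    have xy: "x \<otimes>\<^bsub>H U\<^esub> y \<in> carrier (H U)"
      by (rule monoid.m_closed[OF group.is_monoid[OF S.group_H[OF U(1)]] U(2,3)])
    have "colim_map \<B> H' r' f (P \<otimes>\<^bsub>colim \<B> H r\<^esub> Q) = S'.cls U (f U (x \<otimes>\<^bsub>H U\<^esub> y))"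
      unfolding PQ S.mult_cls[OF U] by (rule cm[OF U(1) xy])
    also have "\<dots> = S'.cls U (f U x) \<otimes>\<^bsub>colim \<B> H' r'\<^esub> S'.cls U (f U y)"
      unfolding hom_mult[OF f_hom[OF U(1)] U(2,3)]
      by (rule S'.mult_cls[symmetric, OF U(1) fc[OF U(1,2)] fc[OF U(1,3)]])
    also have "\<dots> = colim_map \<B> H' r' f P \<otimes>\<^bsub>colim \<B> H' r'\<^esub> colim_map \<B> H' r' f Q"
      unfolding PQ cm[OF U(1,2)] cm[OF U(1,3)] ..
    finally show "colim_map \<B> H' r' f (P \<otimes>\<^bsub>colim \<B> H r\<^esub> Q) =
        colim_map \<B> H' r' f P \<otimes>\<^bsub>colim \<B> H' r'\<^esub> colim_map \<B> H' r' f Q" .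
  qed
  have "inj_on (colim_map \<B> H' r' f) (carrier (colim \<B> H r))"
  proof (rule inj_onI)
    fix P Q assume "P \<in> carrier (colim \<B> H r)" "Q \<in> carrier (colim \<B> H r)"
      and eq: "colim_map \<B> H' r' f P = colim_map \<B> H' r' f Q"
    then obtain U x y where U: "U \<in> \<B>" "x \<in> carrier (H U)" "y \<in> carrier (H U)"
      and PQ: "P = S.cls U x" "Q = S.cls U y" using S.two_cls by metis
    have "S'.cls U (f U x) = S'.cls U (f U y)" using eq PQ cm U by simp
    then obtain W where W: "W \<in> \<B>" "W \<subseteq> U" "r' U W (f U x) = r' U W (f U y)"
      using S'.cls_eq_iff[of U "f U x" U "f U y"] U fc by auto
    let ?x = "r U W x" and ?y = "r U W y"
    have xy: "?x \<in> carrier (H W)" "?y \<in> carrier (H W)" using U W S.r_carrier by auto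
    interpret HW: comm_group "H W" by (rule S.comm_group_H[OF W(1)])
    interpret HW': comm_group "H' W" by (rule S'.comm_group_H[OF W(1)])
    interpret fW: group_hom "H W" "H' W" "f W"
      by (simp add: group_hom_def group_hom_axioms_def f_hom W HW.is_group HW'.is_group)
    have "f W ?x = f W ?y" using f_r U W by simp
    then have "f W (?x \<otimes>\<^bsub>H W\<^esub> inv\<^bsub>H W\<^esub> ?y) = \<one>\<^bsub>H' W\<^esub>" using xy by simp
    then obtain Y where Y: "Y \<in> \<B>" "Y \<subseteq> W" "r W Y (?x \<otimes>\<^bsub>H W\<^esub> inv\<^bsub>H W\<^esub> ?y) = \<one>\<^bsub>H Y\<^esub>"
      using inj[OF W(1), of "?x \<otimes>\<^bsub>H W\<^esub> inv\<^bsub>H W\<^esub> ?y"] xy by auto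
    interpret rW: group_hom "H W" "H Y" "r W Y"
      using W Y by (simp add: group_hom_def group_hom_axioms_def S.r_hom S.group_H)
    have "r W Y ?x = r W Y ?y"
      using Y(3) xy by (simp add: group.inv_solve_right'[OF S.group_H[OF Y(1)]])
    then have "r U Y x = r U Y y" using U W Y S.r_r by auto
    then show "P = Q" unfolding PQ using U W Y by (subst S.cls_eq_iff) auto
  qed
  moreover have "colim_map \<B> H' r' f ` carrier (colim \<B> H r) = carrier (colim \<B> H' r')"
  proof
    show "colim_map \<B> H' r' f ` carrier (colim \<B> H r) \<subseteq> carrier (colim \<B> H' r')"
      using hom by (auto simp: hom_def)
    show "carrier (colim \<B> H' r') \<subseteq> colim_map \<B> H' r' f ` carrier (colim \<B> H r)"
    proof
      fix Q assume "Q \<in> carrier (colim \<B> H' r')"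
      then obtain U y where U: "U \<in> \<B>" "y \<in> carrier (H' U)" "Q = S'.cls U y"
        by (auto simp: S'.carrier_colim)
      then obtain W x where W: "W \<in> \<B>" "W \<subseteq> U" "x \<in> carrier (H W)" "f W x = r' U W y"
        using surj by meson
      have "Q = colim_map \<B> H' r' f (S.cls W x)"
        using U W by (simp add: cm S'.cls_r)
      moreover have "S.cls W x \<in> carrier (colim \<B> H r)" using W S.carrier_colim by auto
      ultimately show "Q \<in> colim_map \<B> H' r' f ` carrier (colim \<B> H r)" by blast
    qed
  qed
  ultimately show ?thesis using hom by (simp add: iso_def bij_betw_def)
qed

text \<open>If \<open>K\<close> maps isomorphically and compatibly to every term, then the transition maps that matter are
  isomorphisms too, and any single index already computes the colimit.\<close>

lemma constant_to_colim_iso: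
  fixes K :: "'k monoid" and H :: "'i set \<Rightarrow> 'h monoid"
  assumes "direct_system \<B> H r"
    and f_hom: "\<And>U. U \<in> \<B> \<Longrightarrow> f U \<in> hom K (H U)"
    and f_r: "\<And>U W x. U \<in> \<B> \<Longrightarrow> W \<in> \<B> \<Longrightarrow> W \<subseteq> U \<Longrightarrow> x \<in> carrier K \<Longrightarrow> r U W (f U x) = f W x"
    and bij: "\<And>U. U \<in> \<B> \<Longrightarrow> bij_betw (f U) (carrier K) (carrier (H U))"
    and K: "Group.group K"
  shows "(\<lambda>x. \<Union>U\<in>\<B>. colim_class \<B> H r U (f U x)) \<in> iso K (colim \<B> H r)"
proof -
  interpret S: direct_system \<B> H r by fact
  let ?F = "\<lambda>x. \<Union>U\<in>\<B>. S.cls U (f U x)"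
  have fc: "f U x \<in> carrier (H U)" if "U \<in> \<B>" "x \<in> carrier K" for U x
    using f_hom that hom_in_carrier by metis
  have F: "?F x = S.cls U (f U x)" if U: "U \<in> \<B>" and x: "x \<in> carrier K" for U x
  proof -
    have "S.cls W (f W x) = S.cls U (f U x)" if W: "W \<in> \<B>" for W
    proof -
      obtain D where D: "D \<in> \<B>" "D \<subseteq> W" "D \<subseteq> U" using S.directed W U by meson
      have "r W D (f W x) = r U D (f U x)" using f_r[OF W D(1,2) x] f_r[OF U D(1,3) x] by simp
      then show ?thesis
        unfolding S.cls_eq_iff[OF W fc[OF W x] U fc[OF U x]] using D by (intro bexI[of _ D]) auto
    qed
    then show ?thesis using U by blast
  qed
  obtain U0 where U0: "U0 \<in> \<B>" using S.nonempty by blast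
  have hom: "?F \<in> hom K (colim \<B> H r)"
  proof (rule homI)
    fix x assume "x \<in> carrier K"
    then show "?F x \<in> carrier (colim \<B> H r)"
      unfolding F[OF U0 \<open>x \<in> carrier K\<close>] S.carrier_colim using U0 fc[OF U0] by blast
  next
    fix x y assume "x \<in> carrier K" "y \<in> carrier K"
    then show "?F (x \<otimes>\<^bsub>K\<^esub> y) = ?F x \<otimes>\<^bsub>colim \<B> H r\<^esub> ?F y"
      using F[OF U0] S.mult_cls[OF U0 fc[OF U0] fc[OF U0]] hom_mult[OF f_hom[OF U0]]
        monoid.m_closed[OF group.is_monoid[OF K]]
      by presburger
  qed
  have "inj_on ?F (carrier K)"
  proof (rule inj_onI)
    fix x y assume xy: "x \<in> carrier K" "y \<in> carrier K" and "?F x = ?F y"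
    then have "S.cls U0 (f U0 x) = S.cls U0 (f U0 y)" using F[OF U0] by simp
    then obtain W where W: "W \<in> \<B>" "W \<subseteq> U0" "r U0 W (f U0 x) = r U0 W (f U0 y)"
      using S.cls_eq_iff U0 fc xy by meson
    then have "f W x = f W y" using f_r[OF U0] xy by simp
    then show "x = y" using bij[OF W(1)] xy unfolding bij_betw_def inj_on_def by blast
  qed
  moreover have "carrier (colim \<B> H r) \<subseteq> ?F ` carrier K"
  proof
    fix Q assume "Q \<in> carrier (colim \<B> H r)"
    then obtain U y where U: "U \<in> \<B>" "y \<in> carrier (H U)" "Q = S.cls U y" by (auto simp: S.carrier_colim)
    then obtain x where "x \<in> carrier K" "y = f U x" using bij[OF U(1)] unfolding bij_betw_def by blast
    then show "Q \<in> ?F ` carrier K" using F U by blast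
  qed
  ultimately show ?thesis using hom by (auto simp: iso_def bij_betw_def hom_def)
qed

lemma iso_cong_carrier:
  assumes f: "f \<in> iso G H" and eq: "\<And>x. x \<in> carrier G \<Longrightarrow> g x = f x"
    and closed: "\<And>x y. x \<in> carrier G \<Longrightarrow> y \<in> carrier G \<Longrightarrow> x \<otimes>\<^bsub>G\<^esub> y \<in> carrier G"
  shows "g \<in> iso G H"
proof -
  have "g \<in> hom G H" using f eq closed by (auto simp: iso_def hom_def Pi_iff)
  moreover have "bij_betw g (carrier G) (carrier H)"
    using f eq bij_betw_cong[of "carrier G" g f] by (simp add: iso_def)
  ultimately show ?thesis by (simp add: iso_def)
qed

section \<open>Colimits of cohomology groups\<close>

text \<open>A restriction map \<open>\<rho> W q\<close> is indexed by its target alone: restricting a function depends on the new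
  domain only.\<close>

locale system_of_complexes =
  fixes \<B> :: "'i set set" and C :: "'i set \<Rightarrow> nat \<Rightarrow> 'c monoid" and d :: "'i set \<Rightarrow> nat \<Rightarrow> 'c \<Rightarrow> 'c"
    and \<rho> :: "'i set \<Rightarrow> nat \<Rightarrow> 'c \<Rightarrow> 'c"
  assumes B_nonempty: "\<B> \<noteq> {}"
    and B_directed: "\<And>U W. U \<in> \<B> \<Longrightarrow> W \<in> \<B> \<Longrightarrow> \<exists>O'\<in>\<B>. O' \<subseteq> U \<and> O' \<subseteq> W"
    and complex: "\<And>U. U \<in> \<B> \<Longrightarrow> cochain_complex (C U) (d U)"
    and restriction: "\<And>U W. U \<in> \<B> \<Longrightarrow> W \<in> \<B> \<Longrightarrow> W \<subseteq> U \<Longrightarrow> cochain_map (C U) (d U) (C W) (d W) (\<rho> W)"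
    and restriction_restriction: "\<And>U W O' q x. U \<in> \<B> \<Longrightarrow> W \<in> \<B> \<Longrightarrow> O' \<in> \<B> \<Longrightarrow> W \<subseteq> U \<Longrightarrow> O' \<subseteq> W \<Longrightarrow>
      x \<in> carrier (C U q) \<Longrightarrow> \<rho> O' q (\<rho> W q x) = \<rho> O' q x"
begin

abbreviation "HH q U \<equiv> cohomology (C U) (d U) q"
abbreviation "res q U W \<equiv> cohomology_map (C W) (d W) q (\<rho> W q)"

lemma direct_system_cohomology: "direct_system \<B> (HH q) (res q)"
proof (rule direct_system.intro)
  show "\<B> \<noteq> {}" by (rule B_nonempty)
  show "\<exists>O'\<in>\<B>. O' \<subseteq> U \<and> O' \<subseteq> W" if "U \<in> \<B>" "W \<in> \<B>" for U W using that by (rule B_directed)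
  show "comm_group (HH q U)" if "U \<in> \<B>" for U by (rule comm_group_cohomology[OF complex[OF that]])
  show "res q U W \<in> hom (HH q U) (HH q W)" if "U \<in> \<B>" "W \<in> \<B>" "W \<subseteq> U" for U W
    by (rule cohomology_map_hom[OF complex complex restriction]) (use that in auto)
  show "res q W O' (res q U W x) = res q U O' x"
    if U: "U \<in> \<B>" "W \<in> \<B>" "O' \<in> \<B>" "W \<subseteq> U" "O' \<subseteq> W" and x: "x \<in> carrier (HH q U)" for U W O' x
  proof -
    obtain z where z: "z \<in> cocycles (C U) (d U) q" "x = cohomology_class (C U) (d U) q z"
      using x by (auto simp: carrier_cohomology[OF complex[OF U(1)]])
    have OU: "O' \<subseteq> U" using U by blast
    note m1 = cohomology_map_class[OF complex complex restriction, OF U(1,2) U(1,2,4) z(1)]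
    note m2 = cohomology_map_class[OF complex complex restriction, OF U(2,3) U(2,3,5)
        cochain_map_cocycles[OF complex complex restriction, OF U(1,2) U(1,2,4) z(1)]]
    note m3 = cohomology_map_class[OF complex complex restriction, OF U(1,3) U(1,3) OU z(1)]
    show ?thesis
      unfolding z(2) m1 m2 m3 using restriction_restriction[OF U] z(1) by (simp add: cocycles_def)
  qed
qed

end

locale natural_cochain_map =
  S: system_of_complexes \<B> C d \<rho> + S': system_of_complexes \<B> C' d' \<rho>'
  for \<B> :: "'i set set" and C :: "'i set \<Rightarrow> nat \<Rightarrow> 'c monoid" and d \<rho>
    and C' :: "'i set \<Rightarrow> nat \<Rightarrow> 'e monoid" and d' \<rho>' +
  fixes h :: "'i set \<Rightarrow> nat \<Rightarrow> 'c \<Rightarrow> 'e"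
  assumes h: "\<And>U. U \<in> \<B> \<Longrightarrow> cochain_map (C U) (d U) (C' U) (d' U) (h U)"
    and natural: "\<And>U W q x. U \<in> \<B> \<Longrightarrow> W \<in> \<B> \<Longrightarrow> W \<subseteq> U \<Longrightarrow> x \<in> carrier (C U q) \<Longrightarrow>
      h W q (\<rho> W q x) = \<rho>' W q (h U q x)"
begin

abbreviation "hmap q U \<equiv> cohomology_map (C' U) (d' U) q (h U q)"

lemma hmap_hom: "U \<in> \<B> \<Longrightarrow> hmap q U \<in> hom (S.HH q U) (S'.HH q U)"
  by (rule cohomology_map_hom[OF S.complex S'.complex h])

lemma hmap_natural:
  assumes U: "U \<in> \<B>" "W \<in> \<B>" "W \<subseteq> U" and x: "x \<in> carrier (S.HH q U)"
  shows "hmap q W (S.res q U W x) = S'.res q U W (hmap q U x)"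
proof -
  obtain z where z: "z \<in> cocycles (C U) (d U) q" "x = cohomology_class (C U) (d U) q z"
    using x by (auto simp: carrier_cohomology[OF S.complex[OF U(1)]])
  note c1 = cochain_map_cocycles[OF S.complex S.complex S.restriction, OF U(1,2) U z(1)]
  note c2 = cochain_map_cocycles[OF S.complex S'.complex h, OF U(1) U(1) U(1) z(1)]
  note m1 = cohomology_map_class[OF S.complex S.complex S.restriction, OF U(1,2) U z(1)]
  note m2 = cohomology_map_class[OF S.complex S'.complex h, OF U(2) U(2) U(2) c1]
  note m3 = cohomology_map_class[OF S.complex S'.complex h, OF U(1) U(1) U(1) z(1)]
  note m4 = cohomology_map_class[OF S'.complex S'.complex S'.restriction, OF U(1,2) U c2]
  show ?thesis
    unfolding z(2) m1 m2 m3 m4 using natural[OF U] z(1) by (simp add: cocycles_def)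
qed

text \<open>The criteria of \<open>colim_map_iso\<close> for maps induced by cochain maps, read off on cocycles.\<close>

lemma colim_hmap_iso:
  assumes surj: "\<And>U z. U \<in> \<B> \<Longrightarrow> z \<in> cocycles (C' U) (d' U) q \<Longrightarrow>
      \<exists>W\<in>\<B>. W \<subseteq> U \<and> (\<exists>x\<in>cocycles (C W) (d W) q. \<exists>b\<in>coboundaries (C' W) (d' W) q.
        h W q x = b \<otimes>\<^bsub>C' W q\<^esub> \<rho>' W q z)"
    and inj: "\<And>U x. U \<in> \<B> \<Longrightarrow> x \<in> cocycles (C U) (d U) q \<Longrightarrow> h U q x \<in> coboundaries (C' U) (d' U) q \<Longrightarrow>
      \<exists>W\<in>\<B>. W \<subseteq> U \<and> \<rho> W q x \<in> coboundaries (C W) (d W) q"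
  shows "colim_map \<B> (S'.HH q) (S'.res q) (hmap q) \<in> iso (colim \<B> (S.HH q) (S.res q)) (colim \<B> (S'.HH q) (S'.res q))"
proof (rule colim_map_iso[OF S.direct_system_cohomology S'.direct_system_cohomology])
  show "hmap q U \<in> hom (S.HH q U) (S'.HH q U)" if "U \<in> \<B>" for U
    using that by (rule hmap_hom)
  show "hmap q W (S.res q U W x) = S'.res q U W (hmap q U x)"
    if "U \<in> \<B>" "W \<in> \<B>" "W \<subseteq> U" "x \<in> carrier (S.HH q U)" for U W x
    using that by (rule hmap_natural)
  fix U y assume U: "U \<in> \<B>" and "y \<in> carrier (S'.HH q U)"
  then obtain z where z: "z \<in> cocycles (C' U) (d' U) q" "y = cohomology_class (C' U) (d' U) q z"
    by (auto simp: carrier_cohomology[OF S'.complex])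
  obtain W x b where W: "W \<in> \<B>" "W \<subseteq> U" and x: "x \<in> cocycles (C W) (d W) q"
    and b: "b \<in> coboundaries (C' W) (d' W) q" "h W q x = b \<otimes>\<^bsub>C' W q\<^esub> \<rho>' W q z"
    using surj[OF U z(1)] by blast
  have "hmap q W (cohomology_class (C W) (d W) q x) = cohomology_class (C' W) (d' W) q (h W q x)"
    by (rule cohomology_map_class[OF S.complex S'.complex h, OF W(1) W(1) W(1) x])
  also have "\<dots> = cohomology_class (C' W) (d' W) q (\<rho>' W q z)"
    unfolding cohomology_class_eq_iff[OF S'.complex[OF W(1)]
      cochain_map_cocycles[OF S.complex S'.complex h, OF W(1) W(1) W(1) x]
      cochain_map_cocycles[OF S'.complex S'.complex S'.restriction, OF U W(1) U W z(1)]]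
    using b by blast
  also have "\<dots> = S'.res q U W y"
    unfolding z(2) by (rule cohomology_map_class[symmetric, OF S'.complex S'.complex S'.restriction, OF U W(1) U W z(1)])
  finally have "hmap q W (cohomology_class (C W) (d W) q x) = S'.res q U W y" .
  moreover have "cohomology_class (C W) (d W) q x \<in> carrier (S.HH q W)"
    using x by (auto simp: carrier_cohomology[OF S.complex[OF W(1)]])
  ultimately show "\<exists>W\<in>\<B>. W \<subseteq> U \<and> (\<exists>x\<in>carrier (S.HH q W). hmap q W x = S'.res q U W y)" using W by blast
next
  fix U x assume U: "U \<in> \<B>" and "x \<in> carrier (S.HH q U)" and h0: "hmap q U x = \<one>\<^bsub>S'.HH q U\<^esub>"
  then obtain z where z: "z \<in> cocycles (C U) (d U) q" "x = cohomology_class (C U) (d U) q z"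
    by (auto simp: carrier_cohomology[OF S.complex])
  note hz = cochain_map_cocycles[OF S.complex S'.complex h, OF U U U z(1)]
  have "h U q z \<in> coboundaries (C' U) (d' U) q"
    using h0 unfolding z(2) cohomology_map_class[OF S.complex S'.complex h, OF U U U z(1)]
      cohomology_class_eq_one_iff[OF S'.complex[OF U] hz] .
  then obtain W where W: "W \<in> \<B>" "W \<subseteq> U" "\<rho> W q z \<in> coboundaries (C W) (d W) q"
    using inj[OF U z(1)] by blast
  have "S.res q U W x = \<one>\<^bsub>S.HH q W\<^esub>"
    unfolding z(2) cohomology_map_class[OF S.complex S.complex S.restriction, OF U W(1) U W(1,2) z(1)]
      cohomology_class_eq_one_iff[OF S.complex[OF W(1)] cochain_map_cocycles[OF S.complex S.complex S.restriction, OF U W(1) U W(1,2) z(1)]]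
    by (rule W(3))
  then show "\<exists>W\<in>\<B>. W \<subseteq> U \<and> S.res q U W x = \<one>\<^bsub>S.HH q W\<^esub>" using W by blast
qed

end


section \<open>Evaluating cochains on chains\<close>

text \<open>The action of the integers on an abelian group. One of the two sums is empty, since \<open>nat\<close> truncates;
  the difference form makes additivity in \<open>k\<close> a computation with natural numbers.\<close>

definition int_scale :: "int \<Rightarrow> 'v::ab_group_add \<Rightarrow> 'v" where
  "int_scale k v = (\<Sum>i<nat k. v) - (\<Sum>i<nat (- k). v)"

lemma int_scale_diff_of_nat: "int_scale (int a - int b) v = (\<Sum>i<a. v) - (\<Sum>i<b. v)"
proof -
  have add: "(\<Sum>i<m + n. v) = (\<Sum>i<m. v) + (\<Sum>i<n. v)" for m n :: nat
    by (induction n) (simp_all add: algebra_simps)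
  show ?thesis
  proof (cases "a \<le> b")
    case True
    then obtain c where "b = a + c" by (metis le_iff_add)
    then show ?thesis by (simp add: int_scale_def add)
  next
    case False
    then obtain c where "a = b + c" by (metis le_iff_add nat_le_linear)
    then show ?thesis by (simp add: int_scale_def add)
  qed
qed

lemma int_scale_simps [simp]:
  "int_scale 0 v = 0" "int_scale 1 v = v" "int_scale k 0 = 0" "int_scale (- 1) v = - v"
  by (simp_all add: int_scale_def)

lemma int_scale_add: "int_scale (j + k) v = int_scale j v + int_scale k v"
proof -
  obtain a b where j: "j = int a - int b" by (rule int_diff_cases)
  obtain c d where k: "k = int c - int d" by (rule int_diff_cases)
  have "j + k = int (a + c) - int (b + d)" by (simp add: j k)
  moreover have "(\<Sum>i<m + n. v) = (\<Sum>i<m. v) + (\<Sum>i<n. v)" for m n :: nat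
    by (induction n) (simp_all add: algebra_simps)
  ultimately show ?thesis by (simp only: int_scale_diff_of_nat j k) (simp add: algebra_simps)
qed

lemma int_scale_add_right: "int_scale k (v + w) = int_scale k v + int_scale k w"
  by (simp add: int_scale_def sum.distrib algebra_simps)

text \<open>The pairing of a cochain with a chain of the free abelian group. Chain maps and chain homotopies are
  constructed on chains and carried over to \<open>V\<close>-valued cochains by this pairing.\<close>

definition frag_eval :: "('i \<Rightarrow> 'v::ab_group_add) \<Rightarrow> ('i \<Rightarrow>\<^sub>0 int) \<Rightarrow> 'v" where
  "frag_eval f c = (\<Sum>i\<in>Poly_Mapping.keys c. int_scale (Poly_Mapping.lookup c i) (f i))"

lemma frag_eval_superset:
  assumes "finite S" "Poly_Mapping.keys c \<subseteq> S"
  shows "frag_eval f c = (\<Sum>i\<in>S. int_scale (Poly_Mapping.lookup c i) (f i))"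
  unfolding frag_eval_def
  by (rule sum.mono_neutral_left) (use assms in \<open>auto simp: in_keys_iff\<close>)

lemma frag_eval_0 [simp]: "frag_eval f 0 = 0"
  by (simp add: frag_eval_def)

lemma frag_eval_of [simp]: "frag_eval f (frag_of i) = f i"
  by (simp add: frag_eval_def)

lemma frag_eval_add: "frag_eval f (a + b) = frag_eval f a + frag_eval f b"
proof -
  let ?S = "Poly_Mapping.keys a \<union> Poly_Mapping.keys b"
  have "frag_eval f (a + b) = (\<Sum>i\<in>?S. int_scale (Poly_Mapping.lookup (a + b) i) (f i))"
    by (rule frag_eval_superset) (use keys_add[of a b] in auto)
  also have "\<dots> = (\<Sum>i\<in>?S. int_scale (Poly_Mapping.lookup a i) (f i)) + (\<Sum>i\<in>?S. int_scale (Poly_Mapping.lookup b i) (f i))"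
    by (simp add: lookup_add int_scale_add sum.distrib)
  also have "\<dots> = frag_eval f a + frag_eval f b"
    by (simp add: frag_eval_superset[of ?S])
  finally show ?thesis .
qed

lemma frag_eval_minus: "frag_eval f (- a) = - frag_eval f a"
  using frag_eval_add[of f a "- a"] by (simp add: eq_neg_iff_add_eq_0 add.commute)

lemma frag_eval_diff: "frag_eval f (a - b) = frag_eval f a - frag_eval f b"
  using frag_eval_add[of f a "- b"] by (simp add: frag_eval_minus)

lemma frag_eval_sum: "frag_eval f (\<Sum>i\<in>I. g i) = (\<Sum>i\<in>I. frag_eval f (g i))"
  by (induction I rule: infinite_finite_induct) (simp_all add: frag_eval_add)

lemma frag_eval_sign: "frag_eval f (frag_cmul ((- 1) ^ j) c) = (if even j then frag_eval f c else - frag_eval f c)"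
  by (simp add: frag_eval_minus)

lemma frag_eval_cong:
  "(\<And>i. i \<in> Poly_Mapping.keys c \<Longrightarrow> f i = g i) \<Longrightarrow> frag_eval f c = frag_eval g c"
  by (simp add: frag_eval_def)

lemma frag_eval_eq_0: "(\<And>i. i \<in> Poly_Mapping.keys c \<Longrightarrow> f i = 0) \<Longrightarrow> frag_eval f c = 0"
  by (simp add: frag_eval_def)

lemma frag_eval_add_fun: "frag_eval (\<lambda>i. f i + g i) c = frag_eval f c + frag_eval g c"
  by (simp add: frag_eval_def int_scale_add_right sum.distrib)

lemma frag_eval_uminus_fun: "frag_eval (\<lambda>i. - f i) c = - frag_eval f c"
  using frag_eval_add_fun[of f "\<lambda>i. - f i" c] by (simp add: frag_eval_eq_0 eq_neg_iff_add_eq_0 add.commute)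

lemma frag_eval_extend: "frag_eval f (frag_extend T c) = frag_eval (\<lambda>i. frag_eval f (T i)) c"
proof (rule frag_induction[of c UNIV])
  show "frag_eval f (frag_extend T (a - b)) = frag_eval (\<lambda>i. frag_eval f (T i)) (a - b)"
    if "frag_eval f (frag_extend T a) = frag_eval (\<lambda>i. frag_eval f (T i)) a"
      "frag_eval f (frag_extend T b) = frag_eval (\<lambda>i. frag_eval f (T i)) b" for a b
    using that by (simp add: frag_extend_diff frag_eval_diff)
qed auto

lemma frag_extend_extend: "frag_extend f (frag_extend T c) = frag_extend (\<lambda>i. frag_extend f (T i)) c"
proof (rule frag_induction[of c UNIV])
  show "frag_extend f (frag_extend T (a - b)) = frag_extend (\<lambda>i. frag_extend f (T i)) (a - b)"
    if "frag_extend f (frag_extend T a) = frag_extend (\<lambda>i. frag_extend f (T i)) a"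
      "frag_extend f (frag_extend T b) = frag_extend (\<lambda>i. frag_extend f (T i)) b" for a b
    using that by (simp add: frag_extend_diff)
qed auto

lemma frag_extend_diff_fun: "frag_extend (\<lambda>i. f i - g i) c = frag_extend f c - frag_extend g c"
proof (rule frag_induction[of c UNIV])
  show "frag_extend (\<lambda>i. f i - g i) (a - b) = frag_extend f (a - b) - frag_extend g (a - b)"
    if "frag_extend (\<lambda>i. f i - g i) a = frag_extend f a - frag_extend g a"
      "frag_extend (\<lambda>i. f i - g i) b = frag_extend f b - frag_extend g b" for a b
    using that by (simp add: frag_extend_diff)
qed auto

section \<open>The boundary of a list\<close>

abbreviation list_cone :: "'a \<Rightarrow> ('a list \<Rightarrow>\<^sub>0 int) \<Rightarrow> 'a list \<Rightarrow>\<^sub>0 int" where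
  "list_cone a \<equiv> frag_extend (frag_of \<circ> Cons a)"

text \<open>The boundary of the augmented complex: the boundary of a one-point list is the empty list. With this
  convention the recursion has no exceptional case, and prefixing a point contracts the complex
  (\<open>list_boundary_cone\<close>).\<close>

primrec list_boundary :: "'a list \<Rightarrow> 'a list \<Rightarrow>\<^sub>0 int" where
  "list_boundary [] = 0"
| "list_boundary (y # ys) = frag_of ys - list_cone y (list_boundary ys)"

lemma list_boundary_cone:
  "frag_extend list_boundary (list_cone a c) = c - list_cone a (frag_extend list_boundary c)"
proof (rule frag_induction[of c UNIV])
  show "frag_extend list_boundary (list_cone a (b - c)) = b - c - list_cone a (frag_extend list_boundary (b - c))"
    if "frag_extend list_boundary (list_cone a b) = b - list_cone a (frag_extend list_boundary b)"
      "frag_extend list_boundary (list_cone a c) = c - list_cone a (frag_extend list_boundary c)" for b c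
    using that by (simp add: frag_extend_diff)
qed (auto simp: o_def)

lemma list_boundary_boundary: "frag_extend list_boundary (list_boundary l) = 0"
  by (induction l) (simp_all add: frag_extend_diff list_boundary_cone)

lemma keys_cone: "l \<in> Poly_Mapping.keys (list_cone a c) \<Longrightarrow> \<exists>m\<in>Poly_Mapping.keys c. l = a # m"
  using keys_frag_extend[of "frag_of \<circ> Cons a" c] by auto

lemma keys_list_boundary:
  assumes "m \<in> Poly_Mapping.keys (list_boundary l)"
  shows "length l = Suc (length m)" "set m \<subseteq> set l"
proof -
  have "length l = Suc (length m) \<and> set m \<subseteq> set l" using assms
  proof (induction l arbitrary: m)
    case (Cons y ys)
    have "m \<in> Poly_Mapping.keys (frag_of ys) \<union> Poly_Mapping.keys (list_cone y (list_boundary ys))"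
      using Cons.prems keys_diff[of "frag_of ys" "list_cone y (list_boundary ys)"] by auto
    then show ?case using Cons.IH keys_cone by fastforce
  qed simp
  then show "length l = Suc (length m)" "set m \<subseteq> set l" by auto
qed

lemma list_boundary_sum:
  "list_boundary l = (\<Sum>j<length l. frag_cmul ((- 1) ^ j) (frag_of (take j l @ drop (Suc j) l)))"
proof (induction l)
  case (Cons y ys)
  have "(\<Sum>j<length (y # ys). frag_cmul ((- 1) ^ j) (frag_of (take j (y # ys) @ drop (Suc j) (y # ys)))) =
      frag_of ys + (\<Sum>j<length ys. frag_cmul ((- 1) ^ Suc j) (frag_of (y # take j ys @ drop (Suc j) ys)))"
    by (simp add: sum.lessThan_Suc_shift del: sum.lessThan_Suc)
  also have "(\<Sum>j<length ys. frag_cmul ((- 1) ^ Suc j) (frag_of (y # take j ys @ drop (Suc j) ys))) =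
      - list_cone y (list_boundary ys)"
    unfolding Cons by (simp add: frag_extend_sum frag_extend_cmul sum_negf[symmetric] o_def)
  finally show ?case by simp
qed simp

section \<open>Complexes of functions on index sets with face maps\<close>

definition face_sum :: "(nat \<Rightarrow> nat \<Rightarrow> 'i \<Rightarrow> 'i) \<Rightarrow> nat \<Rightarrow> 'i \<Rightarrow> 'i \<Rightarrow>\<^sub>0 int" where
  "face_sum face q s = (\<Sum>j\<le>Suc q. frag_cmul ((- 1) ^ j) (frag_of (face q j s)))"

lemma coboundary_eval:
  "s \<in> I (Suc q) \<Longrightarrow> coboundary I face q f s = frag_eval f (face_sum face q s)"
  unfolding coboundary_def face_sum_def
  by (simp add: frag_eval_sum frag_eval_sign if_distrib del: sum.atMost_Suc cong: if_cong)

lemma coboundary_extensional: "coboundary I face q f \<in> extensional (I (Suc q))"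
  by (simp add: coboundary_def)

lemma keys_face_sum:
  "t \<in> Poly_Mapping.keys (face_sum face q s) \<Longrightarrow> \<exists>j\<le>Suc q. t = face q j s"
  unfolding face_sum_def
  using keys_sum[of "\<lambda>j. frag_cmul ((- 1) ^ j) (frag_of (face q j s))" "{..Suc q}"]
  by (auto simp: subset_iff)

lemma carrier_function_group: "topspace V = UNIV \<Longrightarrow> carrier (function_group I V) = extensional I"
  by (simp add: coefficient_group_def PiE_def)

lemma mult_function_group: "f \<otimes>\<^bsub>function_group I V\<^esub> g = (\<lambda>s\<in>I. f s + g s)"
  by (simp add: product_group_def coefficient_group_def)

lemma one_function_group: "\<one>\<^bsub>function_group I V\<^esub> = (\<lambda>s\<in>I. 0)"
  by (simp add: coefficient_group_def)

lemma comm_group_coefficient_group: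
  assumes "topspace V = UNIV"
  shows "comm_group (coefficient_group V)"
  by (rule comm_groupI)
    (use assms in \<open>auto simp: coefficient_group_def algebra_simps intro: exI[of _ "- _"]\<close>)

lemma comm_group_function_group:
  assumes "topspace V = UNIV"
  shows "comm_group (function_group I V)"
proof (rule group.group_comm_groupI)
  interpret G: comm_group "coefficient_group V" by (rule comm_group_coefficient_group[OF assms])
  show "Group.group (function_group I V)" by simp
  show "f \<otimes>\<^bsub>function_group I V\<^esub> g = g \<otimes>\<^bsub>function_group I V\<^esub> f" for f g
    unfolding mult_function_group by (simp add: add.commute)
qed

text \<open>The simplicial identities enter through \<open>face_face\<close>, which says that the boundary squares to zero.\<close>

locale face_complex =
  fixes I :: "nat \<Rightarrow> 'i set" and face :: "nat \<Rightarrow> nat \<Rightarrow> 'i \<Rightarrow> 'i"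
  assumes face_in: "\<And>q j s. s \<in> I (Suc q) \<Longrightarrow> j \<le> Suc q \<Longrightarrow> face q j s \<in> I q"
    and face_face: "\<And>q s. s \<in> I (Suc (Suc q)) \<Longrightarrow>
      frag_extend (face_sum face q) (face_sum face (Suc q) s) = 0"
begin

lemma keys_face_sum_in: "s \<in> I (Suc q) \<Longrightarrow> Poly_Mapping.keys (face_sum face q s) \<subseteq> I q"
  using keys_face_sum face_in by fastforce

lemma cochain_complex_subgroups:
  assumes V: "topspace V = UNIV"
    and S: "\<And>q. subgroup (S q) (function_group (I q) V)"
    and d: "\<And>q f. f \<in> S q \<Longrightarrow> coboundary I face q f \<in> S (Suc q)"
  shows "cochain_complex (\<lambda>q. (function_group (I q) V)\<lparr>carrier := S q\<rparr>) (coboundary I face)"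
  unfolding cochain_complex_def
proof (intro conjI allI ballI)
  fix q
  interpret G: comm_group "function_group (I q) V" by (rule comm_group_function_group[OF V])
  show "comm_group ((function_group (I q) V)\<lparr>carrier := S q\<rparr>)"
    by (intro group.group_comm_groupI subgroup.subgroup_is_group[OF S G.is_group])
      (simp add: mult_function_group add.commute del: mult_product_group)
  show "coboundary I face q \<in> hom ((function_group (I q) V)\<lparr>carrier := S q\<rparr>)
      ((function_group (I (Suc q)) V)\<lparr>carrier := S (Suc q)\<rparr>)"
  proof (rule homI)
    show "coboundary I face q f \<in> carrier ((function_group (I (Suc q)) V)\<lparr>carrier := S (Suc q)\<rparr>)"
      if "f \<in> carrier ((function_group (I q) V)\<lparr>carrier := S q\<rparr>)" for f using that d by simp
    fix f g :: "'i \<Rightarrow> 'a"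
    have "coboundary I face q (\<lambda>s\<in>I q. f s + g s) = (\<lambda>s\<in>I (Suc q). coboundary I face q f s + coboundary I face q g s)"
    proof (rule extensionalityI[of _ "I (Suc q)"])
      fix s assume s: "s \<in> I (Suc q)"
      have "frag_eval (\<lambda>s\<in>I q. f s + g s) (face_sum face q s) = frag_eval (\<lambda>s. f s + g s) (face_sum face q s)"
        by (rule frag_eval_cong) (use keys_face_sum_in[OF s] in auto)
      then show "coboundary I face q (\<lambda>s\<in>I q. f s + g s) s =
          (\<lambda>s\<in>I (Suc q). coboundary I face q f s + coboundary I face q g s) s"
        using s by (simp add: coboundary_eval frag_eval_add_fun)
    qed (auto simp: coboundary_extensional)
    then show "coboundary I face q (f \<otimes>\<^bsub>(function_group (I q) V)\<lparr>carrier := S q\<rparr>\<^esub> g) =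
        coboundary I face q f \<otimes>\<^bsub>(function_group (I (Suc q)) V)\<lparr>carrier := S (Suc q)\<rparr>\<^esub> coboundary I face q g"
      by (simp add: mult_function_group del: mult_product_group)
  qed
  fix f
  show "coboundary I face (Suc q) (coboundary I face q f) =
      \<one>\<^bsub>(function_group (I (Suc (Suc q))) V)\<lparr>carrier := S (Suc (Suc q))\<rparr>\<^esub>"
  proof (rule extensionalityI[of _ "I (Suc (Suc q))"])
    fix s assume s: "s \<in> I (Suc (Suc q))"
    have "coboundary I face (Suc q) (coboundary I face q f) s =
        frag_eval (\<lambda>t. frag_eval f (face_sum face q t)) (face_sum face (Suc q) s)"
      unfolding coboundary_eval[where I=I and q="Suc q", OF s]
      by (rule frag_eval_cong) (use keys_face_sum_in[OF s] in \<open>auto simp: coboundary_eval\<close>)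
    also have "\<dots> = 0" using face_face[OF s] by (simp add: frag_eval_extend[symmetric])
    finally show "coboundary I face (Suc q) (coboundary I face q f) s =
        \<one>\<^bsub>(function_group (I (Suc (Suc q))) V)\<lparr>carrier := S (Suc (Suc q))\<rparr>\<^esub> s"
      using s by (simp add: coefficient_group_def)
  qed (auto simp: coboundary_extensional one_function_group)
qed

lemma cochain_complex_functions:
  assumes V: "topspace V = UNIV"
  shows "cochain_complex (\<lambda>q. function_group (I q) V) (coboundary I face)"
proof -
  have "subgroup (carrier (function_group (I q) V)) (function_group (I q) V)" for q
    by (rule group.subgroup_self) (use comm_group_function_group[OF V] comm_group_def in blast)
  then have "cochain_complex (\<lambda>q. (function_group (I q) V)\<lparr>carrier := carrier (function_group (I q) V)\<rparr>) (coboundary I face)"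
    by (rule cochain_complex_subgroups[OF V])
      (use V coboundary_extensional in \<open>auto simp: carrier_function_group simp del: carrier_product_group\<close>)
  then show ?thesis by (simp del: carrier_product_group)
qed

end

text \<open>All restrictions to smaller coverings and the evaluation at vertices have this form.\<close>

lemma cochain_map_pullback:
  assumes I: "face_complex I face" and J: "face_complex J face'"
    and p: "\<And>q s. s \<in> J q \<Longrightarrow> p q s \<in> I q"
    and p_face: "\<And>q j s. s \<in> J (Suc q) \<Longrightarrow> j \<le> Suc q \<Longrightarrow> p q (face' q j s) = face q j (p (Suc q) s)"
    and C: "\<And>q f g. f \<otimes>\<^bsub>C q\<^esub> g = (\<lambda>s\<in>I q. f s + g s)"
    and C': "\<And>q f g. f \<otimes>\<^bsub>C' q\<^esub> g = (\<lambda>s\<in>J q. f s + g s)"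
    and h: "\<And>q f. f \<in> carrier (C q) \<Longrightarrow> (\<lambda>s\<in>J q. f (p q s)) \<in> carrier (C' q)"
  shows "cochain_map C (coboundary I face) C' (coboundary J face') (\<lambda>q f. \<lambda>s\<in>J q. f (p q s))"
  unfolding cochain_map_def
proof (intro conjI allI ballI)
  interpret I: face_complex I face by fact
  interpret J: face_complex J face' by fact
  fix q
  show "(\<lambda>f. \<lambda>s\<in>J q. f (p q s)) \<in> hom (C q) (C' q)"
    by (rule homI) (use h p in \<open>auto simp: C C' fun_eq_iff\<close>)
  fix f
  show "(\<lambda>s\<in>J (Suc q). coboundary I face q f (p (Suc q) s)) = coboundary J face' q (\<lambda>s\<in>J q. f (p q s))"
  proof (rule extensionalityI[of _ "J (Suc q)"])
    fix s assume s: "s \<in> J (Suc q)"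
    have "face_sum face q (p (Suc q) s) = frag_extend (frag_of \<circ> p q) (face_sum face' q s)"
      unfolding face_sum_def using p_face[OF s]
      by (simp add: frag_extend_sum frag_extend_cmul o_def del: sum.atMost_Suc)
    moreover have "frag_eval (\<lambda>s\<in>J q. f (p q s)) (face_sum face' q s) = frag_eval (\<lambda>s. f (p q s)) (face_sum face' q s)"
      by (rule frag_eval_cong) (use J.keys_face_sum_in[OF s] in auto)
    ultimately show "(\<lambda>s\<in>J (Suc q). coboundary I face q f (p (Suc q) s)) s =
        coboundary J face' q (\<lambda>s\<in>J q. f (p q s)) s"
      using s p by (simp add: coboundary_eval frag_eval_extend)
  qed (auto simp: coboundary_extensional)
qed

section \<open>Tuples as lists\<close>

text \<open>Tuples are converted to lists because the operators on cochains that follow are defined by recursion on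
  the first coordinate; a list also carries its degree.\<close>

definition tuple_of :: "nat \<Rightarrow> 'a list \<Rightarrow> nat \<Rightarrow> 'a" where
  "tuple_of q l = (\<lambda>i\<in>{..q}. l ! i)"

definition list_of :: "nat \<Rightarrow> (nat \<Rightarrow> 'a) \<Rightarrow> 'a list" where
  "list_of q u = map u [0..<Suc q]"

lemma length_list_of [simp]: "length (list_of q u) = Suc q"
  by (simp add: list_of_def)

lemma set_list_of: "set (list_of q u) = u ` {..q}"
  by (auto simp: list_of_def atLeast0LessThan lessThan_Suc_atMost simp del: upt_Suc)

lemma nth_list_of: "i \<le> q \<Longrightarrow> list_of q u ! i = u i"
  unfolding list_of_def by (subst nth_map) (auto simp del: upt_Suc)

lemma tuple_of_list_of: "u \<in> extensional {..q} \<Longrightarrow> tuple_of q (list_of q u) = u"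
  by (rule extensionalityI[of _ "{..q}"]) (auto simp: tuple_of_def nth_list_of)

lemma list_of_tuple_of: "length l = Suc q \<Longrightarrow> list_of q (tuple_of q l) = l"
  by (rule nth_equalityI) (auto simp: nth_list_of tuple_of_def)

lemma tuple_of_in_tuples_iff:
  "length l = Suc q \<Longrightarrow> tuple_of q l \<in> tuples \<UU> q \<longleftrightarrow> (\<exists>U\<in>\<UU>. set l \<subseteq> U)"
  by (auto simp: tuples_def tuple_of_def PiE_iff set_conv_nth less_Suc_eq_le subset_iff; blast)

lemma tuples_extensional: "u \<in> tuples \<UU> q \<Longrightarrow> u \<in> extensional {..q}"
  by (auto simp: tuples_def PiE_def)

lemma tuples_cases:
  assumes "u \<in> tuples \<UU> q"
  obtains l U where "u = tuple_of q l" "length l = Suc q" "U \<in> \<UU>" "set l \<subseteq> U" "l = list_of q u"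
proof -
  have u: "u = tuple_of q (list_of q u)" using tuple_of_list_of tuples_extensional[OF assms] by metis
  then have "tuple_of q (list_of q u) \<in> tuples \<UU> q" using assms by simp
  then obtain U where "U \<in> \<UU>" "set (list_of q u) \<subseteq> U" by (auto simp: tuple_of_in_tuples_iff)
  then show ?thesis using that[of "list_of q u" U] u by simp
qed

lemma omit_tuple_of:
  assumes "length l = Suc (Suc q)" "j \<le> Suc q"
  shows "omit q j (tuple_of (Suc q) l) = tuple_of q (take j l @ drop (Suc j) l)"
  by (rule extensionalityI[of _ "{..q}"])
    (use assms in \<open>auto simp: omit_def tuple_of_def nth_append min_def\<close>)

lemma face_sum_omit:
  assumes "length l = Suc (Suc q)"
  shows "face_sum omit q (tuple_of (Suc q) l) = frag_extend (frag_of \<circ> tuple_of q) (list_boundary l)"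
proof -
  have "{..Suc q} = {..<length l}" using assms by auto
  then show ?thesis
    unfolding face_sum_def list_boundary_sum using omit_tuple_of[OF assms] assms
    by (simp add: frag_extend_sum frag_extend_cmul o_def del: sum.lessThan_Suc sum.atMost_Suc)
qed

lemma cover_d_eval:
  assumes "length l = Suc (Suc q)" "U \<in> \<UU>" "set l \<subseteq> U"
  shows "cover_d \<UU> q f (tuple_of (Suc q) l) = frag_eval (\<lambda>m. f (tuple_of q m)) (list_boundary l)"
proof -
  have "tuple_of (Suc q) l \<in> tuples \<UU> (Suc q)" using assms by (auto simp: tuple_of_in_tuples_iff)
  then show ?thesis
    unfolding cover_d_def by (simp add: coboundary_eval face_sum_omit assms frag_eval_extend o_def)
qed

lemma face_complex_tuples: "face_complex (tuples \<UU>) omit"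
proof
  fix q j and s :: "nat \<Rightarrow> 'a" assume "s \<in> tuples \<UU> (Suc q)" "j \<le> Suc q"
  then obtain l U where "s = tuple_of (Suc q) l" and l: "length l = Suc (Suc q)" "U \<in> \<UU>" "set l \<subseteq> U"
    by (elim tuples_cases)
  moreover have "set (take j l @ drop (Suc j) l) \<subseteq> U"
    using l(3) set_take_subset[of j l] set_drop_subset[of "Suc j" l] by auto
  moreover have "length (take j l @ drop (Suc j) l) = Suc q" using l(1) \<open>j \<le> Suc q\<close> by simp
  ultimately show "omit q j s \<in> tuples \<UU> q"
    using l \<open>j \<le> Suc q\<close> by (simp only: omit_tuple_of tuple_of_in_tuples_iff) blast
next
  fix q and s :: "nat \<Rightarrow> 'a" assume "s \<in> tuples \<UU> (Suc (Suc q))"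
  then obtain l where s: "s = tuple_of (Suc (Suc q)) l" and l: "length l = Suc (Suc (Suc q))"
    by (elim tuples_cases)
  have "frag_extend (face_sum omit q) (face_sum omit (Suc q) s) =
      frag_extend (\<lambda>m. face_sum omit q (tuple_of (Suc q) m)) (list_boundary l)"
    unfolding s face_sum_omit[OF l] by (simp add: frag_extend_extend o_def)
  also have "\<dots> = frag_extend (\<lambda>m. frag_extend (frag_of \<circ> tuple_of q) (list_boundary m)) (list_boundary l)"
    by (rule frag_extend_eq) (use keys_list_boundary(1) l in \<open>fastforce intro: face_sum_omit\<close>)
  also have "\<dots> = 0"
    by (simp add: frag_extend_extend[symmetric] list_boundary_boundary)
  finally show "frag_extend (face_sum omit q) (face_sum omit (Suc q) s) = 0" .
qed

section \<open>Singular simplices\<close>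

lemma face_sum_singular: "face_sum (\<lambda>q. singular_face (Suc q)) q s = chain_boundary (Suc q) (frag_of s)"
  by (simp add: face_sum_def chain_boundary_of)

lemma chain_boundary_extend: "chain_boundary (Suc q) c = frag_extend (face_sum (\<lambda>q. singular_face (Suc q)) q) c"
  by (simp add: chain_boundary_def face_sum_def[abs_def])

lemma singular_face_singular_simplex:
  "singular_simplex (Suc q) X s \<Longrightarrow> j \<le> Suc q \<Longrightarrow> singular_simplex q X (singular_face (Suc q) j s)"
  using singular_simplex_singular_face[of "Suc q" X s j] by simp

lemma singular_face_face:
  assumes "singular_simplex (Suc (Suc q)) X s"
  shows "frag_extend (face_sum (\<lambda>q. singular_face (Suc q)) q) (face_sum (\<lambda>q. singular_face (Suc q)) (Suc q) s) = 0"
proof -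
  have "chain_boundary (Suc q) (chain_boundary (Suc (Suc q)) (frag_of s)) = 0"
    using chain_boundary_boundary[of "Suc (Suc q)" X "frag_of s"] assms by (simp add: singular_chain_of)
  then show ?thesis by (simp add: chain_boundary_extend[symmetric] face_sum_singular)
qed

lemma face_complex_singular: "face_complex (\<lambda>q. singular_simplex_set q X) (\<lambda>q. singular_face (Suc q))"
proof
  show "singular_face (Suc q) j s \<in> singular_simplex_set q X"
    if "s \<in> singular_simplex_set (Suc q) X" "j \<le> Suc q" for q j s
    using that by (simp add: singular_face_singular_simplex)
  show "frag_extend (face_sum (\<lambda>q. singular_face (Suc q)) q) (face_sum (\<lambda>q. singular_face (Suc q)) (Suc q) s) = 0"
    if "s \<in> singular_simplex_set (Suc (Suc q)) X" for q s
    using that singular_face_face by simp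
qed

lemma small_simplices_iff:
  "s \<in> small_simplices X \<UU> q \<longleftrightarrow> (\<exists>U\<in>\<UU>. singular_simplex q (subtopology X U) s)"
  by (auto simp: small_simplices_def singular_simplex_subtopology)

lemma face_complex_small: "face_complex (small_simplices X \<UU>) (\<lambda>q. singular_face (Suc q))"
proof
  show "singular_face (Suc q) j s \<in> small_simplices X \<UU> q"
    if "s \<in> small_simplices X \<UU> (Suc q)" "j \<le> Suc q" for q j s
    using that by (auto simp: small_simplices_iff intro: singular_face_singular_simplex)
  show "frag_extend (face_sum (\<lambda>q. singular_face (Suc q)) q) (face_sum (\<lambda>q. singular_face (Suc q)) (Suc q) s) = 0"
    if "s \<in> small_simplices X \<UU> (Suc (Suc q))" for q s
    using that singular_face_face by (auto simp: small_simplices_def)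
qed

lemma simplex_vertex_in_standard_simplex: "i \<le> q \<Longrightarrow> simplex_vertex i \<in> standard_simplex q"
  unfolding simplex_vertex_def by simp

lemma simplical_face_simplex_vertex:
  "simplical_face j (simplex_vertex i) = (simplex_vertex (if i < j then i else Suc i) :: nat \<Rightarrow> real)"
  by (auto simp: simplical_face_def simplex_vertex_def fun_eq_iff)

lemma vertices_face:
  assumes "j \<le> Suc q"
  shows "(\<lambda>i\<in>{..q}. singular_face (Suc q) j s (simplex_vertex i)) =
    omit q j (\<lambda>i\<in>{..Suc q}. s (simplex_vertex i))"
  by (rule extensionalityI[of _ "{..q}"])
    (use assms in \<open>auto simp: omit_def singular_face_def simplex_vertex_in_standard_simplex simplical_face_simplex_vertex\<close>)

lemma vertices_in_tuples:
  "s \<in> small_simplices X \<UU> q \<Longrightarrow> (\<lambda>i\<in>{..q}. s (simplex_vertex i)) \<in> tuples \<UU> q"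
proof -
  assume "s \<in> small_simplices X \<UU> q"
  then obtain U where U: "U \<in> \<UU>" "s ` standard_simplex q \<subseteq> U" by (auto simp: small_simplices_def)
  then have "s (simplex_vertex i) \<in> U" if "i \<le> q" for i
    using simplex_vertex_in_standard_simplex[OF that] by blast
  then have "(\<lambda>i\<in>{..q}. s (simplex_vertex i)) \<in> {..q} \<rightarrow>\<^sub>E U" by auto
  then show ?thesis using U(1) unfolding tuples_def by blast
qed


section \<open>Deforming singular simplices into small ones\<close>

lemma chain_boundary_frag_extend:
  "chain_boundary k (frag_extend T c) = frag_extend (\<lambda>i. chain_boundary k (T i)) c"
  by (simp add: chain_boundary_def frag_extend_extend frag_extend_eq_0)

lemma chain_boundary_expansion:
  "chain_boundary k c = frag_extend (\<lambda>i. chain_boundary k (frag_of i)) c"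
  using chain_boundary_frag_extend[of k frag_of c] by (simp add: frag_expansion[symmetric])

lemma frag_extend_in:
  assumes "\<And>i. i \<in> Poly_Mapping.keys c \<Longrightarrow> Poly_Mapping.keys (T i) \<subseteq> S"
  shows "Poly_Mapping.keys (frag_extend T c) \<subseteq> S"
  using keys_frag_extend[of T c] assms by blast

lemma frag_diff_in:
  "Poly_Mapping.keys a \<subseteq> S \<Longrightarrow> Poly_Mapping.keys b \<subseteq> S \<Longrightarrow> Poly_Mapping.keys (a - b) \<subseteq> S"
  using keys_diff[of a b] by blast

lemma keys_chain_boundary_small:
  assumes "Poly_Mapping.keys c \<subseteq> small_simplices X \<UU> (Suc k)"
  shows "Poly_Mapping.keys (chain_boundary (Suc k) c) \<subseteq> small_simplices X \<UU> k"
  unfolding chain_boundary_extend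
  by (rule frag_extend_in) (use assms face_complex.keys_face_sum_in[OF face_complex_small] in blast)

text \<open>A sufficiently often subdivided chain is small. The chain homotopy from subdivision to the identity is
  natural in the space, hence maps small chains to small chains; so it turns \<open>c\<close> into a small chain up to a
  boundary and a small error coming from the boundary of \<open>c\<close>.\<close>

lemma relative_cycle_small:
  assumes open_cover: "\<And>U. U \<in> \<UU> \<Longrightarrow> openin X U" "topspace X \<subseteq> \<Union>\<UU>"
    and c: "singular_chain k X c"
    and small: "k > 0 \<Longrightarrow> Poly_Mapping.keys (chain_boundary k c) \<subseteq> small_simplices X \<UU> (k - 1)"
  shows "\<exists>b. singular_chain (Suc k) X b \<and> Poly_Mapping.keys (c - chain_boundary (Suc k) b) \<subseteq> small_simplices X \<UU> k"
proof -
  obtain n where n: "\<And>m f. n \<le> m \<Longrightarrow> f \<in> Poly_Mapping.keys ((singular_subdivision k ^^ m) c) \<Longrightarrow>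
      \<exists>V\<in>\<UU>. f \<in> standard_simplex k \<rightarrow> V"
    using sufficient_iterated_singular_subdivision_exists[OF open_cover c] by metis
  obtain h where h: "\<And>p. h p 0 = (0 :: 'a chain)" "\<And>p c1 c2. h p (c1-c2) = h p c1 - h p c2"
    and h_chain: "\<And>p X c. singular_chain p X c \<Longrightarrow> singular_chain (Suc p) X (h p c)"
    and h_eq: "\<And>p X c. singular_chain p X c \<Longrightarrow>
      chain_boundary (Suc p) (h p c) + h (p - Suc 0) (chain_boundary p c) = (singular_subdivision p ^^ n) c - c"
    using chain_homotopic_iterated_singular_subdivision[of n] by metis
  have h_small: "Poly_Mapping.keys (h p e) \<subseteq> small_simplices X \<UU> (Suc p)"
    if "Poly_Mapping.keys e \<subseteq> small_simplices X \<UU> p" for p e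
    using that
  proof (induction rule: frag_induction)
    case (one s)
    then obtain U where "U \<in> \<UU>" "singular_simplex p (subtopology X U) s" by (auto simp: small_simplices_iff)
    then have "singular_chain (Suc p) (subtopology X U) (h p (frag_of s))"
      by (simp add: h_chain singular_chain_of)
    then show ?case using \<open>U \<in> \<UU>\<close> unfolding singular_chain_def small_simplices_iff[abs_def] subset_iff by blast
  next
    case (diff a b)
    then show ?case by (simp add: h frag_diff_in)
  qed (simp add: h)
  have Sd: "singular_chain k X ((singular_subdivision k ^^ m) c)" for m
    by (induction m) (auto simp: c singular_chain_singular_subdivision)
  have Sd_small: "Poly_Mapping.keys ((singular_subdivision k ^^ n) c) \<subseteq> small_simplices X \<UU> k"
  proof
    fix f assume f: "f \<in> Poly_Mapping.keys ((singular_subdivision k ^^ n) c)"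
    then obtain V where "V \<in> \<UU>" "f \<in> standard_simplex k \<rightarrow> V" using n[OF order_refl] by blast
    moreover have "singular_simplex k X f" using Sd[of n] f by (auto simp: singular_chain_def)
    ultimately show "f \<in> small_simplices X \<UU> k" by (auto simp: small_simplices_def)
  qed
  have "Poly_Mapping.keys (h (k - Suc 0) (chain_boundary k c)) \<subseteq> small_simplices X \<UU> k"
  proof (cases k)
    case 0
    then show ?thesis by (simp add: chain_boundary_def h)
  next
    case (Suc p)
    then show ?thesis using h_small[of "chain_boundary k c" p] small by simp
  qed
  moreover have "c - chain_boundary (Suc k) (- h k c) =
      (singular_subdivision k ^^ n) c - h (k - Suc 0) (chain_boundary k c)"
    using h_eq[OF c] by (simp add: chain_boundary_minus algebra_simps)
  ultimately have "Poly_Mapping.keys (c - chain_boundary (Suc k) (- h k c)) \<subseteq> small_simplices X \<UU> k"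
    using Sd_small by (simp add: frag_diff_in)
  moreover have "singular_chain (Suc k) X (- h k c)" using h_chain[OF c] by (simp add: singular_chain_minus)
  ultimately show ?thesis by blast
qed

lemma chain_boundary_boundary_of:
  "singular_simplex k X s \<Longrightarrow> chain_boundary (k - 1) (chain_boundary k (frag_of s)) = 0"
  using chain_boundary_boundary[of k X "frag_of s"] by (simp add: singular_chain_of)

lemma keys_boundary_simplex:
  "singular_simplex k X s \<Longrightarrow> t \<in> Poly_Mapping.keys (chain_boundary k (frag_of s)) \<Longrightarrow> singular_simplex (k - 1) X t"
  using singular_chain_boundary[of k X "frag_of s"] by (auto simp: singular_chain_of singular_chain_def)

text \<open>Induction on the degree: if \<open>D\<close> is known in degree \<open>k\<close>, then for a simplex \<open>s\<close> of degree \<open>k + 1\<close> the chain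
  \<open>s - D (\<partial> s)\<close> has a small boundary, and \<open>relative_cycle_small\<close> provides \<open>D s\<close>. The choice \<open>D = 0\<close> on small
  simplices is consistent, and it makes \<open>s - \<partial> (D s) - D (\<partial> s)\<close> a retraction onto the small chains.\<close>

lemma deformation_to_small_simplices:
  assumes open_cover: "\<And>U. U \<in> \<UU> \<Longrightarrow> openin X U" "topspace X \<subseteq> \<Union>\<UU>"
  shows "\<exists>D. \<forall>k\<le>n. \<forall>s. singular_simplex k X s \<longrightarrow>
    singular_chain (Suc k) X (D k s) \<and> (s \<in> small_simplices X \<UU> k \<longrightarrow> D k s = 0) \<and>
    Poly_Mapping.keys (frag_of s - chain_boundary (Suc k) (D k s) -
      frag_extend (D (k - 1)) (chain_boundary k (frag_of s))) \<subseteq> small_simplices X \<UU> k"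
    (is "\<exists>D. \<forall>k\<le>n. \<forall>s. singular_simplex k X s \<longrightarrow> ?P k (D k) (D (k - 1)) s")
proof (induction n)
  case 0
  have "\<exists>b. singular_simplex 0 X s \<longrightarrow> singular_chain (Suc 0) X b \<and> (s \<in> small_simplices X \<UU> 0 \<longrightarrow> b = 0) \<and>
      Poly_Mapping.keys (frag_of s - chain_boundary (Suc 0) b) \<subseteq> small_simplices X \<UU> 0" for s
  proof (cases "s \<in> small_simplices X \<UU> 0")
    case False
    then show ?thesis
      using relative_cycle_small[OF open_cover, of 0 "frag_of s"] by (auto simp: singular_chain_of)
  qed (intro exI[of _ 0], auto)
  then obtain D0 where D0: "\<And>s. singular_simplex 0 X s \<Longrightarrow>
      singular_chain (Suc 0) X (D0 s) \<and> (s \<in> small_simplices X \<UU> 0 \<longrightarrow> D0 s = 0) \<and>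
      Poly_Mapping.keys (frag_of s - chain_boundary (Suc 0) (D0 s)) \<subseteq> small_simplices X \<UU> 0"
    by metis
  have "chain_boundary 0 c = 0" for c :: "'a chain" by (simp add: chain_boundary_def)
  then show ?case using D0 by (intro exI[of _ "\<lambda>_. D0"]) simp
next
  case (Suc n)
  then obtain D where D: "\<And>k s. k \<le> n \<Longrightarrow> singular_simplex k X s \<Longrightarrow> ?P k (D k) (D (k - 1)) s" by blast
  have "\<exists>b. singular_simplex (Suc n) X s \<longrightarrow> singular_chain (Suc (Suc n)) X b \<and>
      (s \<in> small_simplices X \<UU> (Suc n) \<longrightarrow> b = 0) \<and>
      Poly_Mapping.keys (frag_of s - chain_boundary (Suc (Suc n)) b -
        frag_extend (D n) (chain_boundary (Suc n) (frag_of s))) \<subseteq> small_simplices X \<UU> (Suc n)" for s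
  proof (cases "singular_simplex (Suc n) X s")
    case s: True
    let ?bs = "chain_boundary (Suc n) (frag_of s)"
    have bs: "singular_simplex n X t" if "t \<in> Poly_Mapping.keys ?bs" for t
      using keys_boundary_simplex[OF s that] by simp
    show ?thesis
    proof (cases "s \<in> small_simplices X \<UU> (Suc n)")
      case True
      then have "Poly_Mapping.keys ?bs \<subseteq> small_simplices X \<UU> n" by (simp add: keys_chain_boundary_small)
      then have "frag_extend (D n) ?bs = 0" using D[of n] bs by (intro frag_extend_eq_0) auto
      then show ?thesis using True by (intro exI[of _ 0]) simp
    next
      case False
      let ?c = "frag_of s - frag_extend (D n) ?bs"
      have c: "singular_chain (Suc n) X ?c"
        using s D[of n] bs by (intro singular_chain_diff singular_chain_extend) (auto simp: singular_chain_of)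
      have z: "frag_extend (\<lambda>t. frag_extend (D (n - 1)) (chain_boundary n (frag_of t))) ?bs = 0"
        using chain_boundary_boundary_of[OF s] chain_boundary_expansion[of n ?bs]
        by (simp add: frag_extend_extend[symmetric])
      have "chain_boundary (Suc n) ?c = ?bs - frag_extend (\<lambda>t. chain_boundary (Suc n) (D n t)) ?bs"
        by (simp add: chain_boundary_diff chain_boundary_frag_extend)
      also have "\<dots> = frag_extend (\<lambda>t. frag_of t - chain_boundary (Suc n) (D n t) -
          frag_extend (D (n - 1)) (chain_boundary n (frag_of t))) ?bs"
        unfolding frag_extend_diff_fun z by (simp add: frag_expansion[symmetric])
      finally have "Poly_Mapping.keys (chain_boundary (Suc n) ?c) \<subseteq> small_simplices X \<UU> n"
        using D[OF order_refl bs] by (simp add: frag_extend_in)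
      then obtain b where "singular_chain (Suc (Suc n)) X b"
        "Poly_Mapping.keys (?c - chain_boundary (Suc (Suc n)) b) \<subseteq> small_simplices X \<UU> (Suc n)"
        using relative_cycle_small[OF open_cover c] by auto
      moreover have "?c - chain_boundary (Suc (Suc n)) b = frag_of s - chain_boundary (Suc (Suc n)) b - frag_extend (D n) ?bs"
        by (simp add: algebra_simps)
      ultimately show ?thesis using False by metis
    qed
  qed blast
  then obtain D' where D': "\<And>s. singular_simplex (Suc n) X s \<Longrightarrow> ?P (Suc n) D' (D n) s" by (simp, metis)
  show ?case
  proof (intro exI[of _ "D(Suc n := D')"] allI impI)
    fix k s assume k: "k \<le> Suc n" and s: "singular_simplex k X s"
    show "?P k ((D(Suc n := D')) k) ((D(Suc n := D')) (k - 1)) s"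
    proof (cases "k = Suc n")
      case True
      then show ?thesis using D'[of s] s by simp
    next
      case False
      then have "k \<le> n" "k - 1 \<noteq> Suc n" "k \<noteq> Suc n" using k by auto
      then show ?thesis using D[OF _ s] by simp
    qed
  qed
qed

section \<open>Filling cycles in locally contractible groups\<close>

definition augmentation :: "('i \<Rightarrow>\<^sub>0 int) \<Rightarrow> int" where
  "augmentation = frag_eval (\<lambda>_. 1)"

lemma chain_map_constant:
  "chain_map k (\<lambda>_. a) c = frag_cmul (augmentation c) (frag_of (restrict (\<lambda>_. a) (standard_simplex k)))"
proof (rule frag_induction[of c UNIV])
  show "chain_map k (\<lambda>_. a) (b - c) = frag_cmul (augmentation (b - c)) (frag_of (restrict (\<lambda>_. a) (standard_simplex k)))"
    if "chain_map k (\<lambda>_. a) b = frag_cmul (augmentation b) (frag_of (restrict (\<lambda>_. a) (standard_simplex k)))"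
      "chain_map k (\<lambda>_. a) c = frag_cmul (augmentation c) (frag_of (restrict (\<lambda>_. a) (standard_simplex k)))" for b c
    using that by (simp add: chain_map_diff augmentation_def frag_eval_diff frag_cmul_diff_distrib)
qed (auto simp: augmentation_def simplex_map_def o_def restrict_def)

text \<open>In degree 0 every chain is a cycle, and those that bound must have augmentation 0.\<close>

definition cycles_bound :: "'a topology \<Rightarrow> 'a set \<Rightarrow> 'a set \<Rightarrow> bool" where
  "cycles_bound X A B \<longleftrightarrow> (\<forall>k c. singular_chain k (subtopology X A) c \<longrightarrow> chain_boundary k c = 0 \<longrightarrow>
     (k = 0 \<longrightarrow> augmentation c = 0) \<longrightarrow>
     (\<exists>w. singular_chain (Suc k) (subtopology X B) w \<and> chain_boundary (Suc k) w = c))"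

lemma cycles_bound_mono:
  "cycles_bound X A B \<Longrightarrow> A' \<subseteq> A \<Longrightarrow> B \<subseteq> B' \<Longrightarrow> cycles_bound X A' B'"
  unfolding cycles_bound_def by (meson singular_chain_mono)

text \<open>A null homotopy makes a cycle homologous to its image under a constant map. In positive degrees that image
  is a cycle of a one-point space, hence a boundary; in degree 0 it is the augmentation times a point.\<close>

lemma nullhomotopic_cycles_bound:
  assumes hom: "homotopic_with (\<lambda>_. True) (subtopology X A) (subtopology X B) id (\<lambda>_. a)"
  shows "cycles_bound X A B"
  unfolding cycles_bound_def
proof (intro allI impI)
  fix k c assume c: "singular_chain k (subtopology X A) c" "chain_boundary k c = 0" "k = 0 \<longrightarrow> augmentation c = 0"
  show "\<exists>w. singular_chain (Suc k) (subtopology X B) w \<and> chain_boundary (Suc k) w = c"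
  proof (cases "topspace (subtopology X A) = {}")
    case True
    then have "c = 0" using c(1) singular_chain_empty by blast
    then show ?thesis by (intro exI[of _ 0]) simp
  next
    case False
    have "continuous_map (subtopology X A) (subtopology X B) (\<lambda>_. a)"
      using homotopic_with_imp_continuous_maps[OF hom] by blast
    then have "a \<in> topspace (subtopology X B)" using False unfolding continuous_map_def by blast
    then have a: "a \<in> topspace X" "a \<in> B" by auto
    let ?e = "chain_map k (\<lambda>_. a) c"
    have cyc: "singular_relcycle k (subtopology X A) {} c" using c by (simp add: singular_cycle)
    have "homologous_rel k (subtopology X B) {} (chain_map k id c) ?e"
      by (rule homotopic_imp_homologous_rel_chain_maps[OF _ cyc])
        (use hom in simp)
    then have hom_ce: "singular_relboundary k (subtopology X B) {} (c - ?e)"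
      using chain_map_ident[OF c(1)] by (simp add: homologous_rel_def)
    have top: "topspace (subtopology X {a}) = {a}" using a by auto
    have "singular_relboundary k (subtopology X B) {} ?e"
    proof (cases "k = 0")
      case True
      then show ?thesis using c(3) by (simp add: chain_map_constant)
    next
      case False
      have "continuous_map (subtopology X A) (subtopology X {a}) (\<lambda>_. a)" using a by auto
      then have "singular_chain k (subtopology X {a}) ?e" using singular_chain_chain_map[OF c(1)] by blast
      moreover have "chain_boundary k ?e = 0"
        using chain_boundary_chain_map[OF c(1), of "\<lambda>_. a"] c(2) by simp
      ultimately have "singular_relboundary k (subtopology X {a}) {} ?e"
        using False by (subst singular_boundary_eq_cycle_singleton[OF top]) (auto simp: singular_cycle)
      then show ?thesis using a(2) singular_boundary_mono by (metis empty_subsetI insert_subset)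
    qed
    then have "singular_relboundary k (subtopology X B) {} ((c - ?e) + ?e)"
      using hom_ce singular_relboundary_add by blast
    then show ?thesis by (simp add: singular_boundary)
  qed
qed

lemma cycles_bound_translate:
  fixes A B :: "'g::topological_group_add set"
  assumes "cycles_bound euclidean A B"
  shows "cycles_bound euclidean ((+) g ` A) ((+) g ` B)"
  unfolding cycles_bound_def
proof (intro allI impI)
  fix k c assume c: "singular_chain k (top_of_set ((+) g ` A)) c" "chain_boundary k c = 0"
    "k = 0 \<longrightarrow> augmentation c = 0"
  have cont1: "continuous_map (top_of_set ((+) g ` A)) (top_of_set A) ((+) (- g))"
    by (auto simp: continuous_map_in_subtopology add.assoc[symmetric] intro!: continuous_intros)
  have cont2: "continuous_map (top_of_set B) (top_of_set ((+) g ` B)) ((+) g)"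
    by (auto simp: continuous_map_in_subtopology intro!: continuous_intros)
  let ?c = "chain_map k ((+) (- g)) c"
  have "augmentation (chain_map k f c) = augmentation c" for f :: "'g \<Rightarrow> 'g"
    by (simp add: augmentation_def chain_map_def frag_eval_extend)
  moreover have "chain_boundary k ?c = 0"
    using chain_boundary_chain_map[OF c(1), of "(+) (- g)"] c(2) by simp
  ultimately obtain w where w: "singular_chain (Suc k) (top_of_set B) w" "chain_boundary (Suc k) w = ?c"
    using assms singular_chain_chain_map[OF c(1) cont1] c(3) unfolding cycles_bound_def by metis
  have "chain_boundary (Suc k) (chain_map (Suc k) ((+) g) w) = chain_map k ((+) g) ?c"
    using chain_boundary_chain_map[OF w(1), of "(+) g"] w(2) by simp
  also have "\<dots> = chain_map k ((+) g \<circ> (+) (- g)) c" by (simp add: chain_map_compose)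
  also have "(+) g \<circ> (+) (- g) = id" by (auto simp: add.assoc[symmetric])
  finally have "chain_boundary (Suc k) (chain_map (Suc k) ((+) g) w) = c"
    unfolding chain_map_ident[OF c(1)] .
  then show "\<exists>w. singular_chain (Suc k) (top_of_set ((+) g ` B)) w \<and> chain_boundary (Suc k) w = c"
    using singular_chain_chain_map[OF w(1) cont2] by blast
qed

text \<open>Cycles of the sum of \<open>N i\<close> with itself must bound, not just those of \<open>N i\<close>: a simplex filled from the base
  point \<open>g\<close> has faces that are filled from other base points, which lie in \<open>g + N i\<close>.\<close>

definition filling_tower :: "nat \<Rightarrow> (nat \<Rightarrow> 'g::topological_group_add set) \<Rightarrow> bool" where
  "filling_tower n N \<longleftrightarrow> (\<forall>i\<le>n. open (N i) \<and> 0 \<in> N i) \<and>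
     (\<forall>i<n. N i \<subseteq> N (Suc i) \<and> {x + y | x y. x \<in> N i \<and> y \<in> N i} \<subseteq> N (Suc i) \<and>
       cycles_bound euclidean {x + y | x y. x \<in> N i \<and> y \<in> N i} (N (Suc i)))"

lemma open_halving:
  fixes U :: "'g::topological_monoid_add set"
  assumes "open U" "0 \<in> U"
  obtains A where "open A" "0 \<in> A" "{x + y | x y. x \<in> A \<and> y \<in> A} \<subseteq> U"
proof -
  have "((\<lambda>p. fst p + snd p) \<longlongrightarrow> (0::'g) + 0) (nhds (0, 0))"
    unfolding nhds_prod by (intro tendsto_add) (auto intro: filterlim_fst filterlim_snd)
  then have "eventually (\<lambda>p. fst p + snd p \<in> U) (nhds (0::'g, 0::'g))"
    using assms by (simp add: tendsto_def)
  then obtain S where S: "open S" "(0, 0) \<in> S" "\<And>p. p \<in> S \<Longrightarrow> fst p + snd p \<in> U"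
    by (auto simp: eventually_nhds)
  obtain A B where AB: "open A" "open B" "0 \<in> A" "0 \<in> B" "A \<times> B \<subseteq> S"
    using open_prod_elim[OF S(1,2)] by (metis mem_Sigma_iff)
  show ?thesis
    by (rule that[of "A \<inter> B"]) (use AB S(3) in \<open>fastforce+\<close>)
qed

text \<open>Built from the top: below \<open>U\<close> there is a neighbourhood that contracts in \<open>U\<close>, and it contains the sum of
  some neighbourhood with itself.\<close>

lemma filling_tower_exists:
  fixes U :: "'g::topological_group_add set"
  assumes lc: "locally_contractible_space (euclidean :: 'g topology)" and U: "open U" "0 \<in> U"
  shows "\<exists>N. filling_tower n N \<and> N n = U"
  using U
proof (induction n arbitrary: U)
  case 0
  then show ?case by (intro exI[of _ "\<lambda>_. U"]) (simp add: filling_tower_def)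
next
  case (Suc n)
  obtain W a where W: "open W" "0 \<in> W" "W \<subseteq> U"
    and hom: "homotopic_with (\<lambda>_. True) (top_of_set W) (top_of_set U) id (\<lambda>_. a)"
    using lc Suc.prems unfolding locally_contractible_space_def by (metis open_openin)
  obtain A where A: "open A" "0 \<in> A" "{x + y | x y. x \<in> A \<and> y \<in> A} \<subseteq> W"
    by (rule open_halving[OF W(1,2)])
  have AW: "A \<subseteq> W"
  proof
    fix x assume "x \<in> A"
    then have "x + 0 \<in> {x + y | x y. x \<in> A \<and> y \<in> A}" using A(2) by blast
    then show "x \<in> W" using A(3) by auto
  qed
  obtain N where N: "filling_tower n N" "N n = A" using Suc.IH[OF A(1,2)] by blast
  have "cycles_bound euclidean {x + y | x y. x \<in> A \<and> y \<in> A} U"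
    by (rule cycles_bound_mono[OF nullhomotopic_cycles_bound[OF hom] A(3) order_refl])
  moreover have "{x + y | x y. x \<in> A \<and> y \<in> A} \<subseteq> U" using A(3) W(3) by (rule order_trans)
  moreover have "A \<subseteq> U" using AW W(3) by (rule order_trans)
  ultimately have "filling_tower (Suc n) (N(Suc n := U))"
    using N Suc.prems unfolding filling_tower_def by (auto simp: le_Suc_eq less_Suc_eq)
  then show ?case by (metis fun_upd_same)
qed

lemma filling_towerD:
  assumes "filling_tower n N"
  shows "i \<le> n \<Longrightarrow> open (N i)" "i \<le> n \<Longrightarrow> 0 \<in> N i" "i \<le> j \<Longrightarrow> j \<le> n \<Longrightarrow> N i \<subseteq> N j"
proof -
  show "i \<le> n \<Longrightarrow> open (N i)" "i \<le> n \<Longrightarrow> 0 \<in> N i" using assms by (auto simp: filling_tower_def)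
  have up: "N m \<subseteq> N (Suc m)" if "m < n" for m using assms that unfolding filling_tower_def by blast
  have "N i \<subseteq> N (i + k)" if "i + k \<le> n" for k
    using that
  proof (induction k)
    case (Suc k)
    have "N i \<subseteq> N (i + k)" by (rule Suc.IH) (use Suc.prems in arith)
    moreover have "N (i + k) \<subseteq> N (Suc (i + k))" by (rule up) (use Suc.prems in arith)
    ultimately have "N i \<subseteq> N (Suc (i + k))" by (rule order_trans)
    then show ?case by simp
  qed simp
  then show "N i \<subseteq> N j" if "i \<le> j" "j \<le> n"
    using that by (metis le_add_diff_inverse)
qed

lemma filling_tower_sum:
  "filling_tower n N \<Longrightarrow> i < n \<Longrightarrow> x \<in> N i \<Longrightarrow> y \<in> N i \<Longrightarrow> x + y \<in> N (Suc i)"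
  unfolding filling_tower_def by blast

lemma filling_tower_bound:
  assumes "filling_tower n N" "i < n"
    and c: "singular_chain k (top_of_set {g + (x + y) | x y. x \<in> N i \<and> y \<in> N i}) c" "chain_boundary k c = 0"
      "k = 0 \<longrightarrow> augmentation c = 0"
  shows "\<exists>w. singular_chain (Suc k) (top_of_set ((+) g ` N (Suc i))) w \<and> chain_boundary (Suc k) w = c"
proof -
  have "cycles_bound euclidean ((+) g ` {x + y | x y. x \<in> N i \<and> y \<in> N i}) ((+) g ` N (Suc i))"
    using assms(1,2) by (intro cycles_bound_translate) (simp add: filling_tower_def)
  moreover have "(+) g ` {x + y | x y. x \<in> N i \<and> y \<in> N i} = {g + (x + y) | x y. x \<in> N i \<and> y \<in> N i}"
    unfolding image_def by blast
  ultimately have "cycles_bound euclidean {g + (x + y) | x y. x \<in> N i \<and> y \<in> N i} ((+) g ` N (Suc i))"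
    by simp
  from this[unfolded cycles_bound_def, rule_format, OF c(1,2)] c(3) show ?thesis by blast
qed


section \<open>Comparing tuples with singular simplices\<close>

definition vertex_list :: "nat \<Rightarrow> ((nat \<Rightarrow> real) \<Rightarrow> 'a) \<Rightarrow> 'a list" where
  "vertex_list k s = list_of k (\<lambda>i. s (simplex_vertex i))"

lemma length_vertex_list [simp]: "length (vertex_list k s) = Suc k"
  by (simp add: vertex_list_def)

lemma hd_vertex_list: "hd (vertex_list k s) = s (simplex_vertex 0)"
  by (simp add: vertex_list_def list_of_def upt_conv_Cons del: upt_Suc)

lemma set_vertex_list: "set (vertex_list k s) \<subseteq> s ` standard_simplex k"
  by (auto simp: vertex_list_def set_list_of simplex_vertex_in_standard_simplex)

lemma tuple_of_vertex_list: "tuple_of k (vertex_list k s) = (\<lambda>i\<in>{..k}. s (simplex_vertex i))"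
  by (auto simp: tuple_of_def vertex_list_def nth_list_of)

lemma vertex_list_face:
  assumes "j \<le> Suc q"
  shows "vertex_list q (singular_face (Suc q) j s) =
    take j (vertex_list (Suc q) s) @ drop (Suc j) (vertex_list (Suc q) s)"
proof -
  have "tuple_of q (vertex_list q (singular_face (Suc q) j s)) = omit q j (tuple_of (Suc q) (vertex_list (Suc q) s))"
    unfolding tuple_of_vertex_list by (rule vertices_face[OF assms])
  also have "\<dots> = tuple_of q (take j (vertex_list (Suc q) s) @ drop (Suc j) (vertex_list (Suc q) s))"
    using assms by (intro omit_tuple_of) auto
  finally have "list_of q (tuple_of q (vertex_list q (singular_face (Suc q) j s))) =
      list_of q (tuple_of q (take j (vertex_list (Suc q) s) @ drop (Suc j) (vertex_list (Suc q) s)))" by simp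
  then show ?thesis using assms by (simp add: list_of_tuple_of)
qed

lemma list_boundary_vertex_list:
  "list_boundary (vertex_list (Suc q) s) = frag_extend (frag_of \<circ> vertex_list q) (chain_boundary (Suc q) (frag_of s))"
proof -
  have "{..Suc q} = {..<length (vertex_list (Suc q) s)}" by auto
  then show ?thesis
    unfolding list_boundary_sum face_sum_singular[symmetric] face_sum_def
    by (simp add: frag_extend_sum frag_extend_cmul o_def vertex_list_face del: sum.lessThan_Suc sum.atMost_Suc)
qed

definition close_points :: "'g::group_add set \<Rightarrow> 'g set \<Rightarrow> bool" where
  "close_points N S \<longleftrightarrow> (\<forall>x\<in>S. \<forall>y\<in>S. - x + y \<in> N)"

lemma close_points_subset: "close_points N S \<Longrightarrow> T \<subseteq> S \<Longrightarrow> close_points N T"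
  by (auto simp: close_points_def)

lemma hd_in_set: "length l = Suc k \<Longrightarrow> hd l \<in> set l"
  by (cases l) auto

lemma shift_carrier:
  fixes g h :: "'g::group_add"
  assumes "- g + h \<in> N" "N \<subseteq> M"
  shows "(+) h ` M \<subseteq> {g + (x + y) | x y. x \<in> M \<and> y \<in> M}"
proof
  fix z assume "z \<in> (+) h ` M"
  then obtain u where "u \<in> M" "z = h + u" by blast
  then have "z = g + ((- g + h) + u)" by (simp add: add.assoc[symmetric])
  then show "z \<in> {g + (x + y) | x y. x \<in> M \<and> y \<in> M}" using assms \<open>u \<in> M\<close> by blast
qed

lemma augmentation_list_boundary: "length l \<ge> 2 \<Longrightarrow> augmentation (list_boundary l) = of_bool (odd (length l))"
proof (induction l)
  case (Cons y ys)
  have eq: "augmentation (list_boundary (y # ys)) = 1 - augmentation (list_boundary ys)"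
    by (simp add: augmentation_def frag_eval_diff frag_eval_extend)
  show ?case
  proof (cases ys)
    case (Cons z zs)
    show ?thesis
    proof (cases zs)
      case Nil
      then show ?thesis unfolding Cons by (simp add: augmentation_def frag_eval_diff)
    next
      case (Cons w ws)
      then have "length ys \<ge> 2" using \<open>ys = z # zs\<close> by simp
      then show ?thesis using eq Cons.IH by simp
    qed
  qed (use Cons.prems in simp)
qed simp

text \<open>The method of acyclic carriers. If \<open>L\<close> is a chain map up to degree \<open>m\<close>, then for a close list \<open>l\<close> of degree
  \<open>m + 1\<close> the chain \<open>L (\<partial> l)\<close> is a cycle carried by the translate of \<open>N m + N m\<close> to the head of \<open>l\<close>, and the
  tower provides a chain with this boundary in the translate of \<open>N (m + 1)\<close>.\<close>

lemma close_tuples_fill: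
  fixes N :: "nat \<Rightarrow> 'g::topological_group_add set"
  assumes tower: "filling_tower n N"
  shows "\<exists>L :: 'g list \<Rightarrow> _. L [] = 0 \<and> (\<forall>y. L [y] = frag_of (restrict (\<lambda>_. y) (standard_simplex 0))) \<and>
    (\<forall>k l. k \<le> m \<longrightarrow> k \<le> n \<longrightarrow> length l = Suc k \<longrightarrow> close_points (N 0) (set l) \<longrightarrow>
      singular_chain k (top_of_set ((+) (hd l) ` N k)) (L l) \<and>
      chain_boundary k (L l) = frag_extend L (list_boundary l))"
proof (induction m)
  case 0
  define L :: "'g list \<Rightarrow> _" where
    "L l = (if length l = 1 then frag_of (restrict (\<lambda>_. hd l) (standard_simplex 0)) else 0)" for l
  have "singular_chain k (top_of_set ((+) (hd l) ` N k)) (L l) \<and> chain_boundary k (L l) = frag_extend L (list_boundary l)"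
    if k: "k \<le> 0" "k \<le> n" "length l = Suc k" for k and l :: "'g list"
  proof -
    have k0: "k = 0" using k by simp
    then obtain y where l: "l = [y]" using k by (auto simp: length_Suc_conv)
    have "y \<in> (+) y ` N 0" using filling_towerD(2)[OF tower, of 0] by (force intro: image_eqI[of _ _ 0])
    then have "singular_simplex 0 (top_of_set ((+) y ` N 0)) (restrict (\<lambda>_. y) (standard_simplex 0))"
      by (auto simp: singular_simplex_def)
    moreover have "frag_extend L (list_boundary [y]) = L []" by simp
    moreover have "L [] = 0" by (simp add: L_def)
    moreover have "chain_boundary 0 c = 0" for c :: "'g chain" by (simp add: chain_boundary_def)
    ultimately show ?thesis unfolding k0 l by (simp add: L_def singular_chain_of)
  qed
  moreover have "L [] = 0" by (simp add: L_def)
  moreover have "L [y] = frag_of (restrict (\<lambda>_. y) (standard_simplex 0))" for y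
    by (subst L_def) (simp add: restrict_def)
  ultimately show ?case by (intro exI[of _ L]) blast
next
  case (Suc m)
  then obtain L :: "'g list \<Rightarrow> _" where L0: "L [] = 0" and L1: "\<And>y. L [y] = frag_of (restrict (\<lambda>_. y) (standard_simplex 0))"
    and L: "\<And>k l. k \<le> m \<Longrightarrow> k \<le> n \<Longrightarrow> length l = Suc k \<Longrightarrow> close_points (N 0) (set l) \<Longrightarrow>
      singular_chain k (top_of_set ((+) (hd l) ` N k)) (L l) \<and> chain_boundary k (L l) = frag_extend L (list_boundary l)"
    by blast
  have "\<exists>w. length l = Suc (Suc m) \<and> Suc m \<le> n \<and> close_points (N 0) (set l) \<longrightarrow>
      singular_chain (Suc m) (top_of_set ((+) (hd l) ` N (Suc m))) w \<and>
      chain_boundary (Suc m) w = frag_extend L (list_boundary l)" for l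
  proof (cases "length l = Suc (Suc m) \<and> Suc m \<le> n \<and> close_points (N 0) (set l)")
    case True
    then have l: "length l = Suc (Suc m)" "Suc m \<le> n" "close_points (N 0) (set l)" by auto
    let ?c = "frag_extend L (list_boundary l)"
    have m: "length t = Suc m" "close_points (N 0) (set t)" "- hd l + hd t \<in> N 0"
      if "t \<in> Poly_Mapping.keys (list_boundary l)" for t
    proof -
      note kt = keys_list_boundary[OF that]
      show t: "length t = Suc m" using kt l by simp
      show "close_points (N 0) (set t)" by (rule close_points_subset[OF l(3) kt(2)])
      show "- hd l + hd t \<in> N 0"
        using l(3) hd_in_set[OF l(1)] hd_in_set[OF t] kt(2) unfolding close_points_def by blast
    qed
    have "singular_chain m (top_of_set {hd l + (x + y) | x y. x \<in> N m \<and> y \<in> N m}) ?c"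
    proof (rule singular_chain_extend)
      fix t assume t: "t \<in> Poly_Mapping.keys (list_boundary l)"
      have "(+) (hd t) ` N m \<subseteq> {hd l + (x + y) | x y. x \<in> N m \<and> y \<in> N m}"
        by (rule shift_carrier[OF m(3)[OF t] filling_towerD(3)[OF tower]]) (use l in auto)
      then show "singular_chain m (top_of_set {hd l + (x + y) | x y. x \<in> N m \<and> y \<in> N m}) (L t)"
        using L[of m t] m[OF t] l(2) singular_chain_mono by auto
    qed
    moreover have "chain_boundary m ?c = 0"
    proof -
      have "chain_boundary m ?c = frag_extend (\<lambda>t. frag_extend L (list_boundary t)) (list_boundary l)"
        unfolding chain_boundary_frag_extend by (rule frag_extend_eq) (use L[of m] m l(2) in auto)
      then show ?thesis by (simp add: frag_extend_extend[symmetric] list_boundary_boundary)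
    qed
    moreover have "augmentation ?c = 0" if "m = 0"
    proof -
      have "augmentation ?c = frag_eval (\<lambda>t. 1) (list_boundary l)"
        unfolding augmentation_def frag_eval_extend
      proof (rule frag_eval_cong)
        fix t assume "t \<in> Poly_Mapping.keys (list_boundary l)"
        then have "length t = Suc 0" using m(1) that by simp
        then obtain y where "t = [y]" by (auto simp: length_Suc_conv)
        then show "frag_eval (\<lambda>_. 1) (L t) = 1" by (simp add: L1)
      qed
      then show ?thesis using augmentation_list_boundary[of l] l(1) that by (simp add: augmentation_def)
    qed
    ultimately show ?thesis using filling_tower_bound[OF tower, of m m "hd l" ?c] l(2) by auto
  qed auto
  then obtain w where w: "\<And>l. length l = Suc (Suc m) \<Longrightarrow> Suc m \<le> n \<Longrightarrow> close_points (N 0) (set l) \<Longrightarrow>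
      singular_chain (Suc m) (top_of_set ((+) (hd l) ` N (Suc m))) (w l) \<and>
      chain_boundary (Suc m) (w l) = frag_extend L (list_boundary l)" by metis
  \<comment> \<open>Only lists of the new degree receive a new value, so the boundaries of shorter lists are not affected.\<close>
  define L' where "L' l = (if length l = Suc (Suc m) then w l else L l)" for l
  have L'L: "frag_extend L' (list_boundary l) = frag_extend L (list_boundary l)" if "length l \<le> Suc (Suc m)" for l
    by (rule frag_extend_eq) (use that keys_list_boundary(1) in \<open>force simp: L'_def\<close>)
  have "singular_chain k (top_of_set ((+) (hd l) ` N k)) (L' l) \<and> chain_boundary k (L' l) = frag_extend L' (list_boundary l)"
    if k: "k \<le> Suc m" "k \<le> n" "length l = Suc k" "close_points (N 0) (set l)" for k l
  proof (cases "k = Suc m")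
    case True
    then show ?thesis using w[of l] L'L[of l] k by (simp add: L'_def)
  next
    case False
    then show ?thesis using L[of k l] L'L[of l] k by (simp add: L'_def)
  qed
  moreover have "L' [] = 0" "L' [y] = frag_of (restrict (\<lambda>_. y) (standard_simplex 0))" for y
    using L0 L1 by (simp_all add: L'_def)
  ultimately show ?case by (intro exI[of _ L']) blast
qed

text \<open>The filling \<open>L\<close> of the vertices of a simplex \<open>s\<close> and \<open>s\<close> itself are carried by the same translate, so the
  acyclic carrier argument also connects them by a chain homotopy. In degree 0 they coincide and \<open>E\<close> is 0.\<close>

lemma close_simplices_homotopy:
  fixes N :: "nat \<Rightarrow> 'g::topological_group_add set"
  assumes tower: "filling_tower n N"
    and L1: "\<And>y. L [y] = frag_of (restrict (\<lambda>_. y) (standard_simplex 0))"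
    and L: "\<And>k l. k \<le> n \<Longrightarrow> length l = Suc k \<Longrightarrow> close_points (N 0) (set l) \<Longrightarrow>
      singular_chain k (top_of_set ((+) (hd l) ` N k)) (L l) \<and> chain_boundary k (L l) = frag_extend L (list_boundary l)"
  shows "\<exists>E. \<forall>k\<le>m. Suc k \<le> n \<longrightarrow> (\<forall>s. singular_simplex k euclidean s \<longrightarrow> close_points (N 0) (s ` standard_simplex k) \<longrightarrow>
    singular_chain (Suc k) (top_of_set ((+) (s (simplex_vertex 0)) ` N (Suc k))) (E k s) \<and>
    chain_boundary (Suc k) (E k s) = L (vertex_list k s) - frag_of s - frag_extend (E (k - 1)) (chain_boundary k (frag_of s)))"
    (is "\<exists>E. \<forall>k\<le>m. Suc k \<le> n \<longrightarrow> (\<forall>s. singular_simplex k euclidean s \<longrightarrow> close_points (N 0) (s ` standard_simplex k) \<longrightarrow>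
      ?P k (E k) (E (k - 1)) s)")
proof (induction m)
  case 0
  have "L (vertex_list 0 s) = frag_of s" if "singular_simplex 0 euclidean s" for s
  proof -
    have s: "s \<in> extensional (standard_simplex 0)" using that by (simp add: singular_simplex_def)
    have ss: "standard_simplex 0 = {simplex_vertex 0}" by (simp add: standard_simplex_0 simplex_vertex_def)
    have "restrict (\<lambda>_. s (simplex_vertex 0)) (standard_simplex 0) = s"
      by (rule extensionalityI[OF _ s]) (auto simp: ss)
    then show ?thesis by (simp add: vertex_list_def list_of_def L1)
  qed
  moreover have "chain_boundary 0 c = 0" for c :: "'g chain" by (simp add: chain_boundary_def)
  ultimately show ?case by (intro exI[of _ "\<lambda>_ _. 0"]) simp
next
  case (Suc m)
  then obtain E where E: "\<And>k s. k \<le> m \<Longrightarrow> Suc k \<le> n \<Longrightarrow> singular_simplex k euclidean s \<Longrightarrow>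
      close_points (N 0) (s ` standard_simplex k) \<Longrightarrow> ?P k (E k) (E (k - 1)) s" by blast
  have "\<exists>w. Suc (Suc m) \<le> n \<and> singular_simplex (Suc m) euclidean s \<and> close_points (N 0) (s ` standard_simplex (Suc m)) \<longrightarrow>
      singular_chain (Suc (Suc m)) (top_of_set ((+) (s (simplex_vertex 0)) ` N (Suc (Suc m)))) w \<and>
      chain_boundary (Suc (Suc m)) w =
        L (vertex_list (Suc m) s) - frag_of s - frag_extend (E m) (chain_boundary (Suc m) (frag_of s))" for s
  proof (cases "Suc (Suc m) \<le> n \<and> singular_simplex (Suc m) euclidean s \<and> close_points (N 0) (s ` standard_simplex (Suc m))")
    case True
    then have n: "Suc (Suc m) \<le> n" and s: "singular_simplex (Suc m) euclidean s"
      and close: "close_points (N 0) (s ` standard_simplex (Suc m))" by auto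
    let ?bs = "chain_boundary (Suc m) (frag_of s)" and ?v = "vertex_list (Suc m) s" and ?g = "s (simplex_vertex 0)"
    let ?N = "N (Suc m)"
    let ?S = "{?g + (x + y) | x y. x \<in> ?N \<and> y \<in> ?N}"
    let ?c = "L ?v - frag_of s - frag_extend (E m) ?bs"
    have N0: "0 \<in> ?N" using filling_towerD(2)[OF tower] n by simp
    have N0m: "N 0 \<subseteq> ?N" using filling_towerD(3)[OF tower, of 0 "Suc m"] n by simp
    have gS: "?g \<in> s ` standard_simplex (Suc m)" using simplex_vertex_in_standard_simplex by blast
    have sub: "(+) ?g ` ?N \<subseteq> ?S"
      by (rule shift_carrier[of _ _ ?N]) (use N0 in auto)
    have face: "singular_simplex m euclidean t" "close_points (N 0) (t ` standard_simplex m)"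
      "- ?g + t (simplex_vertex 0) \<in> N 0" if t: "t \<in> Poly_Mapping.keys ?bs" for t
    proof -
      show "singular_simplex m euclidean t" using keys_boundary_simplex[OF s t] by simp
      have "singular_chain (Suc m) (top_of_set (s ` standard_simplex (Suc m))) (frag_of s)"
        using s by (simp add: singular_chain_of singular_simplex_subtopology)
      then have "singular_chain m (top_of_set (s ` standard_simplex (Suc m))) ?bs" by (rule singular_chain_boundary_alt)
      then have ts: "t ` standard_simplex m \<subseteq> s ` standard_simplex (Suc m)"
        using t by (auto simp: singular_chain_subtopology)
      show "close_points (N 0) (t ` standard_simplex m)" by (rule close_points_subset[OF close ts])
      have "t (simplex_vertex 0) \<in> s ` standard_simplex (Suc m)"
        using ts simplex_vertex_in_standard_simplex[of 0 m] by blast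
      then show "- ?g + t (simplex_vertex 0) \<in> N 0" using close gS unfolding close_points_def by blast
    qed
    have vclose: "close_points (N 0) (set ?v)" by (rule close_points_subset[OF close set_vertex_list])
    note Lv = L[of "Suc m" ?v, OF _ _ vclose]
    have "singular_chain (Suc m) (top_of_set ?S) (L ?v)"
      using Lv n singular_chain_mono[OF _ sub] by (simp add: hd_vertex_list)
    moreover have "singular_chain (Suc m) (top_of_set ?S) (frag_of s)"
    proof -
      have "x \<in> ?S" if "x \<in> s ` standard_simplex (Suc m)" for x
      proof -
        have "- ?g + x \<in> ?N" using close gS that N0m unfolding close_points_def by blast
        moreover have "x = ?g + ((- ?g + x) + 0)" by (simp add: add.assoc[symmetric])
        ultimately show ?thesis using N0 by blast
      qed
      then show ?thesis using s by (auto simp: singular_chain_of singular_simplex_subtopology)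
    qed
    moreover have "singular_chain (Suc m) (top_of_set ?S) (frag_extend (E m) ?bs)"
    proof (rule singular_chain_extend)
      fix t assume t: "t \<in> Poly_Mapping.keys ?bs"
      have "(+) (t (simplex_vertex 0)) ` ?N \<subseteq> ?S" by (rule shift_carrier[OF face(3)[OF t] N0m])
      then show "singular_chain (Suc m) (top_of_set ?S) (E m t)"
        using E[of m t] face[OF t] n singular_chain_mono by auto
    qed
    ultimately have c: "singular_chain (Suc m) (top_of_set ?S) ?c" by (intro singular_chain_diff)
    have z: "frag_extend (\<lambda>t. frag_extend (E (m - 1)) (chain_boundary m (frag_of t))) ?bs = 0"
      using chain_boundary_boundary_of[OF s] chain_boundary_expansion[of m ?bs]
      by (simp add: frag_extend_extend[symmetric])
    have "chain_boundary (Suc m) (frag_extend (E m) ?bs) = frag_extend (\<lambda>t. L (vertex_list m t) - frag_of t -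
          frag_extend (E (m - 1)) (chain_boundary m (frag_of t))) ?bs"
      unfolding chain_boundary_frag_extend by (rule frag_extend_eq) (use E[of m] face n in auto)
    also have "\<dots> = frag_extend (\<lambda>t. L (vertex_list m t)) ?bs - ?bs"
      unfolding frag_extend_diff_fun z by (simp add: frag_expansion[symmetric])
    also have "frag_extend (\<lambda>t. L (vertex_list m t)) ?bs = chain_boundary (Suc m) (L ?v)"
      using Lv n by (simp add: list_boundary_vertex_list frag_extend_extend)
    finally have "chain_boundary (Suc m) ?c = 0" by (simp add: chain_boundary_diff)
    then show ?thesis using filling_tower_bound[OF tower, of "Suc m" "Suc m" ?g ?c] c n by auto
  qed auto
  then obtain E' where E': "\<And>s. Suc (Suc m) \<le> n \<Longrightarrow> singular_simplex (Suc m) euclidean s \<Longrightarrow>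
      close_points (N 0) (s ` standard_simplex (Suc m)) \<Longrightarrow> ?P (Suc m) E' (E m) s" by (simp, metis)
  show ?case
  proof (intro exI[of _ "E(Suc m := E')"] allI impI)
    fix k s assume k: "k \<le> Suc m" "Suc k \<le> n" and s: "singular_simplex k euclidean s"
      "close_points (N 0) (s ` standard_simplex k)"
    show "?P k ((E(Suc m := E')) k) ((E(Suc m := E')) (k - 1)) s"
    proof (cases "k = Suc m")
      case True
      then show ?thesis using E'[of s] k s by simp
    next
      case False
      then have "k \<le> m" "k - 1 \<noteq> Suc m" "k \<noteq> Suc m" using k by auto
      then show ?thesis using E[OF _ k(2) s] by simp
    qed
  qed
qed

text \<open>The acyclic carrier argument for lists, where fillings are explicit: every cycle is the boundary of the cone
  from any point, here from the head of the list, so that no carrier has to be enlarged.\<close>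

primrec list_homotopy :: "('a list \<Rightarrow> 'a list \<Rightarrow>\<^sub>0 int) \<Rightarrow> nat \<Rightarrow> 'a list \<Rightarrow> 'a list \<Rightarrow>\<^sub>0 int" where
  "list_homotopy \<mu> 0 l = 0"
| "list_homotopy \<mu> (Suc k) l =
     list_cone (hd l) (\<mu> l - frag_of l - frag_extend (list_homotopy \<mu> k) (list_boundary l))"

lemma list_homotopy_boundary:
  assumes P: "\<And>l m. P l \<Longrightarrow> m \<in> Poly_Mapping.keys (list_boundary l) \<Longrightarrow> P m"
    and \<mu>1: "\<And>y. P [y] \<Longrightarrow> \<mu> [y] = frag_of [y]"
    and \<mu>: "\<And>l. P l \<Longrightarrow> length l \<le> Suc n \<Longrightarrow> length l \<ge> 2 \<Longrightarrow>
      frag_extend list_boundary (\<mu> l) = frag_extend \<mu> (list_boundary l)"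
  shows "P l \<Longrightarrow> length l = Suc k \<Longrightarrow> k \<le> n \<Longrightarrow>
    frag_extend list_boundary (list_homotopy \<mu> k l) =
    \<mu> l - frag_of l - frag_extend (list_homotopy \<mu> (k - 1)) (list_boundary l)"
proof (induction k arbitrary: l)
  case 0
  then obtain y where l: "l = [y]" by (auto simp: length_Suc_conv)
  then show ?case using \<mu>1 0 by simp
next
  case (Suc k)
  let ?z = "\<mu> l - frag_of l - frag_extend (list_homotopy \<mu> k) (list_boundary l)"
  have m: "P m" "length m = Suc k" if "m \<in> Poly_Mapping.keys (list_boundary l)" for m
    using P[OF Suc.prems(1) that] keys_list_boundary(1)[OF that] Suc.prems(2) by auto
  have "frag_extend list_boundary (frag_extend (list_homotopy \<mu> k) (list_boundary l)) =
      frag_extend (\<lambda>m. \<mu> m - frag_of m - frag_extend (list_homotopy \<mu> (k - 1)) (list_boundary m)) (list_boundary l)"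
    unfolding frag_extend_extend by (rule frag_extend_eq) (use Suc.IH m Suc.prems(3) in auto)
  also have "\<dots> = frag_extend \<mu> (list_boundary l) - list_boundary l"
    by (simp add: frag_extend_diff_fun frag_extend_extend[symmetric] list_boundary_boundary frag_expansion[symmetric])
  finally have "frag_extend list_boundary ?z = 0"
    using \<mu>[OF Suc.prems(1)] Suc.prems(2,3) by (simp add: frag_extend_diff)
  then show ?case by (simp add: list_boundary_cone)
qed

lemma keys_list_homotopy:
  assumes \<mu>: "\<And>m m'. set m \<subseteq> S0 \<Longrightarrow> length m \<le> Suc n \<Longrightarrow> m \<noteq> [] \<Longrightarrow> m' \<in> Poly_Mapping.keys (\<mu> m) \<Longrightarrow>
      length m' = length m \<and> set m' \<subseteq> S"
    and "S0 \<subseteq> S"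
  shows "set l \<subseteq> S0 \<Longrightarrow> length l = Suc k \<Longrightarrow> k \<le> n \<Longrightarrow> m \<in> Poly_Mapping.keys (list_homotopy \<mu> k l) \<Longrightarrow>
    length m = Suc (Suc k) \<and> set m \<subseteq> S"
proof (induction k arbitrary: l m)
  case (Suc k)
  obtain t where t: "t \<in> Poly_Mapping.keys (\<mu> l - frag_of l - frag_extend (list_homotopy \<mu> k) (list_boundary l))"
    and m: "m = hd l # t" using Suc.prems(4) keys_cone by fastforce
  have "t \<in> Poly_Mapping.keys (\<mu> l) \<or> t = l \<or>
      (\<exists>r\<in>Poly_Mapping.keys (list_boundary l). t \<in> Poly_Mapping.keys (list_homotopy \<mu> k r))"
    using t keys_diff[of "\<mu> l - frag_of l" "frag_extend (list_homotopy \<mu> k) (list_boundary l)"]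
      keys_diff[of "\<mu> l" "frag_of l"] keys_frag_extend[of "list_homotopy \<mu> k" "list_boundary l"] by auto
  then have "length t = Suc (Suc k) \<and> set t \<subseteq> S"
  proof (elim disjE bexE)
    assume "t \<in> Poly_Mapping.keys (\<mu> l)"
    moreover have "l \<noteq> []" using Suc.prems(2) by auto
    ultimately show ?thesis using \<mu>[of l t] Suc.prems by auto
  next
    assume "t = l"
    then show ?thesis using Suc.prems \<open>S0 \<subseteq> S\<close> by auto
  next
    fix r assume r: "r \<in> Poly_Mapping.keys (list_boundary l)" "t \<in> Poly_Mapping.keys (list_homotopy \<mu> k r)"
    show ?thesis
      using Suc.IH[OF _ _ _ r(2)] keys_list_boundary[OF r(1)] Suc.prems by auto
  qed
  moreover have "hd l \<in> S" using hd_in_set[OF Suc.prems(2)] Suc.prems(1) \<open>S0 \<subseteq> S\<close> by blast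
  ultimately show ?case using m by simp
qed simp


section \<open>Continuous pseudometrics on a topological group\<close>

fun chain_length :: "('a \<Rightarrow> 'a \<Rightarrow> real) \<Rightarrow> 'a list \<Rightarrow> real" where
  "chain_length f (x # y # zs) = f x y + chain_length f (y # zs)"
| "chain_length f _ = 0"

lemma chain_length_nonneg: "(\<And>x y. f x y \<ge> 0) \<Longrightarrow> chain_length f l \<ge> 0"
  by (induction f l rule: chain_length.induct) auto

lemma chain_length_append:
  "xs \<noteq> [] \<Longrightarrow> chain_length f (xs @ y # ys) = chain_length f xs + f (last xs) y + chain_length f (y # ys)"
proof (induction xs)
  case (Cons x xs)
  then show ?case by (cases xs) auto
qed simp

lemma chain_length_snoc_append:
  "chain_length f (xs @ y # ys) = chain_length f (xs @ [y]) + chain_length f (y # ys)"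
  by (cases "xs = []") (simp_all add: chain_length_append)

lemma chain_length_rev: "(\<And>x y. f x y = f y x) \<Longrightarrow> chain_length f (rev l) = chain_length f l"
proof (induction l)
  case (Cons x xs)
  then show ?case
  proof (cases xs)
    case (Cons y ys)
    then show ?thesis using Cons.IH Cons.prems chain_length_append[of "rev xs" f x "[]"] by simp
  qed simp
qed simp

text \<open>The step \<open>u, v\<close> is the one at which the length of the chain passes \<open>a\<close>.\<close>

lemma chain_split:
  assumes f: "\<And>x y. f x y \<ge> (0::real)" and ne: "l \<noteq> []" "a \<ge> 0" and a: "chain_length f (x # l) > a"
  shows "\<exists>us u v vs. x # l = us @ u # v # vs \<and> chain_length f (us @ [u]) \<le> a \<and>
    chain_length f (us @ [u, v]) > a"
  using ne a
proof (induction l arbitrary: x a)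
  case (Cons y l)
  show ?case
  proof (cases "f x y > a")
    case True
    then show ?thesis using Cons.prems by (intro exI[of _ "[]"]) auto
  next
    case False
    then have "l \<noteq> []" using Cons.prems by (cases l) auto
    then obtain us u v vs where *: "y # l = us @ u # v # vs" "chain_length f (us @ [u]) \<le> a - f x y"
      "chain_length f (us @ [u, v]) > a - f x y"
      using Cons.IH[of "a - f x y" y] False Cons.prems by auto
    have "chain_length f (x # us @ w # ws) = f x y + chain_length f (us @ w # ws)" if "hd (us @ [w]) = y" for w ws
      using that by (cases us) auto
    moreover have "hd (us @ [u]) = y" using *(1) by (cases us) auto
    ultimately have "chain_length f ((x # us) @ [u]) \<le> a" "chain_length f ((x # us) @ [u, v]) > a"
      using *(2,3) by auto
    moreover have "x # y # l = (x # us) @ u # v # vs" using *(1) by simp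
    ultimately show ?thesis by blast
  qed
qed simp

text \<open>The key to Kelley's metrization lemma. The chain is cut at the step where its length passes one half of the
  total. Both remaining parts have at most half of the length and the step itself at most all of it, so by
  induction each of the three is in \<open>R (Suc n)\<close>, and three such relations compose to \<open>R n\<close>.\<close>

lemma chain_lemma:
  fixes R :: "nat \<Rightarrow> 'a \<Rightarrow> 'a \<Rightarrow> bool" and f :: "'a \<Rightarrow> 'a \<Rightarrow> real"
  assumes refl: "\<And>n x. R n x x"
    and R3: "\<And>n w x y z. R (Suc n) w x \<Longrightarrow> R (Suc n) x y \<Longrightarrow> R (Suc n) y z \<Longrightarrow> R n w z"
    and nonneg: "\<And>x y. f x y \<ge> 0"
    and fR: "\<And>n x y. f x y < (1/2) ^ n \<Longrightarrow> R (Suc n) x y"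
  shows "chain_length f (x # l) < (1/2) ^ n \<Longrightarrow> R n x (last (x # l))"
proof (induction "length l" arbitrary: x l n rule: less_induct)
  case less
  have mono: "R n x y" if "R (Suc n) x y" for n x y
    using R3[OF that refl refl] .
  show ?case
  proof (cases l rule: list.exhaust)
    case Nil
    then show ?thesis using refl by simp
  next
    case (Cons y l')
    let ?c = "chain_length f (x # l)"
    have c0: "?c \<ge> 0" by (rule chain_length_nonneg[OF nonneg])
    show ?thesis
    proof (cases "?c = 0")
      case True
      then have "f x y = 0" "chain_length f (y # l') = 0"
        using Cons nonneg[of x y] chain_length_nonneg[of f "y # l'", OF nonneg] by auto
      then have "R (Suc n) x y" "R (Suc n) y (last (y # l'))"
        using fR[of x y n] less(1)[of l' y "Suc n"] Cons by auto
      then show ?thesis using R3[OF _ _ refl] Cons by auto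
    next
      case False
      then have a: "?c > ?c / 2" using c0 by simp
      have "\<exists>us u v vs. x # l = us @ u # v # vs \<and> chain_length f (us @ [u]) \<le> ?c / 2 \<and>
          chain_length f (us @ [u, v]) > ?c / 2"
        by (rule chain_split[OF nonneg]) (use Cons a c0 in auto)
      then obtain us u v vs where s: "x # l = us @ u # v # vs" "chain_length f (us @ [u]) \<le> ?c / 2"
        "chain_length f (us @ [u, v]) > ?c / 2" by blast
      have "?c = chain_length f (us @ [u, v]) + chain_length f (v # vs)"
        unfolding s(1) using chain_length_snoc_append[of f "us @ [u]" v vs] by simp
      then have tail: "chain_length f (v # vs) < ?c / 2" using s(3) by linarith
      have split2: "chain_length f (us @ [u, v]) = chain_length f (us @ [u]) + f u v"
        using chain_length_snoc_append[of f us u "[v]"] by simp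
      have "f u v \<le> ?c"
        using \<open>?c = _\<close> split2 chain_length_nonneg[of f "us @ [u]", OF nonneg]
          chain_length_nonneg[of f "v # vs", OF nonneg] by linarith
      then have Ruv: "R (Suc n) u v" using fR[of u v n] less.prems by simp
      have half: "?c / 2 < (1/2) ^ Suc n" using less.prems by simp
      have "R (Suc n) v (last (v # vs))"
      proof (rule less(1))
        show "length vs < length l" using arg_cong[OF s(1), of length] by simp
        show "chain_length f (v # vs) < (1/2) ^ Suc n" using tail half by simp
      qed
      moreover have "R (Suc n) x u"
      proof (cases us)
        case Nil
        then show ?thesis using s(1) refl by simp
      next
        case (Cons w ws)
        then have w: "w = x" using s(1) by simp
        have "R (Suc n) x (last (x # ws @ [u]))"
        proof (rule less(1))
          show "length (ws @ [u]) < length l" using arg_cong[OF s(1), of length] Cons by simp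
          show "chain_length f (x # ws @ [u]) < (1/2) ^ Suc n" using s(2) half Cons w by simp
        qed
        then show ?thesis by simp
      qed
      moreover have "last (v # vs) = last (x # l)" unfolding s(1) by simp
      ultimately show ?thesis using R3[OF _ Ruv] by metis
    qed
  qed
qed

definition continuous_pseudometric :: "('a::topological_space \<Rightarrow> 'a \<Rightarrow> real) \<Rightarrow> bool" where
  "continuous_pseudometric d \<longleftrightarrow> (\<forall>x y. d x y \<ge> 0) \<and> (\<forall>x. d x x = 0) \<and> (\<forall>x y. d x y = d y x) \<and>
     (\<forall>x y z. d x z \<le> d x y + d y z) \<and> (\<forall>x e. e > 0 \<longrightarrow> (\<exists>O'. open O' \<and> x \<in> O' \<and> (\<forall>y\<in>O'. d x y < e)))"

text \<open>The Birkhoff-Kakutani construction: choose symmetric neighbourhoods \<open>W n\<close> with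
  \<open>W (n + 1) + W (n + 1) + W (n + 1)\<close> contained in \<open>W n\<close>, and let \<open>d\<close> be the infimum of the lengths of chains,
  a single step having length \<open>2\<^sup>-\<^sup>n\<close> if it lies in \<open>W (n + 1)\<close>. The chain lemma bounds \<open>d\<close> from below.\<close>

lemma group_pseudometric:
  fixes U :: "'g::topological_group_add set"
  assumes U: "open U" "0 \<in> U"
  shows "\<exists>d. continuous_pseudometric d \<and> (\<forall>x y. d x y < 1 \<longrightarrow> - x + y \<in> U)"
proof -
  have third: "\<exists>B. open B \<and> (0::'g) \<in> B \<and> (\<forall>x\<in>B. - x \<in> B) \<and> (\<forall>x\<in>B. \<forall>y\<in>B. \<forall>z\<in>B. x + y + z \<in> A)"
    if A: "open A" "0 \<in> A" for A :: "'g set"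
  proof -
    obtain B1 where B1: "open B1" "0 \<in> B1" "{x + y | x y. x \<in> B1 \<and> y \<in> B1} \<subseteq> A"
      by (rule open_halving[OF A])
    obtain B2 where B2: "open B2" "0 \<in> B2" "{x + y | x y. x \<in> B2 \<and> y \<in> B2} \<subseteq> B1"
      by (rule open_halving[OF B1(1,2)])
    have add1: "x + y \<in> A" if "x \<in> B1" "y \<in> B1" for x y using B1(3) that by blast
    have add2: "x + y \<in> B1" if "x \<in> B2" "y \<in> B2" for x y using B2(3) that by blast
    have B21: "x \<in> B1" if "x \<in> B2" for x using add2[OF that B2(2)] by simp
    have "open (uminus -` B2)" by (intro open_vimage B2 continuous_intros)
    then have "open (B2 \<inter> uminus -` B2)" using B2(1) by blast
    then show ?thesis
      using B2(2) B21 by (intro exI[of _ "B2 \<inter> uminus -` B2"]) (auto intro: add1 add2)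
  qed
  define T where "T A = (SOME B. open B \<and> (0::'g) \<in> B \<and> (\<forall>x\<in>B. - x \<in> B) \<and>
    (\<forall>x\<in>B. \<forall>y\<in>B. \<forall>z\<in>B. x + y + z \<in> A))" for A
  have T: "open (T A)" "0 \<in> T A" "\<And>x. x \<in> T A \<Longrightarrow> - x \<in> T A"
    "\<And>x y z. x \<in> T A \<Longrightarrow> y \<in> T A \<Longrightarrow> z \<in> T A \<Longrightarrow> x + y + z \<in> A" if A: "open A" "0 \<in> A" for A
    using someI_ex[OF third[OF A]] unfolding T_def[symmetric] by blast+
  define W where "W n = (T ^^ n) U" for n
  have W0: "W 0 = U" and WS: "W (Suc n) = T (W n)" for n by (simp_all add: W_def)
  have W: "open (W n) \<and> 0 \<in> W n" for n
    by (induction n) (use U T in \<open>auto simp: W0 WS\<close>)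
  have sym: "- x \<in> W (Suc n)" if "x \<in> W (Suc n)" for x n using T(3) W that by (simp add: WS)
  have W3: "x + y + z \<in> W n" if "x \<in> W (Suc n)" "y \<in> W (Suc n)" "z \<in> W (Suc n)" for x y z n
    using T(4) W that by (simp add: WS)
  have Wmono1: "W (Suc n) \<subseteq> W n" for n using W3[of _ n 0 0] W by auto
  have Wmono: "W n \<subseteq> W m" if "m \<le> n" for m n using that Wmono1 by (simp add: lift_Suc_antimono_le)
  define R where "R n x y \<longleftrightarrow> - x + y \<in> W n" for n and x y :: 'g
  define f where "f x y = Inf (insert 1 {(1/2::real) ^ n | n. R (Suc n) x y})" for x y
  have bdd: "bdd_below (insert 1 {(1/2::real) ^ n | n. R (Suc n) x y})" for x y
    by (rule bdd_belowI[of _ 0]) auto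
  have f0: "f x y \<ge> 0" for x y
    unfolding f_def by (rule cInf_greatest) auto
  have f_le: "f x y \<le> (1/2) ^ n" if "R (Suc n) x y" for x y n
    unfolding f_def by (rule cInf_lower[OF _ bdd]) (use that in auto)
  have f1: "f x y \<le> 1" for x y
    unfolding f_def by (rule cInf_lower[OF _ bdd]) auto
  \<comment> \<open>The step length \<open>f\<close> is the infimum over all admissible powers, capped by 1; below a power it lies in the next neighbourhood.\<close>
  have fR: "R (Suc n) x y" if "f x y < (1/2) ^ n" for n x y
  proof -
    have "\<exists>t\<in>insert 1 {(1/2::real) ^ n | n. R (Suc n) x y}. t < (1/2) ^ n"
      using that unfolding f_def by (subst (asm) cInf_less_iff[OF _ bdd]) auto
    moreover have "(1/2::real) ^ n \<le> 1" by (simp add: power_le_one)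
    ultimately obtain m where m: "R (Suc m) x y" "(1/2::real) ^ m < (1/2) ^ n" by auto
    then have "n < m" using power_strict_decreasing_iff[of "1/2::real" m n] by simp
    then show ?thesis using m(1) Wmono[of "Suc n" "Suc m"] by (auto simp: R_def)
  qed
  have Rsym: "R (Suc n) y x" if "R (Suc n) x y" for n x y
    using sym[of "- x + y" n] that by (simp add: R_def minus_add)
  have fsym: "f x y = f y x" for x y
  proof -
    have "R (Suc n) x y \<longleftrightarrow> R (Suc n) y x" for n using Rsym by blast
    then show ?thesis unfolding f_def by simp
  qed
  have Rrefl: "R n x x" for n x using W by (simp add: R_def)
  have R3: "R n w z" if "R (Suc n) w x" "R (Suc n) x y" "R (Suc n) y z" for n w x y z
  proof -
    have "- w + z = (- w + x) + (- x + y) + (- y + z)" by (simp add: add.assoc)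
    then show ?thesis using W3 that unfolding R_def by metis
  qed
  define D where "D x y = {chain_length f (x # l) | l. last (x # l) = y}" for x y
  define d where "d x y = Inf (D x y)" for x y
  have Dbdd: "bdd_below (D x y)" for x y
    unfolding D_def by (rule bdd_belowI[of _ 0]) (use chain_length_nonneg[of f, OF f0] in auto)
  have Dne: "D x y \<noteq> {}" for x y
  proof -
    have "chain_length f (x # [y]) \<in> D x y" unfolding D_def by (intro CollectI exI[of _ "[y]"]) auto
    then show ?thesis by blast
  qed
  have D_le: "d x y \<le> chain_length f (x # l)" if "last (x # l) = y" for x y l
  proof -
    have "chain_length f (x # l) \<in> D x y" using that unfolding D_def by blast
    then show ?thesis unfolding d_def by (rule cInf_lower[OF _ Dbdd])
  qed
  have d_f: "d x y \<le> f x y" for x y using D_le[of x "[y]" y] by simp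
  have d_less: "\<exists>l. last (x # l) = y \<and> chain_length f (x # l) < e" if "d x y < e" for x y e
    using cInf_lessD[OF Dne that[unfolded d_def]] unfolding D_def by blast
  have Dnonneg: "t \<ge> 0" if "t \<in> D x y" for t x y
    using that chain_length_nonneg[of f, OF f0] unfolding D_def by blast
  have d0: "d x y \<ge> 0" for x y
    unfolding d_def by (rule cInf_greatest[OF Dne Dnonneg])
  have dxx: "d x x = 0" for x
    using D_le[of x "[]" x] d0[of x x] by simp
  have dle: "d y x \<le> d x y" for x y
  proof (rule field_le_epsilon)
    fix e :: real assume "e > 0"
    then obtain l where l: "last (x # l) = y" "chain_length f (x # l) < d x y + e" using d_less[of x y "d x y + e"] by auto
    have "d y x \<le> chain_length f (rev (x # l))"
    proof -
      have "hd (rev (x # l)) = y" using l(1) by (simp only: hd_rev)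
      moreover have "rev (x # l) \<noteq> []" by simp
      ultimately obtain m where m: "rev (x # l) = y # m" by (metis list.exhaust_sel)
      have "last (y # m) = x" unfolding m[symmetric] by simp
      then show ?thesis using D_le[of y m x] m by simp
    qed
    also have "\<dots> = chain_length f (x # l)" by (rule chain_length_rev[OF fsym])
    finally show "d y x \<le> d x y + e" using l by simp
  qed
  have tri: "d x z \<le> d x y + d y z" for x y z
  proof (rule field_le_epsilon)
    fix e :: real assume e: "e > 0"
    obtain l where l: "last (x # l) = y" "chain_length f (x # l) < d x y + e/2" using d_less[of x y "d x y + e/2"] e by auto
    obtain m where m: "last (y # m) = z" "chain_length f (y # m) < d y z + e/2" using d_less[of y z "d y z + e/2"] e by auto
    have "x # l = butlast (x # l) @ [y]" using l(1) append_butlast_last_id[of "x # l"] by simp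
    then have "chain_length f (x # l @ m) = chain_length f (x # l) + chain_length f (y # m)"
      using chain_length_snoc_append[of f "butlast (x # l)" y m] by (metis append.assoc append_Cons append_Nil)
    moreover have "last (x # l @ m) = z"
      using l(1) m(1) by (cases m) auto
    ultimately show "d x z \<le> d x y + d y z + e" using D_le[of x "l @ m" z] l(2) m(2) by simp
  qed
  have dU: "- x + y \<in> U" if xy: "d x y < 1" for x y
  proof -
    obtain l where "last (x # l) = y" "chain_length f (x # l) < 1" using d_less[OF xy] by blast
    then have "R 0 x y" using chain_lemma[of R f x l 0, OF Rrefl R3 f0 fR] by simp
    then show ?thesis by (simp add: R_def W0)
  qed
  have dopen: "\<exists>O'. open O' \<and> x \<in> O' \<and> (\<forall>y\<in>O'. d x y < e)" if e: "e > 0" for x e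
  proof -
    obtain n where n: "(1/2::real) ^ n < e" using real_arch_pow_inv[OF e, of "1/2"] by auto
    have "open ((\<lambda>y. - x + y) -` W (Suc n))" using W by (intro open_vimage continuous_intros) auto
    moreover have "x \<in> (\<lambda>y. - x + y) -` W (Suc n)" using W by simp
    moreover have "d x y < e" if "y \<in> (\<lambda>y. - x + y) -` W (Suc n)" for y
    proof -
      have "R (Suc n) x y" using that by (simp add: R_def)
      then show ?thesis using f_le[of n x y] d_f[of x y] n by linarith
    qed
    ultimately show ?thesis by blast
  qed
  have dsym: "d x y = d y x" for x y using dle[of x y] dle[of y x] by linarith
  have "continuous_pseudometric d"
    unfolding continuous_pseudometric_def
    by (intro conjI allI impI; (rule d0 | rule dxx | rule dsym | rule tri | (rule dopen, assumption)))
  then show ?thesis using dU by blast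
qed

section \<open>Step partitions\<close>

text \<open>A replacement for a partition of unity subordinate to the translates of \<open>U\<close>. At a point \<open>y\<close> the times
  \<open>T n y\<close> cut the unit interval into steps, and the centre \<open>c n y\<close> is attached to the step from \<open>T n y\<close> to
  \<open>T (Suc n) y\<close>. Near every point only finitely many steps are nonempty, and the centres, which jump as \<open>y\<close>
  varies, are locally constant wherever their step can be nonempty.\<close>

locale step_partition =
  fixes U :: "'g::topological_group_add set" and T :: "nat \<Rightarrow> 'g \<Rightarrow> real" and c :: "nat \<Rightarrow> 'g \<Rightarrow> 'g"
  assumes U_open: "open U"
    and T_0: "\<And>y. T 0 y = 0" and T_01: "\<And>n y. T n y \<in> {0..1}"
    and T_continuous: "\<And>n. continuous_on UNIV (T n)"
    and T_1: "\<And>y. \<exists>O' m. open O' \<and> y \<in> O' \<and> (\<forall>n\<ge>m. \<forall>z\<in>O'. T n z = 1)"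
    and T_c: "\<And>n y. \<exists>O'. open O' \<and> y \<in> O' \<and>
       ((\<forall>z\<in>O'. c n z = c n y \<and> - c n z + z \<in> U) \<or> (\<forall>z\<in>O'. T (Suc n) z = T n z))"

text \<open>Stone's argument for the paracompactness of metric spaces, applied to a continuous pseudometric \<open>d\<close> whose unit
  balls lie in translates of \<open>U\<close>. After a choice of a well-order, \<open>p y\<close> is the first point whose unit ball
  contains \<open>y\<close>, and \<open>E n\<close> consists of the points that lie deep, by \<open>3 \<cdot> 2\<^sup>-\<^sup>n\<close>, in their first ball. Points of \<open>E n\<close>
  with different first balls are at least \<open>3 \<cdot> 2\<^sup>-\<^sup>n\<close> apart. So near \<open>E n\<close> the first ball of a neighbouring
  point of \<open>E n\<close> is a locally constant centre, and a bump function of the distance to \<open>E n\<close> produces the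
  \<open>n\<close>-th step; the steps are made disjoint by taking maxima.\<close>

lemma step_partition_exists:
  fixes U :: "'g::topological_group_add set"
  assumes U: "open U" "0 \<in> U"
  shows "\<exists>T c. step_partition U T c"
proof -
  obtain d :: "'g \<Rightarrow> 'g \<Rightarrow> real" where d: "continuous_pseudometric d" and dU: "\<And>x y. d x y < 1 \<Longrightarrow> - x + y \<in> U"
    using group_pseudometric[OF U] by blast
  from d have d0: "\<And>x y. d x y \<ge> 0" and dxx: "\<And>x. d x x = 0"
    and dsym: "\<And>x y. d x y = d y x" and tri: "\<And>x y z. d x z \<le> d x y + d y z"
    and dopen: "\<And>x e. e > 0 \<Longrightarrow> \<exists>O'. open O' \<and> x \<in> O' \<and> (\<forall>y\<in>O'. d x y < e)"
    unfolding continuous_pseudometric_def by blast+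
  obtain r where r: "well_order_on UNIV (r :: ('g \<times> 'g) set)" using well_order_on by blast
  have wf: "wf (r - Id)" and tot: "total_on UNIV r" using r by (auto simp: well_order_on_def linear_order_on_def)
  have least: "\<exists>x\<in>Q. \<forall>x'. (x', x) \<in> r - Id \<longrightarrow> x' \<notin> Q" if "x0 \<in> Q" for x0 and Q :: "'g set"
    using wfE_min[OF wf that] by metis
  define p where "p y = (SOME x. d x y < 1 \<and> (\<forall>x'. (x', x) \<in> r - Id \<longrightarrow> \<not> d x' y < 1))" for y
  have p: "d (p y) y < 1 \<and> (\<forall>x'. (x', p y) \<in> r - Id \<longrightarrow> \<not> d x' y < 1)" for y
    unfolding p_def by (rule someI_ex) (use least[of y "{x. d x y < 1}"] dxx in auto)
  define e where "e n = (1/2::real) ^ n" for n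
  have e0: "e n > 0" for n by (simp add: e_def)
  \<comment> \<open>The constants below leave room as follows: bumps live within \<open>e n\<close> of \<open>E n\<close>, centres are fixed within \<open>5/4\<close>, and two points of \<open>E n\<close> within \<open>3/2\<close> of the same point have the same first ball.\<close>
  define E where "E n = {y. d (p y) y \<le> 1 - 3 * e n}" for n
  have sep: "p y = p y'" if y: "y \<in> E n" "y' \<in> E n" and close: "d y y' < 3 * e n" for n y y'
  proof (rule ccontr)
    assume ne: "p y \<noteq> p y'"
    have "\<not> (p z, p w) \<in> r - Id" if "z \<in> E n" "d z w < 3 * e n" for z w
      using p[of w] tri[of "p z" w z] that unfolding E_def by auto
    then have "(p y, p y') \<notin> r - Id" "(p y', p y) \<notin> r - Id" using y close dsym by metis+
    then show False using ne tot by (auto simp: total_on_def)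
  qed
  \<comment> \<open>The distance to \<open>E n\<close>, capped so that it makes sense for empty \<open>E n\<close>.\<close>
  define \<rho> where "\<rho> n z = Inf (insert (2 * e n) (d z ` E n))" for n z
  have bdd: "bdd_below (insert (2 * e n) (d z ` E n))" for n z
    by (rule bdd_belowI[of _ 0]) (use d0 e0[of n] in auto)
  have rho_le: "\<rho> n z \<le> d z y" if "y \<in> E n" for n z y
    unfolding \<rho>_def by (rule cInf_lower[OF _ bdd]) (use that in auto)
  have rho0: "\<rho> n z \<ge> 0" for n z
    unfolding \<rho>_def by (rule cInf_greatest) (use d0 e0[of n] in auto)
  have rho_less: "\<exists>y\<in>E n. d z y < t" if "\<rho> n z < t" "t \<le> 2 * e n" for n z t
    using that unfolding \<rho>_def by (subst (asm) cInf_less_iff[OF _ bdd]) auto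
  have rho_lip: "\<rho> n z \<le> \<rho> n w + d z w" for n z w
  proof -
    have "\<rho> n z - d z w \<le> \<rho> n w"
      unfolding \<rho>_def[of n w]
    proof (rule cInf_greatest)
      fix t assume "t \<in> insert (2 * e n) (d w ` E n)"
      then show "\<rho> n z - d z w \<le> t"
      proof
        assume t: "t = 2 * e n"
        have "\<rho> n z \<le> 2 * e n" unfolding \<rho>_def by (rule cInf_lower[OF _ bdd]) auto
        then show ?thesis using t d0[of z w] by simp
      next
        assume "t \<in> d w ` E n"
        then obtain y where "y \<in> E n" "t = d w y" by auto
        then show ?thesis using rho_le[of y n z] tri[of z y w] by simp
      qed
    qed simp
    then show ?thesis by simp
  qed
  have rho_abs: "\<bar>\<rho> n z - \<rho> n w\<bar> \<le> d z w" for n z w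
    using rho_lip[of n z w] rho_lip[of n w z] dsym[of z w] by (auto simp: abs_le_iff)
  have rho_cont: "continuous_on UNIV (\<rho> n)" for n
    unfolding continuous_on_def
  proof
    fix z
    show "(\<rho> n \<longlongrightarrow> \<rho> n z) (at z within UNIV)"
    proof (rule tendstoI)
      fix \<epsilon> :: real assume "\<epsilon> > 0"
      then obtain O' where O': "open O'" "z \<in> O'" "\<And>y. y \<in> O' \<Longrightarrow> d z y < \<epsilon>" using dopen by meson
      have "dist (\<rho> n y) (\<rho> n z) < \<epsilon>" if "y \<in> O'" for y
        using rho_abs[of n z y] O'(3)[OF that] by (simp add: dist_real_def)
      then show "\<forall>\<^sub>F y in at z within UNIV. dist (\<rho> n y) (\<rho> n z) < \<epsilon>"
        using O'(1,2) unfolding eventually_at_topological by blast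
    qed
  qed
  define \<theta> where "\<theta> n z = max 0 (min 1 (2 - 2 * \<rho> n z / e n))" for n z
  have theta01: "\<theta> n z \<in> {0..1}" for n z by (auto simp: \<theta>_def)
  have theta_cont: "continuous_on UNIV (\<theta> n)" for n
    unfolding \<theta>_def using e0[of n] by (intro continuous_intros rho_cont) auto
  have theta1: "\<theta> n z = 1" if "\<rho> n z \<le> e n / 2" for n z
  proof -
    have "2 * \<rho> n z / e n \<le> 1" using that e0[of n] by (simp add: field_simps)
    then show ?thesis by (simp add: \<theta>_def)
  qed
  have theta0: "\<theta> n z = 0" if "\<rho> n z \<ge> e n" for n z
  proof -
    have "2 * \<rho> n z / e n \<ge> 2" using that e0[of n] by (simp add: field_simps)
    then show ?thesis by (simp add: \<theta>_def)
  qed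
  \<comment> \<open>Maxima rather than sums: the steps stay in the unit interval, and after the first full bump all are empty.\<close>
  define T where "T = rec_nat (\<lambda>_. 0) (\<lambda>n t z. max (t z) (\<theta> n z))"
  have T0: "T 0 z = 0" and TS: "T (Suc n) z = max (T n z) (\<theta> n z)" for n z by (simp_all add: T_def)
  have T01: "T n z \<in> {0..1}" for n z
    by (induction n) (use theta01 in \<open>auto simp: T0 TS max_def\<close>)
  have Tcont: "continuous_on UNIV (T n)" for n
  proof (induction n)
    case (Suc n)
    have "T (Suc n) = (\<lambda>z. max (T n z) (\<theta> n z))" by (rule ext) (rule TS)
    then show ?case using Suc theta_cont by (simp add: continuous_on_max)
  qed (simp add: T_def)
  have Tmono: "T m z \<le> T n z" if "m \<le> n" for m n z
    by (rule lift_Suc_mono_le[OF _ that]) (simp add: TS)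
  define c where "c n z = p (SOME y. y \<in> E n \<and> d z y < (3/2) * e n)" for n z
  have c: "\<exists>y. y \<in> E n \<and> d z y < (3/2) * e n \<and> c n z = p y" if "\<rho> n z < (3/2) * e n" for n z
  proof -
    have "\<exists>y. y \<in> E n \<and> d z y < (3/2) * e n" using rho_less[OF that] e0[of n] by auto
    from someI_ex[OF this] show ?thesis unfolding c_def by blast
  qed
  show ?thesis
  proof (intro exI[of _ T] exI[of _ c] step_partition.intro)
    show "\<exists>O' m. open O' \<and> y \<in> O' \<and> (\<forall>n\<ge>m. \<forall>z\<in>O'. T n z = 1)" for y
    proof -
      have "(1 - d (p y) y) / 3 > 0" using p[of y] by simp
      then obtain m where m: "e m < (1 - d (p y) y) / 3"
        using real_arch_pow_inv[of "(1 - d (p y) y) / 3" "1/2"] by (auto simp: e_def)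
      then have "y \<in> E m" by (simp add: E_def)
      obtain O' where O': "open O'" "y \<in> O'" "\<And>z. z \<in> O' \<Longrightarrow> d y z < e m / 2"
        using dopen[of "e m / 2" y] e0[of m] by auto
      have "T n z = 1" if "n \<ge> Suc m" "z \<in> O'" for n z
      proof -
        have "\<rho> m z \<le> e m / 2" using rho_le[OF \<open>y \<in> E m\<close>, of z] O'(3)[OF that(2)] dsym[of y z] by simp
        then have "T (Suc m) z \<ge> 1" using theta1 by (simp add: TS)
        then show ?thesis using Tmono[OF that(1), of z] T01[of n z] by simp
      qed
      then show ?thesis using O' by blast
    qed
    show "\<exists>O'. open O' \<and> y \<in> O' \<and> ((\<forall>z\<in>O'. c n z = c n y \<and> - c n z + z \<in> U) \<or> (\<forall>z\<in>O'. T (Suc n) z = T n z))" for n y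
    proof (cases "\<rho> n y < (5/4) * e n")
      case True
      then have "(5/4) * e n < (3/2) * e n" using e0[of n] by simp
      obtain O' where O': "open O'" "y \<in> O'" "\<And>z. z \<in> O' \<Longrightarrow> d y z < (5/4) * e n - \<rho> n y"
        using dopen[of "(5/4) * e n - \<rho> n y" y] True by auto
      obtain O2 where O2: "open O2" "y \<in> O2" "\<And>z. z \<in> O2 \<Longrightarrow> d y z < e n / 8"
        using dopen[of "e n / 8" y] e0[of n] by auto
      define c' where "c' z = (SOME y. y \<in> E n \<and> d z y < (5/4) * e n)" for z
      have near: "\<exists>x. x \<in> E n \<and> d z x < (5/4) * e n" if "z \<in> O'" for z
        using rho_less[of n z "(5/4) * e n"] rho_lip[of n z y] O'(3)[OF that] dsym[of y z] e0[of n] by auto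
      have cz: "c n z = p x" if z: "z \<in> O'" and x: "x \<in> E n" "d z x < (5/4) * e n + e n / 8" for z x
      proof -
        obtain x' where x': "x' \<in> E n" "d z x' < (3/2) * e n" "c n z = p x'"
          using c[of n z] near[OF z] rho_le[of _ n z] \<open>(5/4) * e n < (3/2) * e n\<close> by force
        have "d x' x < 3 * e n" using tri[of x' x z] dsym[of z x'] x x' e0[of n] by simp
        then show ?thesis using sep[OF x'(1) x(1)] x' by simp
      qed
      obtain x where x: "x \<in> E n" "d y x < (5/4) * e n" using near[OF O'(2)] by blast
      have "c n z = c n y \<and> - c n z + z \<in> U" if z: "z \<in> O' \<inter> O2" for z
      proof -
        have "d z x < (5/4) * e n + e n / 8" using tri[of z x y] dsym[of z y] O2(3)[of z] z x by simp
        then have cz1: "c n z = p x" using cz[of z x] z x by simp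
        moreover have "c n y = p x" using cz[of y x] O'(2) x e0[of n] by simp
        moreover have "d (p x) z < 1"
          using tri[of "p x" z x] dsym[of x z] \<open>d z x < _\<close> x(1) e0[of n] by (simp add: E_def)
        ultimately show ?thesis using dU[of "p x" z] by simp
      qed
      moreover have "open (O' \<inter> O2)" "y \<in> O' \<inter> O2" using O' O2 by auto
      ultimately show ?thesis by blast
    next
      case False
      obtain O' where O': "open O'" "y \<in> O'" "\<And>z. z \<in> O' \<Longrightarrow> d y z < e n / 4"
        using dopen[of "e n / 4" y] e0[of n] by auto
      have "T (Suc n) z = T n z" if "z \<in> O'" for z
      proof -
        have "\<rho> n z \<ge> e n" using rho_lip[of n y z] O'(3)[OF that] False by simp
        then show ?thesis using theta0 T01[of n z] by (simp add: TS)
      qed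
      then show ?thesis using O' by blast
    qed
  qed (use T0 T01 Tcont U in auto)
qed


section \<open>Maps that are continuous for the k-topology\<close>

abbreviation k_continuous :: "'a topology \<Rightarrow> 'b topology \<Rightarrow> ('a \<Rightarrow> 'b) \<Rightarrow> bool" where
  "k_continuous Y V h \<equiv> continuous_map (k_topology Y) V h"

text \<open>The defining condition of the k-topology, with test spaces of any type.\<close>

lemma k_continuous_test:
  fixes K :: "'k topology"
  assumes h: "k_continuous Y V h" and K: "compact_space K" "Hausdorff_space K" "continuous_map K Y \<phi>"
  shows "continuous_map K V (h \<circ> \<phi>)"
  unfolding continuous_map_def
proof (intro conjI allI impI)
  have \<phi>: "\<phi> x \<in> topspace Y" if "x \<in> topspace K" for x using K(3) that by (auto simp: continuous_map_def)
  show "h \<circ> \<phi> \<in> topspace K \<rightarrow> topspace V" using h \<phi> by (auto simp: continuous_map_def)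
  fix W assume "openin V W"
  then have "openin (k_topology Y) {x \<in> topspace Y. h x \<in> W}" using h by (simp add: continuous_map_def)
  from openin_k_topology_preimage[OF this K]
  have "openin K {x \<in> topspace K. \<phi> x \<in> {x \<in> topspace Y. h x \<in> W}}" .
  moreover have "{x \<in> topspace K. \<phi> x \<in> {x \<in> topspace Y. h x \<in> W}} = {x \<in> topspace K. (h \<circ> \<phi>) x \<in> W}"
    using \<phi> by auto
  ultimately show "openin K {x \<in> topspace K. (h \<circ> \<phi>) x \<in> W}" by simp
qed

lemma k_continuousI:
  fixes Y :: "'y topology"
  assumes top: "\<And>y. y \<in> topspace Y \<Longrightarrow> h y \<in> topspace V"
    and test: "\<And>(K :: (nat \<times> 'y) set set topology) \<phi>. compact_space K \<Longrightarrow> Hausdorff_space K \<Longrightarrow>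
      continuous_map K Y \<phi> \<Longrightarrow> continuous_map K V (h \<circ> \<phi>)"
  shows "k_continuous Y V h"
  unfolding continuous_map_def
proof (intro conjI allI impI)
  show "h \<in> topspace (k_topology Y) \<rightarrow> topspace V" using top by auto
  fix W assume W: "openin V W"
  show "openin (k_topology Y) {x \<in> topspace (k_topology Y). h x \<in> W}"
    unfolding openin_k_topology k_open_def
  proof (intro conjI allI impI)
    fix K :: "(nat \<times> 'y) set set topology" and \<phi>
    assume K: "compact_space K" "Hausdorff_space K" "continuous_map K Y \<phi>"
    have "openin K {x \<in> topspace K. (h \<circ> \<phi>) x \<in> W}"
      using test[OF K] W by (simp add: continuous_map_def)
    moreover have "{x \<in> topspace K. \<phi> x \<in> {x \<in> topspace (k_topology Y). h x \<in> W}} = {x \<in> topspace K. (h \<circ> \<phi>) x \<in> W}"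
      using K(3) by (auto simp: continuous_map_def)
    ultimately show "openin K {x \<in> topspace K. \<phi> x \<in> {x \<in> topspace (k_topology Y). h x \<in> W}}" by simp
  qed auto
qed

lemma continuous_imp_k_continuous: "continuous_map Y V h \<Longrightarrow> k_continuous Y V h"
proof (rule k_continuousI)
  assume h: "continuous_map Y V h"
  then show "h y \<in> topspace V" if "y \<in> topspace Y" for y
    using that by (auto simp: continuous_map_def)
  show "continuous_map K V (h \<circ> \<phi>)" if "continuous_map K Y \<phi>" for K :: "(nat \<times> 'a) set set topology" and \<phi>
    by (rule continuous_map_compose[OF that h])
qed

lemma k_continuous_compose:
  assumes "continuous_map Z Y g" "k_continuous Y V h"
  shows "k_continuous Z V (\<lambda>z. h (g z))"
proof (rule k_continuousI)
  show "h (g z) \<in> topspace V" if "z \<in> topspace Z" for z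
    using assms that by (auto simp: continuous_map_def)
  show "continuous_map K V ((\<lambda>z. h (g z)) \<circ> \<phi>)"
    if "compact_space K" "Hausdorff_space K" "continuous_map K Z \<phi>" for K :: "(nat \<times> 'a) set set topology" and \<phi>
    using k_continuous_test[OF assms(2) that(1,2) continuous_map_compose[OF that(3) assms(1)]]
    by (simp add: o_def)
qed

text \<open>Test maps into a product are pairs of test maps, so \<open>F\<close> may be composed with a pair of k-continuous maps.\<close>

lemma k_continuous_pair:
  fixes Y :: "'y topology"
  assumes F: "k_continuous (prod_topology V X) W F" and h: "k_continuous Y V h" and g: "k_continuous Y X g"
  shows "k_continuous Y W (\<lambda>y. F (h y, g y))"
proof (rule k_continuousI)
  show "F (h y, g y) \<in> topspace W" if "y \<in> topspace Y" for y
    using assms that by (auto simp: continuous_map_def Pi_iff)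
  fix K :: "(nat \<times> 'y) set set topology" and \<phi>
  assume K: "compact_space K" "Hausdorff_space K" and \<phi>: "continuous_map K Y \<phi>"
  have "continuous_map K (prod_topology V X) (\<lambda>x. ((h \<circ> \<phi>) x, (g \<circ> \<phi>) x))"
    using k_continuous_test[OF h K \<phi>] k_continuous_test[OF g K \<phi>] by (simp add: continuous_map_paired o_def)
  from k_continuous_test[OF F K this] show "continuous_map K W ((\<lambda>y. F (h y, g y)) \<circ> \<phi>)"
    by (simp add: o_def)
qed

lemma k_continuous_cong:
  "(\<And>y. y \<in> topspace Y \<Longrightarrow> h y = g y) \<Longrightarrow> k_continuous Y V h \<Longrightarrow> k_continuous Y V g"
  using continuous_map_eq[of "k_topology Y" V h g] by simp

definition k_continuous_near :: "'a topology \<Rightarrow> 'b topology \<Rightarrow> ('a \<Rightarrow> 'b) \<Rightarrow> 'a \<Rightarrow> bool" where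
  "k_continuous_near Y V h y \<longleftrightarrow> (\<exists>O'. openin Y O' \<and> y \<in> O' \<and> k_continuous (subtopology Y O') V h)"

lemma k_continuous_subtopology: "k_continuous Y V h \<Longrightarrow> k_continuous (subtopology Y S) V h"
  using k_continuous_compose[of "subtopology Y S" Y id V h] by simp

lemma k_continuous_subtopology_mono:
  assumes "k_continuous (subtopology Y S) V h" "T \<subseteq> S"
  shows "k_continuous (subtopology Y T) V h"
proof -
  have "subtopology (subtopology Y S) T = subtopology Y T"
    using assms(2) by (simp add: subtopology_subtopology inf.absorb2)
  then show ?thesis using k_continuous_subtopology[OF assms(1), of T] by simp
qed

text \<open>A compact Hausdorff test space is regular: each of its points has a closed, hence compact neighbourhood that
  is mapped into the given open set, and this neighbourhood is itself a test space.\<close>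

lemma k_continuous_local:
  fixes Y :: "'y topology"
  assumes loc: "\<And>y. y \<in> topspace Y \<Longrightarrow> k_continuous_near Y V h y"
  shows "k_continuous Y V h"
proof (rule k_continuousI)
  show "h y \<in> topspace V" if "y \<in> topspace Y" for y
    using loc[OF that] that unfolding k_continuous_near_def by (auto simp: continuous_map_def Pi_iff)
  fix K :: "(nat \<times> 'y) set set topology" and \<phi>
  assume K: "compact_space K" "Hausdorff_space K" and \<phi>: "continuous_map K Y \<phi>"
  have "\<exists>N. openin K N \<and> p \<in> N \<and> continuous_map (subtopology K N) V (h \<circ> \<phi>)" if p: "p \<in> topspace K" for p
  proof -
    have "\<phi> p \<in> topspace Y" using \<phi> p by (auto simp: continuous_map_def)
    then obtain O' where O': "openin Y O'" "\<phi> p \<in> O'" "k_continuous (subtopology Y O') V h"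
      using loc unfolding k_continuous_near_def by blast
    have "openin K {x \<in> topspace K. \<phi> x \<in> O'}" using \<phi> O'(1) by (simp add: continuous_map_def)
    moreover have "regular_space K"
      using K compact_Hausdorff_imp_regular_space by blast
    ultimately obtain N C where N: "openin K N" "closedin K C" "p \<in> N" "N \<subseteq> C" "C \<subseteq> {x \<in> topspace K. \<phi> x \<in> O'}"
      using p O'(2) unfolding neighbourhood_base_of_closedin[symmetric] neighbourhood_base_of
      by (metis (mono_tags, lifting) mem_Collect_eq)
    have "compact_space (subtopology K C)"
      using closedin_compact_space[OF K(1) N(2)] compact_space_subtopology by blast
    moreover have "Hausdorff_space (subtopology K C)" using K(2) Hausdorff_space_subtopology by blast
    moreover have "continuous_map (subtopology K C) (subtopology Y O') \<phi>"
      using \<phi> N(5) by (auto simp: continuous_map_in_subtopology continuous_map_from_subtopology)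
    ultimately have "continuous_map (subtopology K C) V (h \<circ> \<phi>)" by (rule k_continuous_test[OF O'(3)])
    then have "continuous_map (subtopology K N) V (h \<circ> \<phi>)"
      using N(4) continuous_map_from_subtopology_mono by blast
    then show ?thesis using N by blast
  qed
  then obtain N where N: "\<And>p. p \<in> topspace K \<Longrightarrow> openin K (N p) \<and> p \<in> N p \<and> continuous_map (subtopology K (N p)) V (h \<circ> \<phi>)"
    by metis
  show "continuous_map K V (h \<circ> \<phi>)"
    by (rule pasting_lemma[where I = "topspace K" and T = N and f = "\<lambda>_. h \<circ> \<phi>"]) (use N in auto)
qed

lemma k_continuous_imp_near: "k_continuous Y V h \<Longrightarrow> y \<in> topspace Y \<Longrightarrow> k_continuous_near Y V h y"
  unfolding k_continuous_near_def by (intro exI[of _ "topspace Y"]) simp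

lemma k_continuous_near_cong:
  assumes "k_continuous_near Y V h y" "openin Y O'" "y \<in> O'" "\<And>z. z \<in> O' \<Longrightarrow> h z = g z"
  shows "k_continuous_near Y V g y"
proof -
  obtain S where S: "openin Y S" "y \<in> S" "k_continuous (subtopology Y S) V h"
    using assms(1) unfolding k_continuous_near_def by blast
  have "k_continuous (subtopology Y (S \<inter> O')) V g"
    by (rule k_continuous_cong[OF _ k_continuous_subtopology_mono[OF S(3)]]) (use assms(4) in auto)
  then show ?thesis unfolding k_continuous_near_def using S assms(2,3) by (intro exI[of _ "S \<inter> O'"]) auto
qed

lemma k_continuous_near_subtopology:
  assumes "k_continuous_near Y V h y" "y \<in> S"
  shows "k_continuous_near (subtopology Y S) V h y"
proof -
  obtain O' where O': "openin Y O'" "y \<in> O'" "k_continuous (subtopology Y O') V h"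
    using assms(1) unfolding k_continuous_near_def by blast
  have "subtopology (subtopology Y S) (O' \<inter> S) = subtopology Y (O' \<inter> S)"
    by (simp add: subtopology_subtopology Int_absorb1 inf.absorb2)
  then have "k_continuous (subtopology (subtopology Y S) (O' \<inter> S)) V h"
    using k_continuous_subtopology_mono[OF O'(3), of "O' \<inter> S"] by simp
  moreover have "openin (subtopology Y S) (O' \<inter> S)" using O'(1) by (auto simp: openin_subtopology)
  ultimately show ?thesis unfolding k_continuous_near_def using O'(2) assms(2) by blast
qed

section \<open>Averaging over a loop contractible group\<close>

locale contraction =
  fixes V :: "'v::ab_group_add topology" and \<Phi> :: "'v \<times> real \<Rightarrow> 'v"
  assumes V_UNIV: "topspace V = UNIV"
    and V_add: "continuous_map (k_topology (prod_topology V V)) V (\<lambda>(x, y). x + y)"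
    and V_uminus: "continuous_map V V uminus"
    and Phi_continuous: "continuous_map (k_topology (prod_topology V (top_of_set {0..1::real}))) V \<Phi>"
    and Phi_0: "\<And>v. \<Phi> (v, 0) = v" and Phi_1: "\<And>v. \<Phi> (v, 1) = 0"
    and Phi_add: "\<And>t v w. t \<in> {0..1} \<Longrightarrow> \<Phi> (v + w, t) = \<Phi> (v, t) + \<Phi> (w, t)"
begin

lemma k_continuous_add:
  "k_continuous Y V h \<Longrightarrow> k_continuous Y V g \<Longrightarrow> k_continuous Y V (\<lambda>y. h y + g y)"
  using k_continuous_pair[OF V_add, of Y h g] by simp

lemma k_continuous_uminus: "k_continuous Y V h \<Longrightarrow> k_continuous Y V (\<lambda>y. - h y)"
  using continuous_map_compose[OF _ V_uminus, of "k_topology Y" h] by (simp add: o_def)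

lemma k_continuous_diff:
  "k_continuous Y V h \<Longrightarrow> k_continuous Y V g \<Longrightarrow> k_continuous Y V (\<lambda>y. h y - g y)"
  using k_continuous_add[OF _ k_continuous_uminus, of Y h g] by simp

lemma k_continuous_const: "k_continuous Y V (\<lambda>_. v)"
  using V_UNIV by simp

lemma k_continuous_sum:
  "(\<And>i. i \<in> I \<Longrightarrow> k_continuous Y V (h i)) \<Longrightarrow> k_continuous Y V (\<lambda>y. \<Sum>i\<in>I. h i y)"
  by (induction I rule: infinite_finite_induct) (simp_all add: V_UNIV k_continuous_add)

lemma k_continuous_Phi:
  assumes "k_continuous Y V h" "continuous_map Y (top_of_set {0..1}) t"
  shows "k_continuous Y V (\<lambda>y. \<Phi> (h y, t y))"
  using k_continuous_pair[OF Phi_continuous assms(1) continuous_imp_k_continuous[OF assms(2)]] .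

lemma k_continuous_near_diff:
  assumes "k_continuous_near Y V h y" "k_continuous_near Y V g y"
  shows "k_continuous_near Y V (\<lambda>y. h y - g y) y"
proof -
  obtain S where S: "openin Y S" "y \<in> S" "k_continuous (subtopology Y S) V h"
    using assms(1) unfolding k_continuous_near_def by blast
  obtain T where T: "openin Y T" "y \<in> T" "k_continuous (subtopology Y T) V g"
    using assms(2) unfolding k_continuous_near_def by blast
  have "k_continuous (subtopology Y (S \<inter> T)) V (\<lambda>y. h y - g y)"
    by (intro k_continuous_diff k_continuous_subtopology_mono[OF S(3)] k_continuous_subtopology_mono[OF T(3)]) auto
  then show ?thesis unfolding k_continuous_near_def using S T by (intro exI[of _ "S \<inter> T"]) auto
qed

lemma k_continuous_near_sum:
  assumes "finite I" "\<And>i. i \<in> I \<Longrightarrow> k_continuous_near Y V (h i) y" "y \<in> topspace Y"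
  shows "k_continuous_near Y V (\<lambda>y. \<Sum>i\<in>I. h i y) y"
  using assms(1,2)
proof (induction I)
  case empty
  show ?case using k_continuous_imp_near[OF k_continuous_const assms(3)] by simp
next
  case (insert i I)
  obtain S where S: "openin Y S" "y \<in> S" "k_continuous (subtopology Y S) V (h i)"
    using insert.prems unfolding k_continuous_near_def by blast
  obtain T where T: "openin Y T" "y \<in> T" "k_continuous (subtopology Y T) V (\<lambda>y. \<Sum>i\<in>I. h i y)"
    using insert unfolding k_continuous_near_def by blast
  have "k_continuous (subtopology Y (S \<inter> T)) V (\<lambda>y. h i y + (\<Sum>i\<in>I. h i y))"
    by (intro k_continuous_add k_continuous_subtopology_mono[OF S(3)] k_continuous_subtopology_mono[OF T(3)]) auto
  then show ?case unfolding k_continuous_near_def using S T insert.hyps by (intro exI[of _ "S \<inter> T"]) auto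
qed

lemma Phi_zero: "t \<in> {0..1} \<Longrightarrow> \<Phi> (0, t) = 0"
  using Phi_add[of t 0 0] by simp

lemma Phi_uminus: "t \<in> {0..1} \<Longrightarrow> \<Phi> (- v, t) = - \<Phi> (v, t)"
  using Phi_add[of t v "- v"] Phi_zero[of t] by (simp add: eq_neg_iff_add_eq_0 add.commute)

end

locale averaging = contraction V \<Phi> + step_partition U T c
  for V :: "'v::ab_group_add topology" and \<Phi>
    and U :: "'g::topological_group_add set" and T :: "nat \<Rightarrow> 'g \<Rightarrow> real" and c :: "nat \<Rightarrow> 'g \<Rightarrow> 'g"
begin

abbreviation near :: "'g \<Rightarrow> 'g \<Rightarrow> bool" where
  "near x y \<equiv> - x + y \<in> U"

text \<open>With \<open>\<Psi> t = \<Phi> (\<cdot>, 1 - t)\<close>, a homotopy of endomorphisms from 0 to the identity, the weight of the \<open>n\<close>-th step is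
  the endomorphism \<open>\<Psi> (T (Suc n) y) - \<Psi> (T n y)\<close>. These play the role of the values of a partition of unity:
  they sum up to the identity by telescoping, although \<open>V\<close> has no scalar multiplication.\<close>

definition weight :: "nat \<Rightarrow> 'g \<Rightarrow> 'v \<Rightarrow> 'v" where
  "weight n y v = \<Phi> (v, 1 - T (Suc n) y) - \<Phi> (v, 1 - T n y)"

text \<open>A finite sum: the least bound is taken from which on all steps at \<open>y\<close> are empty.\<close>

definition average :: "'g \<Rightarrow> ('g \<Rightarrow> 'v) \<Rightarrow> 'v" where
  "average y \<phi> = (\<Sum>n<(LEAST m. \<forall>n\<ge>m. T n y = 1). weight n y (\<phi> (c n y)))"

lemma T_01': "1 - T n y \<in> {0..1}"
  using T_01[of n y] by simp

lemma weight_add: "weight n y (v + w) = weight n y v + weight n y w"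
  unfolding weight_def Phi_add[OF T_01'] by simp

lemma weight_uminus: "weight n y (- v) = - weight n y v"
  unfolding weight_def Phi_uminus[OF T_01'] by simp

lemma weight_eq_0: "T (Suc n) y = T n y \<Longrightarrow> weight n y v = 0"
  by (simp add: weight_def)

lemma near_c: "T (Suc n) y \<noteq> T n y \<Longrightarrow> near (c n y) y"
proof -
  assume ne: "T (Suc n) y \<noteq> T n y"
  obtain O' where "y \<in> O'" "(\<forall>z\<in>O'. c n z = c n y \<and> - c n z + z \<in> U) \<or> (\<forall>z\<in>O'. T (Suc n) z = T n z)"
    using T_c[of y n] by (elim exE conjE)
  then show "near (c n y) y" using ne by blast
qed

lemma average_eq:
  assumes "\<And>n. n \<ge> m \<Longrightarrow> T n y = 1"
  shows "average y \<phi> = (\<Sum>n<m. weight n y (\<phi> (c n y)))"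
proof -
  let ?P = "\<lambda>m. \<forall>n\<ge>m. T n y = 1"
  have P: "?P m" using assms by blast
  have L: "?P (Least ?P)" by (rule LeastI[of ?P, OF P])
  have "Least ?P \<le> m" by (rule Least_le[of ?P, OF P])
  then have sub: "{..<Least ?P} \<subseteq> {..<m}" by simp
  have "weight n y v = 0" if "\<not> n < Least ?P" for n v
  proof (rule weight_eq_0)
    have "n \<ge> Least ?P" "Suc n \<ge> Least ?P" using that by linarith+
    then show "T (Suc n) y = T n y" using L by metis
  qed
  then show ?thesis unfolding average_def
    by (intro sum.mono_neutral_left[OF _ sub]) (simp_all only: finite_lessThan Diff_iff lessThan_iff, blast)
qed

lemma average_cong:
  assumes "\<And>x. near x y \<Longrightarrow> \<phi> x = \<psi> x"
  shows "average y \<phi> = average y \<psi>"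
  unfolding average_def
proof (rule sum.cong)
  show "weight n y (\<phi> (c n y)) = weight n y (\<psi> (c n y))" for n
    using assms near_c[of n y] weight_eq_0[of n y] by (cases "T (Suc n) y = T n y") auto
qed simp

lemma average_const: "average y (\<lambda>_. v) = v"
proof -
  obtain m where m: "\<And>n. n \<ge> m \<Longrightarrow> T n y = 1" using T_1 by blast
  have "average y (\<lambda>_. v) = (\<Sum>n<m. weight n y v)" by (rule average_eq[OF m])
  also have "\<dots> = \<Phi> (v, 1 - T m y) - \<Phi> (v, 1 - T 0 y)"
    unfolding weight_def by (rule sum_lessThan_telescope)
  also have "\<dots> = v" using m[of m] by (simp add: T_0 Phi_0 Phi_1)
  finally show ?thesis .
qed

lemma average_add: "average y (\<lambda>x. \<phi> x + \<psi> x) = average y \<phi> + average y \<psi>"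
  by (simp add: average_def weight_add sum.distrib)

lemma average_uminus: "average y (\<lambda>x. - \<phi> x) = - average y \<phi>"
  by (simp add: average_def weight_uminus sum_negf)

lemma average_diff: "average y (\<lambda>x. \<phi> x - \<psi> x) = average y \<phi> - average y \<psi>"
  using average_add[of y \<phi> "\<lambda>x. - \<psi> x"] by (simp add: average_uminus)

lemma average_frag_eval: "average y (\<lambda>x. frag_eval (f x) a) = frag_eval (\<lambda>m. average y (\<lambda>x. f x m)) a"
proof (rule frag_induction[of a UNIV])
  show "average y (\<lambda>x. frag_eval (f x) 0) = frag_eval (\<lambda>m. average y (\<lambda>x. f x m)) 0"
    by (simp add: average_const)
  show "average y (\<lambda>x. frag_eval (f x) (a - b)) = frag_eval (\<lambda>m. average y (\<lambda>x. f x m)) (a - b)"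
    if "average y (\<lambda>x. frag_eval (f x) a) = frag_eval (\<lambda>m. average y (\<lambda>x. f x m)) a"
      "average y (\<lambda>x. frag_eval (f x) b) = frag_eval (\<lambda>m. average y (\<lambda>x. f x m)) b" for a b
    using that by (simp add: frag_eval_diff average_diff)
qed auto

text \<open>Near a point only finitely many steps contribute. For each of them either the centre is constant nearby, so that
  the values of \<open>F\<close> at this one centre matter, or the step is empty nearby.\<close>

lemma k_continuous_average:
  assumes a: "continuous_map Y euclidean a"
    and F: "\<And>y x. y \<in> topspace Y \<Longrightarrow> near x (a y) \<Longrightarrow> k_continuous_near Y V (\<lambda>y. F y x) y"
  shows "k_continuous Y V (\<lambda>y. average (a y) (F y))"
proof (rule k_continuous_local)
  fix y assume y: "y \<in> topspace Y"
  have pre: "openin Y {z \<in> topspace Y. a z \<in> O'}" if "open O'" for O'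
    using a that by (simp add: continuous_map_def)
  have wt: "k_continuous Z V (\<lambda>z. weight n (a z) (h z))"
    if "k_continuous Z V h" "continuous_map Z euclidean a" for Z h n
  proof -
    have "continuous_map Z (top_of_set {0..1}) (\<lambda>z. 1 - T m (a z))" for m
    proof -
      have "continuous_map euclidean euclideanreal (\<lambda>g. 1 - T m g)"
        using T_continuous[of m] by (auto intro!: continuous_intros)
      then have "continuous_map Z euclideanreal ((\<lambda>g. 1 - T m g) \<circ> a)" by (rule continuous_map_compose[OF that(2)])
      then show ?thesis using T_01'[of m] by (auto simp: continuous_map_in_subtopology o_def)
    qed
    then show ?thesis unfolding weight_def by (intro k_continuous_diff k_continuous_Phi that)
  qed
  obtain O1 m where O1: "open O1" "a y \<in> O1" "\<And>n z. n \<ge> m \<Longrightarrow> z \<in> O1 \<Longrightarrow> T n z = 1" using T_1[of "a y"] by blast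
  have "k_continuous_near Y V (\<lambda>z. weight n (a z) (F z (c n (a z)))) y" for n
  proof -
    obtain O' where O': "open O'" "a y \<in> O'" and
      or: "(\<forall>z\<in>O'. c n z = c n (a y) \<and> near (c n z) z) \<or> (\<forall>z\<in>O'. T (Suc n) z = T n z)"
      using T_c[of "a y" n] by blast
    have yO: "y \<in> {z \<in> topspace Y. a z \<in> O'}" using y O' by simp
    from or show ?thesis
    proof
      assume const: "\<forall>z\<in>O'. c n z = c n (a y) \<and> near (c n z) z"
      then have "near (c n (a y)) (a y)" using O'(2) by blast
      then obtain S where S: "openin Y S" "y \<in> S" "k_continuous (subtopology Y S) V (\<lambda>z. F z (c n (a y)))"
        using F[OF y] unfolding k_continuous_near_def by blast
      have "k_continuous (subtopology Y S) V (\<lambda>z. weight n (a z) (F z (c n (a y))))"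
        by (rule wt[OF S(3) continuous_map_from_subtopology[OF a]])
      then have "k_continuous_near Y V (\<lambda>z. weight n (a z) (F z (c n (a y)))) y"
        unfolding k_continuous_near_def using S by blast
      then show ?thesis
        by (rule k_continuous_near_cong[OF _ pre[OF O'(1)] yO]) (use const in auto)
    next
      assume "\<forall>z\<in>O'. T (Suc n) z = T n z"
      then show ?thesis
        by (intro k_continuous_near_cong[OF k_continuous_imp_near[OF k_continuous_const[of Y 0] y] pre[OF O'(1)] yO])
          (simp add: weight_eq_0)
    qed
  qed
  then have "k_continuous_near Y V (\<lambda>z. \<Sum>n<m. weight n (a z) (F z (c n (a z)))) y"
    by (intro k_continuous_near_sum y) auto
  then show "k_continuous_near Y V (\<lambda>z. average (a z) (F z)) y"
    by (rule k_continuous_near_cong[OF _ pre[OF O1(1)]]) (use y O1 in \<open>auto intro!: average_eq[symmetric]\<close>)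
qed

text \<open>Averaging a cochain in all coordinates, the first one last. The weights at different points need not commute;
  the nested order is kept in all formulas. The prism operator is the usual homotopy from \<open>smooth\<close> to the
  identity: its terms average an initial part of the coordinates and repeat the last averaged one.\<close>

primrec smooth :: "'g list \<Rightarrow> ('g list \<Rightarrow> 'v) \<Rightarrow> 'v" where
  "smooth [] f = f []"
| "smooth (y # ys) f = average y (\<lambda>x. smooth ys (\<lambda>zs. f (x # zs)))"

primrec prism :: "'g list \<Rightarrow> ('g list \<Rightarrow> 'v) \<Rightarrow> 'v" where
  "prism [] f = 0"
| "prism (y # ys) f = average y (\<lambda>x. f (x # y # ys) - prism ys (\<lambda>zs. f (x # zs)))"

lemma smooth_diff: "smooth l (\<lambda>m. f m - g m) = smooth l f - smooth l g"
  by (induction l arbitrary: f g) (simp_all add: average_diff)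

lemma smooth_zero: "smooth l (\<lambda>_. 0) = 0"
  by (induction l) (simp_all add: average_const)

lemma prism_diff: "prism l (\<lambda>m. f m - g m) = prism l f - prism l g"
proof (induction l arbitrary: f g)
  case (Cons y ys)
  have "prism (y # ys) (\<lambda>m. f m - g m) =
      average y (\<lambda>x. (f (x # y # ys) - prism ys (\<lambda>zs. f (x # zs))) - (g (x # y # ys) - prism ys (\<lambda>zs. g (x # zs))))"
    by (simp add: Cons.IH algebra_simps)
  then show ?case by (simp only: average_diff prism.simps)
qed simp

lemma prism_zero: "prism l (\<lambda>_. 0) = 0"
  by (induction l) (simp_all add: average_const)

lemma boundary_eval_Cons:
  "frag_eval f (list_boundary (y # ys)) = f ys - frag_eval (\<lambda>zs. f (y # zs)) (list_boundary ys)"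
  by (simp add: frag_eval_diff frag_eval_extend)

text \<open>Dropping a coordinate of an average leaves an average of a constant in that coordinate, which is that
  constant. By recursion only the first coordinate has to be considered.\<close>

lemma smooth_boundary:
  "smooth l (\<lambda>m. frag_eval f (list_boundary m)) = frag_eval (\<lambda>m. smooth m f) (list_boundary l)"
proof (induction l arbitrary: f)
  case (Cons y ys)
  have "smooth (y # ys) (\<lambda>m. frag_eval f (list_boundary m)) =
      average y (\<lambda>x. smooth ys f - frag_eval (\<lambda>m. smooth m (\<lambda>zs. f (x # zs))) (list_boundary ys))"
    by (simp only: smooth.simps boundary_eval_Cons smooth_diff Cons.IH)
  also have "\<dots> = smooth ys f - frag_eval (\<lambda>m. smooth (y # m) f) (list_boundary ys)"
    by (simp add: average_diff average_const average_frag_eval)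
  also have "\<dots> = frag_eval (\<lambda>m. smooth m f) (list_boundary (y # ys))"
    by (rule boundary_eval_Cons[symmetric])
  finally show ?case .
qed simp

text \<open>The prism formula. Induction on the list works because all three operators are defined by recursion on the first
  coordinate and the cochain is arbitrary, in particular the cochain \<open>\<lambda>zs. f (x # zs)\<close>, which need not vanish
  at the empty list.\<close>

lemma prism_boundary:
  "frag_eval (\<lambda>m. prism m f) (list_boundary l) + prism l (\<lambda>m. frag_eval f (list_boundary m)) = f l - smooth l f"
proof (induction l arbitrary: f)
  case (Cons y ys)
  let ?d = "\<lambda>f m. frag_eval f (list_boundary m)"
  have "frag_eval (\<lambda>m. prism m f) (list_boundary (y # ys)) = prism ys f - frag_eval (\<lambda>zs. prism (y # zs) f) (list_boundary ys)"
    by (rule boundary_eval_Cons)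
  also have "frag_eval (\<lambda>zs. prism (y # zs) f) (list_boundary ys) =
      average y (\<lambda>x. frag_eval (\<lambda>zs. f (x # y # zs) - prism zs (\<lambda>zs. f (x # zs))) (list_boundary ys))"
    by (simp add: average_frag_eval)
  finally have 1: "frag_eval (\<lambda>m. prism m f) (list_boundary (y # ys)) = prism ys f -
      average y (\<lambda>x. frag_eval (\<lambda>zs. f (x # y # zs) - prism zs (\<lambda>zs. f (x # zs))) (list_boundary ys))" .
  have 2: "prism (y # ys) (?d f) =
      average y (\<lambda>x. (f (y # ys) - (f (x # ys) - ?d (\<lambda>zs. f (x # y # zs)) ys)) -
        (prism ys f - prism ys (?d (\<lambda>zs. f (x # zs)))))"
    by (simp only: prism.simps boundary_eval_Cons prism_diff)
  have dd: "frag_eval (\<lambda>zs. g zs - h zs) e = frag_eval g e - frag_eval h e" for g h :: "'g list \<Rightarrow> 'v" and e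
    using frag_eval_add_fun[of g "\<lambda>i. - h i" e] by (simp add: frag_eval_uminus_fun)
  have "average y (\<lambda>x. frag_eval (\<lambda>m. prism m (\<lambda>zs. f (x # zs))) (list_boundary ys) + prism ys (?d (\<lambda>zs. f (x # zs)))) =
      average y (\<lambda>x. f (x # ys) - smooth ys (\<lambda>zs. f (x # zs)))"
    by (simp only: Cons.IH)
  then show ?case
    unfolding 1 2 dd
    by (simp add: average_diff average_add average_const algebra_simps)
qed simp

lemma smooth_cong:
  "(\<And>zs. list_all2 near zs l \<Longrightarrow> f zs = g zs) \<Longrightarrow> smooth l f = smooth l g"
proof (induction l arbitrary: f g)
  case (Cons y ys)
  have "smooth ys (\<lambda>zs. f (x # zs)) = smooth ys (\<lambda>zs. g (x # zs))" if "near x y" for x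
    by (rule Cons.IH, rule Cons.prems) (simp add: that)
  then show ?case unfolding smooth.simps by (rule average_cong)
qed simp

text \<open>The lists that occur in \<open>prism l f\<close> start with centres near an initial part of \<open>l\<close> and then repeat the rest of
  \<open>l\<close> from the last averaged point on.\<close>

lemma prism_cong:
  "(\<And>xs as b bs. l = as @ b # bs \<Longrightarrow> list_all2 near xs (as @ [b]) \<Longrightarrow> f (xs @ b # bs) = g (xs @ b # bs)) \<Longrightarrow>
    prism l f = prism l g"
proof (induction l arbitrary: f g)
  case (Cons y ys)
  have "f (x # y # ys) = g (x # y # ys)" if "near x y" for x
    using Cons.prems[of "[]" y ys "[x]"] that by simp
  moreover have "prism ys (\<lambda>zs. f (x # zs)) = prism ys (\<lambda>zs. g (x # zs))" if "near x y" for x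
  proof (rule Cons.IH)
    fix xs as b bs assume "ys = as @ b # bs" "list_all2 near xs (as @ [b])"
    then show "f (x # xs @ b # bs) = g (x # xs @ b # bs)"
      using Cons.prems[of "y # as" b bs "x # xs"] that by simp
  qed
  ultimately have "f (x # y # ys) - prism ys (\<lambda>zs. f (x # zs)) = g (x # y # ys) - prism ys (\<lambda>zs. g (x # zs))"
    if "near x y" for x using that by metis
  then show ?case unfolding prism.simps by (rule average_cong)
qed simp

lemma openin_near:
  assumes "continuous_map Y euclidean a"
  shows "openin Y {y \<in> topspace Y. near x (a y)}"
proof -
  have "open ((\<lambda>z. - x + z) -` U)" by (intro open_vimage U_open continuous_intros)
  then have "open {z. - x + z \<in> U}" by (simp add: vimage_def)
  then have "openin euclidean {z. - x + z \<in> U}" by (simp only: open_openin)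
  from openin_continuous_map_preimage[OF assms this] show ?thesis by (simp only: mem_Collect_eq)
qed

text \<open>The list \<open>as\<close> consists of the coordinate functions; \<open>F\<close> may depend on the point because the recursion
  substitutes centres for the first coordinates.\<close>

lemma k_continuous_smooth:
  assumes "\<And>a. a \<in> set as \<Longrightarrow> continuous_map Y euclidean a"
    and "\<And>y xs. y \<in> topspace Y \<Longrightarrow> list_all2 (\<lambda>x a. near x (a y)) xs as \<Longrightarrow> k_continuous_near Y V (\<lambda>y. F y xs) y"
  shows "k_continuous Y V (\<lambda>y. smooth (map (\<lambda>a. a y) as) (F y))"
  using assms
proof (induction as arbitrary: Y F)
  case Nil
  then show ?case by (auto intro: k_continuous_local)
next
  case (Cons a as)
  have a: "continuous_map Y euclidean a" using Cons.prems by simp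
  have "k_continuous_near Y V (\<lambda>y. smooth (map (\<lambda>a. a y) as) (\<lambda>zs. F y (x # zs))) y"
    if y: "y \<in> topspace Y" "near x (a y)" for x y
  proof -
    let ?O = "{y \<in> topspace Y. near x (a y)}"
    have "k_continuous (subtopology Y ?O) V (\<lambda>y. smooth (map (\<lambda>a. a y) as) (\<lambda>zs. F y (x # zs)))"
      by (rule Cons.IH)
        (use Cons.prems in \<open>auto intro!: continuous_map_from_subtopology k_continuous_near_subtopology\<close>)
    then show ?thesis unfolding k_continuous_near_def using openin_near[OF a] y by blast
  qed
  then show ?case using k_continuous_average[OF a] by simp
qed

lemma k_continuous_prism:
  assumes "\<And>a. a \<in> set as \<Longrightarrow> continuous_map Y euclidean a"
    and "\<And>y xs as1 b as2. y \<in> topspace Y \<Longrightarrow> as = as1 @ b # as2 \<Longrightarrow>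
      list_all2 (\<lambda>x a. near x (a y)) xs (as1 @ [b]) \<Longrightarrow>
      k_continuous_near Y V (\<lambda>y. F y (xs @ b y # map (\<lambda>a. a y) as2)) y"
  shows "k_continuous Y V (\<lambda>y. prism (map (\<lambda>a. a y) as) (F y))"
  using assms
proof (induction as arbitrary: Y F)
  case Nil
  then show ?case by (simp add: V_UNIV)
next
  case (Cons a as)
  have a: "continuous_map Y euclidean a" using Cons.prems by simp
  have "k_continuous_near Y V (\<lambda>y. F y (x # a y # map (\<lambda>a. a y) as) - prism (map (\<lambda>a. a y) as) (\<lambda>zs. F y (x # zs))) y"
    if y: "y \<in> topspace Y" "near x (a y)" for x y
  proof (rule k_continuous_near_diff)
    show "k_continuous_near Y V (\<lambda>y. F y (x # a y # map (\<lambda>a. a y) as)) y"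
      using Cons.prems(2)[of y "[]" a as "[x]"] y by simp
    let ?O = "{y \<in> topspace Y. near x (a y)}"
    have "k_continuous (subtopology Y ?O) V (\<lambda>y. prism (map (\<lambda>a. a y) as) (\<lambda>zs. F y (x # zs)))"
    proof (rule Cons.IH)
      show "continuous_map (subtopology Y ?O) euclidean a" if "a \<in> set as" for a
        using Cons.prems(1) that by (auto intro: continuous_map_from_subtopology)
      fix z xs as1 b as2
      assume z: "z \<in> topspace (subtopology Y ?O)" and as: "as = as1 @ b # as2"
        and xs: "list_all2 (\<lambda>x a. near x (a z)) xs (as1 @ [b])"
      have "k_continuous_near Y V (\<lambda>y. F y ((x # xs) @ b y # map (\<lambda>a. a y) as2)) z"
        by (rule Cons.prems(2)[of z "a # as1"]) (use z as xs in auto)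
      then show "k_continuous_near (subtopology Y ?O) V (\<lambda>y. F y (x # xs @ b y # map (\<lambda>a. a y) as2)) z"
        using z by (auto intro: k_continuous_near_subtopology)
    qed
    then show "k_continuous_near Y V (\<lambda>y. prism (map (\<lambda>a. a y) as) (\<lambda>zs. F y (x # zs))) y"
      unfolding k_continuous_near_def using openin_near[OF a] y by blast
  qed
  then show ?case using k_continuous_average[OF a] by simp
qed

end


section \<open>Cocycles and coboundaries on a coset covering\<close>

lemma coset_cover_refines:
  "W \<subseteq> U \<Longrightarrow> A \<in> coset_cover W \<Longrightarrow> \<exists>B\<in>coset_cover U. A \<subseteq> B"
  unfolding coset_cover_def by blast

lemma tuples_mono:
  assumes "W \<subseteq> U"
  shows "tuples (coset_cover W) q \<subseteq> tuples (coset_cover U) q"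
proof
  fix u assume "u \<in> tuples (coset_cover W) q"
  then obtain A where "A \<in> coset_cover W" "u \<in> {..q} \<rightarrow>\<^sub>E A" by (auto simp: tuples_def)
  moreover obtain B where "B \<in> coset_cover U" "A \<subseteq> B" using coset_cover_refines[OF assms] calculation(1) by blast
  ultimately show "u \<in> tuples (coset_cover U) q" unfolding tuples_def using PiE_mono[of "{..q}" "\<lambda>_. A" "\<lambda>_. B"] by blast
qed

lemma small_simplices_mono:
  assumes "W \<subseteq> U"
  shows "small_simplices X (coset_cover W) q \<subseteq> small_simplices X (coset_cover U) q"
proof
  fix s assume "s \<in> small_simplices X (coset_cover W) q"
  then obtain A where s: "singular_simplex q X s" and A: "A \<in> coset_cover W" "s ` standard_simplex q \<subseteq> A"
    by (auto simp: small_simplices_def)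
  moreover obtain B where "B \<in> coset_cover U" "A \<subseteq> B" using coset_cover_refines[OF assms A(1)] by blast
  ultimately show "s \<in> small_simplices X (coset_cover U) q" unfolding small_simplices_def by blast
qed

context face_complex
begin

lemma cocycles_iff:
  assumes V: "topspace V = UNIV"
  shows "f \<in> cocycles (\<lambda>q. function_group (I q) V) (coboundary I face) q \<longleftrightarrow>
    f \<in> extensional (I q) \<and> (\<forall>s\<in>I (Suc q). frag_eval f (face_sum face q s) = 0)"
proof -
  have "coboundary I face q f = (\<lambda>s\<in>I (Suc q). 0) \<longleftrightarrow> (\<forall>s\<in>I (Suc q). coboundary I face q f s = 0)"
    (is "?l \<longleftrightarrow> ?r")
  proof
    show "?r" if "?l" using that by simp
    show "?l" if "?r"
      by (rule extensionalityI[of _ "I (Suc q)"]) (use that in \<open>auto simp: coboundary_extensional\<close>)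
  qed
  then show ?thesis
    unfolding cocycles_def mem_Collect_eq one_function_group carrier_function_group[OF V]
    by (simp add: coboundary_eval)
qed

lemma coboundaries_iff:
  assumes V: "topspace V = UNIV"
  shows "f \<in> coboundaries (\<lambda>q. function_group (I q) V) (coboundary I face) q \<longleftrightarrow>
    f \<in> extensional (I q) \<and>
    (\<exists>\<beta>. \<forall>s\<in>I q. f s = (case q of 0 \<Rightarrow> 0 | Suc p \<Rightarrow> frag_eval \<beta> (face_sum face p s)))"
proof (cases q)
  case 0
  have "f = (\<lambda>s\<in>I 0. 0) \<longleftrightarrow> f \<in> extensional (I 0) \<and> (\<forall>s\<in>I 0. f s = 0)"
    by (auto intro: extensionalityI)
  then show ?thesis by (simp add: 0 coboundaries_def one_function_group del: one_product_group)
next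
  case (Suc p)
  show ?thesis
  proof
    assume "f \<in> coboundaries (\<lambda>q. function_group (I q) V) (coboundary I face) q"
    then obtain b where "f = coboundary I face p b" by (auto simp: Suc coboundaries_def)
    then show "f \<in> extensional (I q) \<and>
        (\<exists>\<beta>. \<forall>s\<in>I q. f s = (case q of 0 \<Rightarrow> 0 | Suc p \<Rightarrow> frag_eval \<beta> (face_sum face p s)))"
      by (auto simp: Suc coboundary_extensional coboundary_eval)
  next
    assume "f \<in> extensional (I q) \<and>
        (\<exists>\<beta>. \<forall>s\<in>I q. f s = (case q of 0 \<Rightarrow> 0 | Suc p \<Rightarrow> frag_eval \<beta> (face_sum face p s)))"
    then obtain \<beta> where f: "f \<in> extensional (I (Suc p))" "\<And>s. s \<in> I (Suc p) \<Longrightarrow> f s = frag_eval \<beta> (face_sum face p s)"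
      by (auto simp: Suc)
    have "coboundary I face p (restrict \<beta> (I p)) = f"
    proof (rule extensionalityI[of _ "I (Suc p)"])
      show "coboundary I face p (restrict \<beta> (I p)) \<in> extensional (I (Suc p))" by (rule coboundary_extensional)
      show "f \<in> extensional (I (Suc p))" by (rule f(1))
      fix s assume s: "s \<in> I (Suc p)"
      have "frag_eval (restrict \<beta> (I p)) (face_sum face p s) = frag_eval \<beta> (face_sum face p s)"
        by (rule frag_eval_cong) (use keys_face_sum_in[OF s] in auto)
      then show "coboundary I face p (restrict \<beta> (I p)) s = f s" using f(2)[OF s] s by (simp add: coboundary_eval)
    qed
    then show "f \<in> coboundaries (\<lambda>q. function_group (I q) V) (coboundary I face) q"
      by (auto simp: Suc coboundaries_def carrier_function_group[OF V] simp del: carrier_product_group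
          intro!: image_eqI[of _ _ "restrict \<beta> (I p)"])
  qed
qed

end

definition small_list :: "'a set set \<Rightarrow> nat \<Rightarrow> 'a list \<Rightarrow> bool" where
  "small_list \<UU> q l \<longleftrightarrow> length l = Suc q \<and> (\<exists>U\<in>\<UU>. set l \<subseteq> U)"

lemma small_list_boundary:
  "small_list \<UU> (Suc q) l \<Longrightarrow> m \<in> Poly_Mapping.keys (list_boundary l) \<Longrightarrow> small_list \<UU> q m"
  using keys_list_boundary[of m l] unfolding small_list_def by auto

lemma tuple_of_small_list: "small_list \<UU> q l \<Longrightarrow> tuple_of q l \<in> tuples \<UU> q"
  by (simp add: small_list_def tuple_of_in_tuples_iff)

lemma small_list_of: "u \<in> tuples \<UU> q \<Longrightarrow> small_list \<UU> q (list_of q u)"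
  by (erule tuples_cases) (auto simp: small_list_def)

lemma tuples_ball: "(\<forall>u\<in>tuples \<UU> q. P u) \<longleftrightarrow> (\<forall>l. small_list \<UU> q l \<longrightarrow> P (tuple_of q l))"
  using tuple_of_small_list small_list_of tuple_of_list_of tuples_extensional by metis

lemma frag_eval_face_sum_omit:
  assumes "small_list \<UU> (Suc q) l"
  shows "frag_eval f (face_sum omit q (tuple_of (Suc q) l)) = frag_eval (\<lambda>m. f (tuple_of q m)) (list_boundary l)"
  using assms by (simp add: small_list_def face_sum_omit frag_eval_extend)

text \<open>The cocycle condition in terms of lists; likewise for coboundaries below, where \<open>\<beta> [] = 0\<close> makes degree 0 fit
  the pattern, as the boundary of a one-point list is the empty list.\<close>

lemma cover_cocycles_iff:
  assumes V: "topspace V = UNIV"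
  shows "f \<in> cocycles (cover_cochains \<UU> V) (cover_d \<UU>) q \<longleftrightarrow> f \<in> extensional (tuples \<UU> q) \<and>
    (\<forall>l. small_list \<UU> (Suc q) l \<longrightarrow> frag_eval (\<lambda>m. f (tuple_of q m)) (list_boundary l) = 0)"
proof -
  have "cover_cochains \<UU> V = (\<lambda>q. function_group (tuples \<UU> q) V)" by (simp add: cover_cochains_def fun_eq_iff)
  then show ?thesis
    unfolding cover_d_def by (simp add: face_complex.cocycles_iff[OF face_complex_tuples V] tuples_ball frag_eval_face_sum_omit)
qed

lemma cover_coboundaries_iff:
  fixes f :: "(nat \<Rightarrow> 'a) \<Rightarrow> 'v::ab_group_add"
  assumes V: "topspace V = UNIV"
  shows "f \<in> coboundaries (cover_cochains \<UU> V) (cover_d \<UU>) q \<longleftrightarrow> f \<in> extensional (tuples \<UU> q) \<and>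
    (\<exists>\<beta>. \<beta> [] = 0 \<and> (\<forall>l. small_list \<UU> q l \<longrightarrow> f (tuple_of q l) = frag_eval \<beta> (list_boundary l)))"
    (is "?L \<longleftrightarrow> ?E \<and> ?R")
proof -
  have C: "cover_cochains \<UU> V = (\<lambda>q. function_group (tuples \<UU> q) V)" by (simp add: cover_cochains_def fun_eq_iff)
  have L: "?L \<longleftrightarrow> ?E \<and> (\<exists>\<beta>. \<forall>l. small_list \<UU> q l \<longrightarrow>
      f (tuple_of q l) = (case q of 0 \<Rightarrow> 0 | Suc p \<Rightarrow> frag_eval \<beta> (face_sum omit p (tuple_of q l))))"
    unfolding C cover_d_def by (simp only: face_complex.coboundaries_iff[OF face_complex_tuples V] tuples_ball)
  show ?thesis
  proof (cases q)
    case 0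
    have "frag_eval \<beta> (list_boundary l) = 0" if "\<beta> [] = 0" "small_list \<UU> 0 l" for \<beta> :: "'a list \<Rightarrow> 'v" and l
      using that by (auto simp: small_list_def length_Suc_conv)
    then show ?thesis unfolding L by (auto simp: 0 intro: exI[of _ "\<lambda>_. 0"])
  next
    case (Suc p)
    have "(\<exists>\<beta>. \<forall>l. small_list \<UU> q l \<longrightarrow> f (tuple_of q l) = frag_eval \<beta> (face_sum omit p (tuple_of q l))) \<longleftrightarrow> ?R"
    proof
      assume "\<exists>\<beta>. \<forall>l. small_list \<UU> q l \<longrightarrow> f (tuple_of q l) = frag_eval \<beta> (face_sum omit p (tuple_of q l))"
      then obtain \<beta> where \<beta>: "\<And>l. small_list \<UU> q l \<Longrightarrow> f (tuple_of q l) = frag_eval \<beta> (face_sum omit p (tuple_of q l))" by blast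
      show ?R
      proof (intro exI[of _ "\<lambda>m. if m = [] then 0 else \<beta> (tuple_of p m)"] conjI allI impI)
        fix l assume l: "small_list \<UU> q l"
        have "f (tuple_of q l) = frag_eval (\<lambda>m. \<beta> (tuple_of p m)) (list_boundary l)"
          using \<beta>[OF l] frag_eval_face_sum_omit[of \<UU> p l \<beta>] l by (simp add: Suc)
        also have "\<dots> = frag_eval (\<lambda>m. if m = [] then 0 else \<beta> (tuple_of p m)) (list_boundary l)"
          by (rule frag_eval_cong) (use keys_list_boundary(1) l in \<open>fastforce simp: Suc small_list_def\<close>)
        finally show "f (tuple_of q l) = frag_eval (\<lambda>m. if m = [] then 0 else \<beta> (tuple_of p m)) (list_boundary l)" .
      qed simp
    next
      assume ?R
      then obtain \<beta> where \<beta>: "\<And>l. small_list \<UU> q l \<Longrightarrow> f (tuple_of q l) = frag_eval \<beta> (list_boundary l)" by blast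
      show "\<exists>\<beta>. \<forall>l. small_list \<UU> q l \<longrightarrow> f (tuple_of q l) = frag_eval \<beta> (face_sum omit p (tuple_of q l))"
      proof (intro exI[of _ "\<lambda>u. \<beta> (list_of p u)"] allI impI)
        fix l assume l: "small_list \<UU> q l"
        have "frag_eval \<beta> (list_boundary l) = frag_eval (\<lambda>m. \<beta> (list_of p (tuple_of p m))) (list_boundary l)"
          by (rule frag_eval_cong) (use small_list_boundary l in \<open>force simp: Suc small_list_def list_of_tuple_of\<close>)
        then show "f (tuple_of q l) = frag_eval (\<lambda>u. \<beta> (list_of p u)) (face_sum omit p (tuple_of q l))"
          using \<beta>[OF l] frag_eval_face_sum_omit[of \<UU> p l "\<lambda>u. \<beta> (list_of p u)"] l by (simp add: Suc)
      qed
    qed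
    then show ?thesis unfolding L by (simp add: Suc)
  qed
qed

lemma singular_cocycles_iff:
  assumes V: "topspace V = UNIV" and I: "face_complex I (\<lambda>q. singular_face (Suc q))"
  shows "f \<in> cocycles (\<lambda>q. function_group (I q) V) (coboundary I (\<lambda>q. singular_face (Suc q))) q \<longleftrightarrow>
    f \<in> extensional (I q) \<and> (\<forall>s\<in>I (Suc q). frag_eval f (chain_boundary (Suc q) (frag_of s)) = 0)"
  by (simp add: face_complex.cocycles_iff[OF I V] face_sum_singular)

text \<open>In degree 0 both sides say that \<open>f\<close> vanishes, since \<open>chain_boundary 0\<close> is 0.\<close>

lemma singular_coboundaries_iff:
  assumes V: "topspace V = UNIV" and I: "face_complex I (\<lambda>q. singular_face (Suc q))"
  shows "f \<in> coboundaries (\<lambda>q. function_group (I q) V) (coboundary I (\<lambda>q. singular_face (Suc q))) q \<longleftrightarrow>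
    f \<in> extensional (I q) \<and> (\<exists>\<beta>. \<forall>s\<in>I q. f s = frag_eval \<beta> (chain_boundary q (frag_of s)))"
proof -
  have "chain_boundary 0 c = 0" for c :: "'b chain" by (simp add: chain_boundary_def)
  then show ?thesis by (cases q) (simp_all add: face_complex.coboundaries_iff[OF I V] face_sum_singular)
qed

lemma small_cochains_eq: "small_cochains X \<UU> V = (\<lambda>q. function_group (small_simplices X \<UU> q) V)"
  by (simp add: small_cochains_def fun_eq_iff)

lemma cover_cochains_eq: "cover_cochains \<UU> V = (\<lambda>q. function_group (tuples \<UU> q) V)"
  by (simp add: cover_cochains_def fun_eq_iff)

lemma cochain_complex_cover: "topspace V = UNIV \<Longrightarrow> cochain_complex (cover_cochains \<UU> V) (cover_d \<UU>)"
  unfolding cover_cochains_eq cover_d_def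
  by (rule face_complex.cochain_complex_functions[OF face_complex_tuples])

lemma cochain_complex_small: "topspace V = UNIV \<Longrightarrow> cochain_complex (small_cochains X \<UU> V) (small_d X \<UU>)"
  unfolding small_cochains_eq small_d_def
  by (rule face_complex.cochain_complex_functions[OF face_complex_small])

section \<open>k-continuous cochains\<close>

abbreviation tuple_space :: "'a topology \<Rightarrow> 'a set set \<Rightarrow> nat \<Rightarrow> (nat \<Rightarrow> 'a) topology" where
  "tuple_space X \<UU> q \<equiv> subtopology (product_topology (\<lambda>_. X) {..q}) (tuples \<UU> q)"

abbreviation k_cochain :: "'a topology \<Rightarrow> 'a set set \<Rightarrow> 'v topology \<Rightarrow> nat \<Rightarrow> ((nat \<Rightarrow> 'a) \<Rightarrow> 'v) \<Rightarrow> bool" where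
  "k_cochain X \<UU> V q f \<equiv> k_continuous (tuple_space X \<UU> q) V f"

lemma carrier_kc_cochains:
  assumes V: "topspace V = UNIV"
  shows "carrier (kc_cochains X \<UU> V q) = {f. f \<in> extensional (tuples \<UU> q) \<and> k_cochain X \<UU> V q f}"
  unfolding kc_cochains_def cover_cochains_def by (auto simp: carrier_function_group[OF V] simp del: carrier_product_group)

lemma continuous_map_tuple_of:
  assumes len: "length as = Suc q" and a: "\<And>a. a \<in> set as \<Longrightarrow> continuous_map Z X a"
    and small: "\<And>z. z \<in> topspace Z \<Longrightarrow> \<exists>U\<in>\<UU>. set (map (\<lambda>a. a z) as) \<subseteq> U"
  shows "continuous_map Z (tuple_space X \<UU> q) (\<lambda>z. tuple_of q (map (\<lambda>a. a z) as))"
  unfolding continuous_map_in_subtopology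
proof
  have "continuous_map Z X (\<lambda>z. tuple_of q (map (\<lambda>a. a z) as) k)" if k: "k \<le> q" for k
  proof -
    have "(\<lambda>z. tuple_of q (map (\<lambda>a. a z) as) k) = as ! k" using k len by (auto simp: tuple_of_def fun_eq_iff)
    moreover have "continuous_map Z X (as ! k)" by (rule a) (use k len in auto)
    ultimately show ?thesis by simp
  qed
  then show "continuous_map Z (product_topology (\<lambda>_. X) {..q}) (\<lambda>z. tuple_of q (map (\<lambda>a. a z) as))"
    by (auto simp: continuous_map_componentwise tuple_of_def)
  show "(\<lambda>z. tuple_of q (map (\<lambda>a. a z) as)) \<in> topspace Z \<rightarrow> tuples \<UU> q"
    using small len by (auto simp: tuple_of_in_tuples_iff)
qed

text \<open>The coordinate functions, arranged so that evaluating all of them at a tuple yields its list.\<close>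

definition projections :: "nat \<Rightarrow> ((nat \<Rightarrow> 'a) \<Rightarrow> 'a) list" where
  "projections q = map (\<lambda>i u. u i) [0..<Suc q]"

lemma length_projections [simp]: "length (projections q) = Suc q"
  by (simp add: projections_def)

lemma map_projections: "map (\<lambda>a. a u) (projections q) = list_of q u"
  by (simp add: projections_def list_of_def)

lemma continuous_map_projections:
  "a \<in> set (projections q) \<Longrightarrow> continuous_map (tuple_space X \<UU> q) X a"
  by (auto simp: projections_def less_Suc_eq_le simp del: upt_Suc
      intro!: continuous_map_from_subtopology continuous_map_product_projection)

lemma topspace_tuple_space: "u \<in> topspace (tuple_space X \<UU> q) \<Longrightarrow> u \<in> tuples \<UU> q"
  by simp

context contraction
begin

text \<open>Omitting a coordinate is a continuous map of tuple spaces.\<close>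

lemma k_cochain_coboundary:
  assumes f: "k_cochain X \<UU> V q f"
  shows "k_cochain X \<UU> V (Suc q) (cover_d \<UU> q f)"
proof -
  have omit_cont: "continuous_map (tuple_space X \<UU> (Suc q)) (tuple_space X \<UU> q) (omit q j)" if j: "j \<le> Suc q" for j
  proof -
    let ?as = "take j (projections (Suc q)) @ drop (Suc j) (projections (Suc q)) :: ((nat \<Rightarrow> 'a) \<Rightarrow> 'a) list"
    have eq: "tuple_of q (map (\<lambda>a. a u) ?as) = omit q j u" if u: "u \<in> tuples \<UU> (Suc q)" for u
    proof -
      have "omit q j u = omit q j (tuple_of (Suc q) (list_of (Suc q) u))"
        using tuple_of_list_of[OF tuples_extensional[OF u]] by simp
      also have "\<dots> = tuple_of q (take j (list_of (Suc q) u) @ drop (Suc j) (list_of (Suc q) u))"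
        by (rule omit_tuple_of) (use j in auto)
      finally show ?thesis by (simp add: map_projections[symmetric] take_map drop_map)
    qed
    have "continuous_map (tuple_space X \<UU> (Suc q)) (tuple_space X \<UU> q) (\<lambda>u. tuple_of q (map (\<lambda>a. a u) ?as))"
    proof (rule continuous_map_tuple_of)
      show "length ?as = Suc q" using j by simp
      show "continuous_map (tuple_space X \<UU> (Suc q)) X a" if "a \<in> set ?as" for a
        using that continuous_map_projections[of a "Suc q"] by (auto dest: in_set_takeD in_set_dropD)
      fix u assume "u \<in> topspace (tuple_space X \<UU> (Suc q))"
      then have "omit q j u \<in> tuples \<UU> q"
        using face_complex.face_in[OF face_complex_tuples _ j] topspace_tuple_space by blast
      then have "tuple_of q (map (\<lambda>a. a u) ?as) \<in> tuples \<UU> q"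
        using eq \<open>u \<in> topspace _\<close> topspace_tuple_space by metis
      then show "\<exists>U\<in>\<UU>. set (map (\<lambda>a. a u) ?as) \<subseteq> U"
        using j by (subst (asm) tuple_of_in_tuples_iff) auto
    qed
    then show ?thesis
      by (rule continuous_map_eq) (use eq topspace_tuple_space in blast)
  qed
  have "k_cochain X \<UU> V (Suc q) (\<lambda>u. \<Sum>j\<le>Suc q. if even j then f (omit q j u) else - f (omit q j u))"
  proof (rule k_continuous_sum)
    fix j assume "j \<in> {..Suc q}"
    then have "k_cochain X \<UU> V (Suc q) (\<lambda>u. f (omit q j u))"
      using k_continuous_compose[OF omit_cont f] by simp
    then show "k_cochain X \<UU> V (Suc q) (\<lambda>u. if even j then f (omit q j u) else - f (omit q j u))"
      using k_continuous_uminus by (cases "even j") auto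
  qed
  then show ?thesis
    by (rule k_continuous_cong[rotated]) (auto simp: cover_d_def coboundary_def)
qed

lemma kc_cochains_eq:
  "kc_cochains X \<UU> V = (\<lambda>q. (function_group (tuples \<UU> q) V)\<lparr>carrier :=
      {f. f \<in> extensional (tuples \<UU> q) \<and> k_cochain X \<UU> V q f}\<rparr>)"
  by (simp add: kc_cochains_def cover_cochains_def fun_eq_iff carrier_function_group[OF V_UNIV] del: carrier_product_group)

lemma subgroup_k_cochains:
  "subgroup {f. f \<in> extensional (tuples \<UU> q) \<and> k_cochain X \<UU> V q f} (function_group (tuples \<UU> q) V)"
proof -
  interpret G: comm_group "function_group (tuples \<UU> q) V" by (rule comm_group_function_group[OF V_UNIV])
  have carr: "carrier (function_group (tuples \<UU> q) V) = extensional (tuples \<UU> q)" by (rule carrier_function_group[OF V_UNIV])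
  show ?thesis
  proof (rule G.subgroupI)
    show "{f. f \<in> extensional (tuples \<UU> q) \<and> k_cochain X \<UU> V q f} \<subseteq> carrier (function_group (tuples \<UU> q) V)"
      unfolding carr by blast
    have "k_cochain X \<UU> V q (\<lambda>u\<in>tuples \<UU> q. 0)"
      by (rule k_continuous_cong[OF _ k_continuous_const[of _ 0]]) simp
    then show "{f. f \<in> extensional (tuples \<UU> q) \<and> k_cochain X \<UU> V q f} \<noteq> {}" by blast
    fix f assume f: "f \<in> {f. f \<in> extensional (tuples \<UU> q) \<and> k_cochain X \<UU> V q f}"
    have inv: "inv\<^bsub>function_group (tuples \<UU> q) V\<^esub> f = (\<lambda>u\<in>tuples \<UU> q. - f u)"
    proof (rule G.inv_equality)
      show "(\<lambda>u\<in>tuples \<UU> q. - f u) \<otimes>\<^bsub>function_group (tuples \<UU> q) V\<^esub> f = \<one>\<^bsub>function_group (tuples \<UU> q) V\<^esub>"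
        unfolding mult_function_group one_function_group by (auto simp: fun_eq_iff)
    qed (use f carr in \<open>auto simp del: carrier_product_group\<close>)
    have "k_cochain X \<UU> V q (\<lambda>u\<in>tuples \<UU> q. - f u)"
      by (rule k_continuous_cong[OF _ k_continuous_uminus]) (use f in auto)
    then show "inv\<^bsub>function_group (tuples \<UU> q) V\<^esub> f \<in> {f. f \<in> extensional (tuples \<UU> q) \<and> k_cochain X \<UU> V q f}"
      unfolding inv by simp
    fix g assume g: "g \<in> {f. f \<in> extensional (tuples \<UU> q) \<and> k_cochain X \<UU> V q f}"
    have "k_cochain X \<UU> V q (\<lambda>u\<in>tuples \<UU> q. f u + g u)"
      by (rule k_continuous_cong[OF _ k_continuous_add[of _ f g]]) (use f g in auto)
    then show "f \<otimes>\<^bsub>function_group (tuples \<UU> q) V\<^esub> g \<in> {f. f \<in> extensional (tuples \<UU> q) \<and> k_cochain X \<UU> V q f}"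
      unfolding mult_function_group by simp
  qed
qed

lemma cochain_complex_kc: "cochain_complex (kc_cochains X \<UU> V) (cover_d \<UU>)"
  unfolding kc_cochains_eq cover_d_def
proof (rule face_complex.cochain_complex_subgroups[OF face_complex_tuples V_UNIV subgroup_k_cochains])
  show "coboundary (tuples \<UU>) omit q f \<in> {f. f \<in> extensional (tuples \<UU> (Suc q)) \<and> k_cochain X \<UU> V (Suc q) f}"
    if "f \<in> {f. f \<in> extensional (tuples \<UU> q) \<and> k_cochain X \<UU> V q f}" for q f
    using that k_cochain_coboundary[where X = X and \<UU> = \<UU> and q = q and f = f] coboundary_extensional[of "tuples \<UU>" omit q f] by (simp add: cover_d_def)
qed

lemma kc_coboundaryI:
  assumes f: "f \<in> extensional (tuples \<UU> q)" and \<beta>0: "\<beta> [] = 0"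
    and \<beta>: "\<And>p. q = Suc p \<Longrightarrow> k_cochain X \<UU> V p (\<lambda>u. \<beta> (list_of p u))"
    and eq: "\<And>l. small_list \<UU> q l \<Longrightarrow> f (tuple_of q l) = frag_eval \<beta> (list_boundary l)"
  shows "f \<in> coboundaries (kc_cochains X \<UU> V) (cover_d \<UU>) q"
proof (cases q)
  case 0
  have "f u = 0" if "u \<in> tuples \<UU> 0" for u
  proof -
    have u: "u = tuple_of 0 (list_of 0 u)" using tuple_of_list_of[OF tuples_extensional[OF that]] by simp
    have "f (tuple_of 0 (list_of 0 u)) = frag_eval \<beta> (list_boundary (list_of 0 u))"
      using eq small_list_of[OF that] 0 by blast
    then show ?thesis using \<beta>0 u by (simp add: list_of_def)
  qed
  then have "f = (\<lambda>u\<in>tuples \<UU> 0. 0)" using f 0 by (auto intro: extensionalityI)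
  then show ?thesis by (simp add: 0 coboundaries_def kc_cochains_def cover_cochains_def one_function_group del: one_product_group)
next
  case (Suc p)
  let ?b = "\<lambda>u\<in>tuples \<UU> p. \<beta> (list_of p u)"
  have "k_cochain X \<UU> V p ?b" by (rule k_continuous_cong[OF _ \<beta>[OF Suc]]) simp
  then have b: "?b \<in> carrier (kc_cochains X \<UU> V p)" unfolding carrier_kc_cochains[OF V_UNIV] by simp
  have "cover_d \<UU> p ?b = f"
  proof (rule extensionalityI)
    show "cover_d \<UU> p ?b \<in> extensional (tuples \<UU> (Suc p))" by (simp add: cover_d_def coboundary_extensional)
    show "f \<in> extensional (tuples \<UU> (Suc p))" using f Suc by simp
    fix u assume "u \<in> tuples \<UU> (Suc p)"
    then obtain l U where u: "u = tuple_of (Suc p) l" and l: "length l = Suc (Suc p)" "U \<in> \<UU>" "set l \<subseteq> U"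
      by (elim tuples_cases)
    then have sl: "small_list \<UU> (Suc p) l" by (auto simp: small_list_def)
    have "cover_d \<UU> p ?b u = frag_eval (\<lambda>m. ?b (tuple_of p m)) (list_boundary l)" unfolding u by (rule cover_d_eval[OF l])
    also have "\<dots> = frag_eval \<beta> (list_boundary l)"
    proof (rule frag_eval_cong)
      fix m assume "m \<in> Poly_Mapping.keys (list_boundary l)"
      then have "small_list \<UU> p m" by (rule small_list_boundary[OF sl])
      then show "?b (tuple_of p m) = \<beta> m" using tuple_of_small_list by (auto simp: small_list_def list_of_tuple_of)
    qed
    finally show "cover_d \<UU> p ?b u = f u" using eq sl Suc u by simp
  qed
  then show ?thesis using b Suc by (auto simp: coboundaries_def)
qed

end


section \<open>Singular cohomology computed by small simplices\<close>

lemma cohomology_map_bij: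
  assumes C: "cochain_complex C d" and C': "cochain_complex C' d'" and h: "cochain_map C d C' d' h"
    and surj: "\<And>z'. z' \<in> cocycles C' d' q \<Longrightarrow> \<exists>z\<in>cocycles C d q. h q z = z'"
    and inj: "\<And>z. z \<in> cocycles C d q \<Longrightarrow> h q z \<in> coboundaries C' d' q \<Longrightarrow> z \<in> coboundaries C d q"
  shows "bij_betw (cohomology_map C' d' q (h q)) (carrier (cohomology C d q)) (carrier (cohomology C' d' q))"
proof -
  let ?h = "cohomology_map C' d' q (h q)"
  interpret G: comm_group "cohomology C d q" by (rule comm_group_cohomology[OF C])
  interpret G': comm_group "cohomology C' d' q" by (rule comm_group_cohomology[OF C'])
  interpret hom: group_hom "cohomology C d q" "cohomology C' d' q" ?h
    by (simp add: group_hom_def group_hom_axioms_def cohomology_map_hom[OF C C' h] G.is_group G'.is_group)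
  have "kernel (cohomology C d q) (cohomology C' d' q) ?h = {\<one>\<^bsub>cohomology C d q\<^esub>}"
  proof
    show "kernel (cohomology C d q) (cohomology C' d' q) ?h \<subseteq> {\<one>\<^bsub>cohomology C d q\<^esub>}"
    proof
      fix x assume x: "x \<in> kernel (cohomology C d q) (cohomology C' d' q) ?h"
      then obtain z where z: "z \<in> cocycles C d q" "x = cohomology_class C d q z"
        by (auto simp: kernel_def carrier_cohomology[OF C])
      have "cohomology_class C' d' q (h q z) = \<one>\<^bsub>cohomology C' d' q\<^esub>"
        using x z(2) cohomology_map_class[OF C C' h z(1)] by (simp add: kernel_def)
      then have "h q z \<in> coboundaries C' d' q"
        using cohomology_class_eq_one_iff[OF C' cochain_map_cocycles[OF C C' h z(1)]] by blast
      then have "z \<in> coboundaries C d q" by (rule inj[OF z(1)])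
      then show "x \<in> {\<one>\<^bsub>cohomology C d q\<^esub>}" unfolding z(2) cohomology_class_eq_one_iff[OF C z(1), symmetric] by simp
    qed
  qed (simp add: kernel_def)
  then have "inj_on ?h (carrier (cohomology C d q))" by (rule hom.trivial_ker_imp_inj)
  moreover have "carrier (cohomology C' d' q) \<subseteq> ?h ` carrier (cohomology C d q)"
  proof
    fix y assume "y \<in> carrier (cohomology C' d' q)"
    then obtain z' where z': "z' \<in> cocycles C' d' q" "y = cohomology_class C' d' q z'"
      by (auto simp: carrier_cohomology[OF C'])
    then obtain z where z: "z \<in> cocycles C d q" "h q z = z'" using surj by blast
    then have "y = ?h (cohomology_class C d q z)" using z' cohomology_map_class[OF C C' h z(1)] by simp
    then show "y \<in> ?h ` carrier (cohomology C d q)" using z(1) by (auto simp: carrier_cohomology[OF C])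
  qed
  ultimately show ?thesis using hom.hom_closed by (auto simp: bij_betw_def)
qed

lemma cochain_map_sing_small:
  assumes V: "topspace V = UNIV"
  shows "cochain_map (\<lambda>q. function_group (singular_simplex_set q X) V)
     (coboundary (\<lambda>q. singular_simplex_set q X) (\<lambda>q. singular_face (Suc q)))
     (small_cochains X \<UU> V) (small_d X \<UU>) (\<lambda>q f. restrict f (small_simplices X \<UU> q))"
  unfolding small_cochains_eq small_d_def
  by (rule cochain_map_pullback[OF face_complex_singular face_complex_small])
    (auto simp: small_simplices_def mult_function_group carrier_function_group[OF V]
      simp del: mult_product_group carrier_product_group)

lemma frag_eval_boundary_zero:
  assumes f: "\<And>s. s \<in> S \<Longrightarrow> frag_eval f (chain_boundary k (frag_of s)) = 0" and c: "Poly_Mapping.keys c \<subseteq> S"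
  shows "frag_eval f (chain_boundary k c) = 0"
  unfolding chain_boundary_expansion[of k c] frag_eval_extend
  by (rule frag_eval_eq_0) (use assms in auto)

lemma frag_eval_boundary_eq:
  assumes f: "\<And>s. s \<in> S \<Longrightarrow> f s = frag_eval \<beta> (chain_boundary k (frag_of s))" and c: "Poly_Mapping.keys c \<subseteq> S"
  shows "frag_eval f c = frag_eval \<beta> (chain_boundary k c)"
  unfolding chain_boundary_expansion[of k c] frag_eval_extend
  by (rule frag_eval_cong) (use assms in auto)

text \<open>Let \<open>\<rho>\<close> be the retraction \<open>s - \<partial> (D s) - D (\<partial> s)\<close> onto the small chains. It is a chain map and the identity on
  small simplices. Composing with \<open>\<rho>\<close> extends a cocycle on small simplices to all simplices, and the
  homotopy \<open>D\<close> shows that a cocycle whose restriction is a coboundary is one itself.\<close>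

lemma sing_to_small_bij:
  assumes V: "topspace V = UNIV" and cover: "\<And>U. U \<in> \<UU> \<Longrightarrow> openin X U" "topspace X \<subseteq> \<Union>\<UU>"
  shows "bij_betw (cohomology_map (small_cochains X \<UU> V) (small_d X \<UU>) q (\<lambda>f. restrict f (small_simplices X \<UU> q)))
     (carrier (singular_cohomology X V q)) (carrier (cohomology (small_cochains X \<UU> V) (small_d X \<UU>) q))"
proof -
  let ?S = "\<lambda>q. singular_simplex_set q X" and ?T = "small_simplices X \<UU>"
  obtain D where D: "\<And>k s. k \<le> Suc q \<Longrightarrow> singular_simplex k X s \<Longrightarrow>
    singular_chain (Suc k) X (D k s) \<and> (s \<in> ?T k \<longrightarrow> D k s = 0) \<and>
    Poly_Mapping.keys (frag_of s - chain_boundary (Suc k) (D k s) -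
      frag_extend (D (k - 1)) (chain_boundary k (frag_of s))) \<subseteq> ?T k"
    using deformation_to_small_simplices[OF cover, of "Suc q"] by blast
  define \<rho> where "\<rho> k s = frag_of s - chain_boundary (Suc k) (D k s) -
      frag_extend (D (k - 1)) (chain_boundary k (frag_of s))" for k s
  have rho: "Poly_Mapping.keys (\<rho> k s) \<subseteq> ?T k" if "k \<le> Suc q" "singular_simplex k X s" for k s
    using D[OF that] unfolding \<rho>_def by blast
  have Dk: "Poly_Mapping.keys (D k s) \<subseteq> ?S (Suc k)" if "k \<le> Suc q" "singular_simplex k X s" for k s
    using D[OF that] unfolding singular_chain_def by blast
  have nat: "chain_boundary (Suc k) (\<rho> (Suc k) s) = frag_extend (\<rho> k) (chain_boundary (Suc k) (frag_of s))"
    if k: "k \<le> q" and s: "singular_simplex (Suc k) X s" for k s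
  proof -
    let ?bs = "chain_boundary (Suc k) (frag_of s)"
    have bb: "chain_boundary (Suc k) (chain_boundary (Suc (Suc k)) (D (Suc k) s)) = 0"
      using chain_boundary_boundary[of "Suc (Suc k)" X "D (Suc k) s"] D[of "Suc k" s] k s by simp
    have z: "frag_extend (\<lambda>t. frag_extend (D (k - 1)) (chain_boundary k (frag_of t))) ?bs = 0"
      using chain_boundary_boundary_of[OF s] chain_boundary_expansion[of k ?bs]
      by (simp add: frag_extend_extend[symmetric])
    have "frag_extend (\<rho> k) ?bs = ?bs - frag_extend (\<lambda>t. chain_boundary (Suc k) (D k t)) ?bs"
      unfolding \<rho>_def[abs_def] frag_extend_diff_fun z by (simp add: frag_expansion[symmetric])
    then show ?thesis
      unfolding \<rho>_def by (simp add: chain_boundary_diff bb chain_boundary_frag_extend)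
  qed
  have bs: "singular_simplex (k - 1) X t" if "singular_simplex k X s" "t \<in> Poly_Mapping.keys (chain_boundary k (frag_of s))" for k s t
    using keys_boundary_simplex[OF that] .
  have rho_small: "\<rho> q s = frag_of s" if s: "s \<in> ?T q" for s
  proof -
    have "singular_simplex q X s" using s by (simp add: small_simplices_def)
    moreover have "frag_extend (D (q - 1)) (chain_boundary q (frag_of s)) = 0"
    proof (cases q)
      case 0
      then show ?thesis by (simp add: chain_boundary_def)
    next
      case (Suc p)
      have "Poly_Mapping.keys (chain_boundary (Suc p) (frag_of s)) \<subseteq> ?T p"
        by (rule keys_chain_boundary_small) (use s Suc in simp)
      then show ?thesis using D[of p] Suc
        by (intro frag_extend_eq_0) (auto simp: small_simplices_def subset_iff)
    qed
    ultimately show ?thesis using D[of q s] s unfolding \<rho>_def by simp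
  qed
  note cyc_sing = singular_cocycles_iff[OF V face_complex_singular]
    and cob_sing = singular_coboundaries_iff[OF V face_complex_singular]
    and cyc_small = singular_cocycles_iff[OF V face_complex_small]
    and cob_small = singular_coboundaries_iff[OF V face_complex_small]
  show ?thesis
    unfolding singular_cohomology_def
  proof (rule cohomology_map_bij[OF face_complex.cochain_complex_functions[OF face_complex_singular V]
        cochain_complex_small[OF V] cochain_map_sing_small[OF V]])
    fix z' assume "z' \<in> cocycles (small_cochains X \<UU> V) (small_d X \<UU>) q"
    then have z': "z' \<in> extensional (?T q)" "\<And>s. s \<in> ?T (Suc q) \<Longrightarrow> frag_eval z' (chain_boundary (Suc q) (frag_of s)) = 0"
      unfolding small_cochains_eq small_d_def cyc_small by auto
    let ?z = "\<lambda>s\<in>?S q. frag_eval z' (\<rho> q s)"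
    have "?z \<in> cocycles (\<lambda>q. function_group (?S q) V) (coboundary ?S (\<lambda>q. singular_face (Suc q))) q"
      unfolding cyc_sing
    proof (intro conjI ballI)
      fix s assume "s \<in> ?S (Suc q)"
      then have s: "singular_simplex (Suc q) X s" by simp
      have "frag_eval ?z (chain_boundary (Suc q) (frag_of s)) =
          frag_eval (\<lambda>t. frag_eval z' (\<rho> q t)) (chain_boundary (Suc q) (frag_of s))"
        by (rule frag_eval_cong) (use bs[OF s] in auto)
      also have "\<dots> = frag_eval z' (chain_boundary (Suc q) (\<rho> (Suc q) s))"
        unfolding nat[OF order_refl s] frag_eval_extend ..
      also have "\<dots> = 0"
        by (rule frag_eval_boundary_zero[OF z'(2) rho[OF order_refl s]])
      finally show "frag_eval ?z (chain_boundary (Suc q) (frag_of s)) = 0" .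
    qed simp
    moreover have "restrict ?z (?T q) = z'"
      by (rule extensionalityI[OF restrict_extensional z'(1)]) (auto simp: rho_small small_simplices_def)
    ultimately show "\<exists>z\<in>cocycles (\<lambda>q. function_group (?S q) V) (coboundary ?S (\<lambda>q. singular_face (Suc q))) q.
        restrict z (?T q) = z'" by blast
  next
    fix z assume "z \<in> cocycles (\<lambda>q. function_group (?S q) V) (coboundary ?S (\<lambda>q. singular_face (Suc q))) q"
      and "restrict z (?T q) \<in> coboundaries (small_cochains X \<UU> V) (small_d X \<UU>) q"
    then have z: "z \<in> extensional (?S q)" "\<And>s. s \<in> ?S (Suc q) \<Longrightarrow> frag_eval z (chain_boundary (Suc q) (frag_of s)) = 0"
      and "\<exists>\<beta>. \<forall>s\<in>?T q. restrict z (?T q) s = frag_eval \<beta> (chain_boundary q (frag_of s))"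
      unfolding small_cochains_eq small_d_def cyc_sing cob_small by auto
    then obtain \<beta> where \<beta>: "\<And>s. s \<in> ?T q \<Longrightarrow> z s = frag_eval \<beta> (chain_boundary q (frag_of s))" by auto
    let ?b = "\<lambda>t. frag_eval \<beta> (\<rho> (q - 1) t) + frag_eval z (D (q - 1) t)"
    have "z s = frag_eval ?b (chain_boundary q (frag_of s))" if s: "singular_simplex q X s" for s
    proof -
      have "frag_of s = \<rho> q s + chain_boundary (Suc q) (D q s) + frag_extend (D (q - 1)) (chain_boundary q (frag_of s))"
        unfolding \<rho>_def by simp
      then have "z s = frag_eval z (\<rho> q s + chain_boundary (Suc q) (D q s) + frag_extend (D (q - 1)) (chain_boundary q (frag_of s)))"
        by (metis frag_eval_of)
      also have "\<dots> = frag_eval z (\<rho> q s) + frag_eval z (chain_boundary (Suc q) (D q s)) +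
          frag_eval (\<lambda>t. frag_eval z (D (q - 1) t)) (chain_boundary q (frag_of s))"
        by (simp add: frag_eval_add frag_eval_extend)
      also have "frag_eval z (chain_boundary (Suc q) (D q s)) = 0"
        by (rule frag_eval_boundary_zero[OF z(2) Dk]) (use s in auto)
      also have "frag_eval z (\<rho> q s) = frag_eval \<beta> (chain_boundary q (\<rho> q s))"
        by (rule frag_eval_boundary_eq[OF \<beta> rho]) (use s in auto)
      also have "chain_boundary q (\<rho> q s) = frag_extend (\<rho> (q - 1)) (chain_boundary q (frag_of s))"
      proof (cases q)
        case 0
        then show ?thesis by (simp add: chain_boundary_def)
      next
        case (Suc p)
        then show ?thesis using nat[of p s] s by simp
      qed
      finally show ?thesis by (simp add: frag_eval_extend frag_eval_add_fun)
    qed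
    then show "z \<in> coboundaries (\<lambda>q. function_group (?S q) V) (coboundary ?S (\<lambda>q. singular_face (Suc q))) q"
      unfolding cob_sing using z(1) by (auto intro!: exI[of _ ?b])
  qed
qed

section \<open>All cochains compared with small singular cochains\<close>

lemma coset_in_cover: "(+) g ` U \<in> coset_cover U"
  by (auto simp: coset_cover_def)

lemma close_points_coset:
  assumes "\<And>x y. x \<in> W \<Longrightarrow> y \<in> W \<Longrightarrow> - x + y \<in> N" "A \<in> coset_cover W"
  shows "close_points N A"
proof -
  obtain g where A: "A = (\<lambda>u. g + u) ` W" using assms(2) by (auto simp: coset_cover_def)
  have "- (g + x) + (g + y) = - x + y" for x y by (simp add: minus_add add.assoc[symmetric])
  then show ?thesis using assms(1) by (auto simp: A close_points_def)
qed

text \<open>The three parts of the homotopy equivalence between close tuples and small simplices: the chain map \<open>L\<close> from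
  lists to simplices, which is inverse to taking vertices up to the homotopies \<open>E\<close> on simplices and \<open>D\<close> on
  lists. All values are small with respect to the cosets of \<open>U\<close>.\<close>

definition fills_lists where
  "fills_lists U q N L \<longleftrightarrow> L [] = 0 \<and> (\<forall>k l. k \<le> Suc q \<longrightarrow> length l = Suc k \<longrightarrow> close_points N (set l) \<longrightarrow>
     Poly_Mapping.keys (L l) \<subseteq> small_simplices euclidean (coset_cover U) k \<and>
     chain_boundary k (L l) = frag_extend L (list_boundary l))"

definition contracts_simplices where
  "contracts_simplices U q N L E \<longleftrightarrow>
     (\<forall>k s. k \<le> q \<longrightarrow> singular_simplex k euclidean s \<longrightarrow> close_points N (s ` standard_simplex k) \<longrightarrow>
       Poly_Mapping.keys (E k s) \<subseteq> small_simplices euclidean (coset_cover U) (Suc k) \<and>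
       chain_boundary (Suc k) (E k s) =
         L (vertex_list k s) - frag_of s - frag_extend (E (k - 1)) (chain_boundary k (frag_of s)))"

definition contracts_lists where
  "contracts_lists U q N L D \<longleftrightarrow> D 0 [] = 0 \<and>
     (\<forall>k l. k \<le> q \<longrightarrow> length l = Suc k \<longrightarrow> close_points N (set l) \<longrightarrow>
       Poly_Mapping.keys (D k l) \<subseteq> Collect (small_list (coset_cover U) (Suc k)) \<and>
       frag_extend list_boundary (D k l) =
         frag_extend (frag_of \<circ> vertex_list k) (L l) - frag_of l - frag_extend (D (k - 1)) (list_boundary l))"

text \<open>A tower of height \<open>q + 2\<close> with top \<open>U\<close> leaves room for the fillings up to degree \<open>q + 1\<close> and for the homotopies,
  whose values are one degree higher than their arguments. Closeness is measured by the bottom of the tower.\<close>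

lemma small_fillings:
  fixes U :: "'g::topological_group_add set"
  assumes lc: "locally_contractible_space (euclidean :: 'g topology)" and U: "open U" "0 \<in> U"
  shows "\<exists>N L E D. open N \<and> 0 \<in> N \<and> fills_lists U q N L \<and> contracts_simplices U q N L E \<and> contracts_lists U q N L D"
proof -
  define n where "n = Suc (Suc q)"
  obtain N where tower: "filling_tower n N" and Nn: "N n = U" using filling_tower_exists[OF lc U] by blast
  obtain L :: "'g list \<Rightarrow> _" where L0: "L [] = 0" and L1: "\<And>y. L [y] = frag_of (restrict (\<lambda>_. y) (standard_simplex 0))"
    and L: "\<And>k l. k \<le> n \<Longrightarrow> length l = Suc k \<Longrightarrow> close_points (N 0) (set l) \<Longrightarrow>
      singular_chain k (top_of_set ((+) (hd l) ` N k)) (L l) \<and> chain_boundary k (L l) = frag_extend L (list_boundary l)"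
    using close_tuples_fill[OF tower, of n] by blast
  have "\<exists>E. \<forall>k\<le>n. Suc k \<le> n \<longrightarrow> (\<forall>s. singular_simplex k euclidean s \<longrightarrow> close_points (N 0) (s ` standard_simplex k) \<longrightarrow>
    singular_chain (Suc k) (top_of_set ((+) (s (simplex_vertex 0)) ` N (Suc k))) (E k s) \<and>
    chain_boundary (Suc k) (E k s) = L (vertex_list k s) - frag_of s - frag_extend (E (k - 1)) (chain_boundary k (frag_of s)))"
    by (rule close_simplices_homotopy[OF tower L1 L])
  then obtain E where E: "\<And>k s. Suc k \<le> n \<Longrightarrow> singular_simplex k euclidean s \<Longrightarrow> close_points (N 0) (s ` standard_simplex k) \<Longrightarrow>
    singular_chain (Suc k) (top_of_set ((+) (s (simplex_vertex 0)) ` N (Suc k))) (E k s) \<and>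
    chain_boundary (Suc k) (E k s) = L (vertex_list k s) - frag_of s - frag_extend (E (k - 1)) (chain_boundary k (frag_of s))"
    by (metis Suc_leD)
  have NU: "N k \<subseteq> U" if "k \<le> n" for k using filling_towerD(3)[OF tower that order_refl] Nn by simp
  have small: "Poly_Mapping.keys c \<subseteq> small_simplices euclidean (coset_cover U) k"
    if c: "singular_chain k (top_of_set ((+) g ` N j)) c" and j: "j \<le> n" for k g j c
  proof -
    have "singular_chain k (top_of_set ((+) g ` U)) c"
      by (rule singular_chain_mono[OF c image_mono[OF NU[OF j]]])
    then show ?thesis unfolding singular_chain_def small_simplices_iff[abs_def] subset_iff
      using coset_in_cover[of g U] by blast
  qed
  define \<mu> where "\<mu> l = frag_extend (frag_of \<circ> vertex_list (length l - 1)) (L l)" for l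
  define D where "D = list_homotopy \<mu>"
  have mu_keys: "length m' = length m \<and> set m' \<subseteq> (+) (hd l) ` U"
    if l: "close_points (N 0) (set l)" "hd l \<in> set l"
      and m: "set m \<subseteq> set l" "length m \<le> Suc q" "m \<noteq> []" "m' \<in> Poly_Mapping.keys (\<mu> m)" for l m m'
  proof -
    obtain k where k: "length m = Suc k" using m(3) by (cases m) auto
    have kn: "k \<le> n" "k < n" using k m(2) by (auto simp: n_def)
    have "m' \<in> (\<Union>s\<in>Poly_Mapping.keys (L m). Poly_Mapping.keys ((frag_of \<circ> vertex_list (length m - 1)) s))"
      by (rule subsetD[OF keys_frag_extend m(4)[unfolded \<mu>_def]])
    then obtain s where s0: "s \<in> Poly_Mapping.keys (L m)"
      and "m' \<in> Poly_Mapping.keys ((frag_of \<circ> vertex_list (length m - 1)) s)" by (rule UN_E)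
    then have s: "s \<in> Poly_Mapping.keys (L m)" "m' = vertex_list k s" by (simp_all add: k)
    have cl: "close_points (N 0) (set m)" by (rule close_points_subset[OF l(1) m(1)])
    have "singular_simplex k (top_of_set ((+) (hd m) ` N k)) s"
      using L[OF kn(1) k cl] s(1) by (auto simp: singular_chain_def)
    then have "s ` standard_simplex k \<subseteq> (+) (hd m) ` N k" by (simp add: singular_simplex_subtopology)
    then have "set m' \<subseteq> (+) (hd m) ` N k" using set_vertex_list[of k s] s(2) by blast
    also have "\<dots> \<subseteq> {hd l + (x + y) | x y. x \<in> N k \<and> y \<in> N k}"
    proof (rule shift_carrier)
      have "hd m \<in> set l" using hd_in_set[OF k] m(1) by blast
      then show "- hd l + hd m \<in> N 0" using l unfolding close_points_def by blast
      show "N 0 \<subseteq> N k" by (rule filling_towerD(3)[OF tower _ kn(1)]) simp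
    qed
    also have "\<dots> \<subseteq> (+) (hd l) ` U"
      using filling_tower_sum[OF tower kn(2)] NU[of "Suc k"] kn(2) by auto
    finally show ?thesis using s(2) k by simp
  qed
  have D_keys: "Poly_Mapping.keys (D k l) \<subseteq> Collect (small_list (coset_cover U) (Suc k))"
    if k: "k \<le> q" "length l = Suc k" "close_points (N 0) (set l)" for k l
  proof
    fix m assume m: "m \<in> Poly_Mapping.keys (D k l)"
    have hl: "hd l \<in> set l" by (rule hd_in_set[OF k(2)])
    have "length m = Suc (Suc k) \<and> set m \<subseteq> (+) (hd l) ` U"
    proof (rule keys_list_homotopy[where \<mu> = \<mu> and n = q and ?S0.0 = "set l" and l = l])
      show "length m' = length m \<and> set m' \<subseteq> (+) (hd l) ` U"
        if "set m \<subseteq> set l" "length m \<le> Suc q" "m \<noteq> []" "m' \<in> Poly_Mapping.keys (\<mu> m)" for m m'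
        using mu_keys[OF k(3) hl that] .
      show "set l \<subseteq> (+) (hd l) ` U"
      proof
        fix x assume "x \<in> set l"
        then have "- hd l + x \<in> U" using k(3) hl NU[of 0] unfolding close_points_def by blast
        then show "x \<in> (+) (hd l) ` U" by (rule rev_image_eqI) (simp add: add.assoc[symmetric])
      qed
    qed (use k m in \<open>auto simp: D_def\<close>)
    then show "m \<in> Collect (small_list (coset_cover U) (Suc k))"
      using coset_in_cover[of "hd l" U] by (auto simp: small_list_def)
  qed
  have D_eq: "frag_extend list_boundary (D k l) = frag_extend (frag_of \<circ> vertex_list k) (L l) - frag_of l -
         frag_extend (D (k - 1)) (list_boundary l)"
    if k: "k \<le> q" "length l = Suc k" "close_points (N 0) (set l)" for k l
  proof -
    have "frag_extend list_boundary (list_homotopy \<mu> k l) = \<mu> l - frag_of l - frag_extend (list_homotopy \<mu> (k - 1)) (list_boundary l)"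
    proof (rule list_homotopy_boundary[where P = "\<lambda>l. close_points (N 0) (set l)" and n = q])
      show "close_points (N 0) (set m)" if "close_points (N 0) (set l)" "m \<in> Poly_Mapping.keys (list_boundary l)" for l m
        by (rule close_points_subset[OF that(1) keys_list_boundary(2)[OF that(2)]])
      show "\<mu> [y] = frag_of [y]" for y
        using simplex_vertex_in_standard_simplex[of 0 0] by (simp add: \<mu>_def L1 vertex_list_def list_of_def)
      show "frag_extend list_boundary (\<mu> l) = frag_extend \<mu> (list_boundary l)"
        if l: "close_points (N 0) (set l)" "length l \<le> Suc q" "length l \<ge> 2" for l
      proof -
        obtain j where j: "length l = Suc (Suc j)" using l(3) by (metis Suc_le_D numeral_2_eq_2 Suc_le_mono)
        have "frag_extend list_boundary (\<mu> l) = frag_extend (\<lambda>s. list_boundary (vertex_list (Suc j) s)) (L l)"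
          by (simp add: \<mu>_def j frag_extend_extend)
        also have "\<dots> = frag_extend (frag_of \<circ> vertex_list j) (chain_boundary (Suc j) (L l))"
          unfolding list_boundary_vertex_list chain_boundary_expansion[of "Suc j" "L l"] by (simp add: frag_extend_extend)
        also have "\<dots> = frag_extend (frag_of \<circ> vertex_list j) (frag_extend L (list_boundary l))"
          using L[OF _ j l(1)] j l(2) by (simp add: n_def)
        also have "\<dots> = frag_extend \<mu> (list_boundary l)"
          unfolding frag_extend_extend
        proof (rule frag_extend_eq)
          fix m assume "m \<in> Poly_Mapping.keys (list_boundary l)"
          then have "length m = Suc j" using keys_list_boundary(1)[of m l] j by simp
          then show "frag_extend (frag_of \<circ> vertex_list j) (L m) = \<mu> m" by (simp add: \<mu>_def)
        qed
        finally show ?thesis .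
      qed
    qed (use k in auto)
    then show ?thesis using k(2) unfolding D_def \<mu>_def by simp
  qed
  show ?thesis
    unfolding fills_lists_def contracts_simplices_def contracts_lists_def
  proof (intro exI[of _ "N 0"] exI[of _ L] exI[of _ E] exI[of _ D] conjI allI impI)
    show "open (N 0)" "0 \<in> N 0" using filling_towerD(1,2)[OF tower, of 0] by auto
    show "L [] = 0" by (rule L0)
    show "D 0 [] = 0" by (simp add: D_def)
  next
    fix k l assume k: "k \<le> Suc q" "length (l :: 'g list) = Suc k" "close_points (N 0) (set l)"
    then have kn: "k \<le> n" by (simp add: n_def)
    show "Poly_Mapping.keys (L l) \<subseteq> small_simplices euclidean (coset_cover U) k"
      using small[OF _ kn] L[OF kn k(2,3)] by blast
    show "chain_boundary k (L l) = frag_extend L (list_boundary l)" using L[OF kn k(2,3)] by blast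
  next
    fix k and s :: "(nat \<Rightarrow> real) \<Rightarrow> 'g"
    assume s: "k \<le> q" "singular_simplex k euclidean s" "close_points (N 0) (s ` standard_simplex k)"
    then have kn: "Suc k \<le> n" by (simp add: n_def)
    show "Poly_Mapping.keys (E k s) \<subseteq> small_simplices euclidean (coset_cover U) (Suc k)"
      using small[OF _ kn] E[OF kn s(2,3)] by blast
    show "chain_boundary (Suc k) (E k s) = L (vertex_list k s) - frag_of s - frag_extend (E (k - 1)) (chain_boundary k (frag_of s))"
      using E[OF kn s(2,3)] by blast
  next
    fix k l assume k: "k \<le> q" "length (l :: 'g list) = Suc k" "close_points (N 0) (set l)"
    show "Poly_Mapping.keys (D k l) \<subseteq> Collect (small_list (coset_cover U) (Suc k))" by (rule D_keys[OF k])
    show "frag_extend list_boundary (D k l) = frag_extend (frag_of \<circ> vertex_list k) (L l) - frag_of l -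
         frag_extend (D (k - 1)) (list_boundary l)" by (rule D_eq[OF k])
  qed
qed


lemma filterbase_below:
  assumes "open_identity_filterbase \<B>" "U \<in> \<B>" "open N" "0 \<in> N"
  obtains W where "W \<in> \<B>" "W \<subseteq> U" "W \<subseteq> N"
proof -
  have "open (U \<inter> N)" "0 \<in> U \<inter> N" using assms unfolding open_identity_filterbase_def by auto
  then obtain W where "W \<in> \<B>" "W \<subseteq> U \<inter> N" using assms(1) unfolding open_identity_filterbase_def by blast
  then show ?thesis using that by blast
qed

lemma filterbaseD:
  assumes "open_identity_filterbase \<B>"
  shows "U \<in> \<B> \<Longrightarrow> open U" "U \<in> \<B> \<Longrightarrow> 0 \<in> U" "\<B> \<noteq> {}"
    "U \<in> \<B> \<Longrightarrow> W \<in> \<B> \<Longrightarrow> \<exists>O'\<in>\<B>. O' \<subseteq> U \<and> O' \<subseteq> W"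
proof -
  show *: "U \<in> \<B> \<Longrightarrow> open U" "U \<in> \<B> \<Longrightarrow> 0 \<in> U" for U using assms by (auto simp: open_identity_filterbase_def)
  have "\<forall>N. open N \<and> 0 \<in> N \<longrightarrow> (\<exists>U\<in>\<B>. U \<subseteq> N)" using assms unfolding open_identity_filterbase_def by simp
  from this[rule_format, of UNIV] show "\<B> \<noteq> {}" by auto
  show "\<exists>O'\<in>\<B>. O' \<subseteq> U \<and> O' \<subseteq> W" if UW: "U \<in> \<B>" "W \<in> \<B>"
  proof -
    obtain O' where "O' \<in> \<B>" "O' \<subseteq> U" "O' \<subseteq> W"
      by (rule filterbase_below[OF assms UW(1) *(1)[OF UW(2)] *(2)[OF UW(2)]])
    then show ?thesis by blast
  qed
qed

lemma close_neighbourhood: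
  fixes N :: "'g::topological_group_add set"
  assumes "open N" "0 \<in> N"
  obtains A where "open A" "0 \<in> A" "\<And>x y. x \<in> A \<Longrightarrow> y \<in> A \<Longrightarrow> - x + y \<in> N" "\<And>x y. x \<in> A \<Longrightarrow> y \<in> A \<Longrightarrow> x - y \<in> N"
proof -
  obtain A where A: "open A" "0 \<in> A" "{x + y | x y. x \<in> A \<and> y \<in> A} \<subseteq> N" by (rule open_halving[OF assms])
  have "open (A \<inter> uminus -` A)" by (intro open_Int A open_vimage continuous_intros)
  moreover have "0 \<in> A \<inter> uminus -` A" using A by simp
  moreover have "- x + y \<in> N" "x - y \<in> N" if "x \<in> A \<inter> uminus -` A" "y \<in> A \<inter> uminus -` A" for x y
    using that A(3) unfolding diff_conv_add_uminus by blast+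
  ultimately show ?thesis by (rule that)
qed

lemma vertex_map_eq:
  "s \<in> small_simplices X \<UU> q \<Longrightarrow> vertex_map X \<UU> q f s = f (tuple_of q (vertex_list q s))"
  by (simp add: vertex_map_def tuple_of_vertex_list)

text \<open>Pulling \<open>z\<close> back along \<open>L\<close> yields a cocycle on tuples, and the homotopy \<open>E\<close> compares its values at vertices
  with \<open>z\<close>.\<close>

lemma cover_to_small_surj:
  fixes \<B> :: "'g::topological_group_add set set" and V :: "'v::ab_group_add topology"
  assumes lc: "locally_contractible_space (euclidean :: 'g topology)" and B: "open_identity_filterbase \<B>"
    and V: "topspace V = UNIV" and U: "U \<in> \<B>"
    and z: "z \<in> cocycles (small_cochains euclidean (coset_cover U) V) (small_d euclidean (coset_cover U)) q"
  shows "\<exists>W\<in>\<B>. W \<subseteq> U \<and> (\<exists>x\<in>cocycles (cover_cochains (coset_cover W) V) (cover_d (coset_cover W)) q.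
    \<exists>b\<in>coboundaries (small_cochains euclidean (coset_cover W) V) (small_d euclidean (coset_cover W)) q.
      vertex_map euclidean (coset_cover W) q x =
        b \<otimes>\<^bsub>small_cochains euclidean (coset_cover W) V q\<^esub> restrict z (small_simplices euclidean (coset_cover W) q))"
proof -
  obtain N L E where N: "open N" "0 \<in> N" and fL: "fills_lists U q N L" and fE: "contracts_simplices U q N L E"
    using small_fillings[OF lc filterbaseD(1,2)[OF B U], of q] by blast
  note L = fL[unfolded fills_lists_def, THEN conjunct2, rule_format] and E = fE[unfolded contracts_simplices_def, rule_format]
  obtain A where A: "open A" "0 \<in> A" "\<And>x y. x \<in> A \<Longrightarrow> y \<in> A \<Longrightarrow> - x + y \<in> N"
    using close_neighbourhood[OF N] by metis
  obtain W where W: "W \<in> \<B>" "W \<subseteq> U" "W \<subseteq> A" by (rule filterbase_below[OF B U A(1,2)])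
  have close: "close_points N C" if "C \<in> coset_cover W" for C
    by (rule close_points_coset[OF _ that]) (use A(3) W(3) in blast)
  have z: "\<And>s. s \<in> small_simplices euclidean (coset_cover U) (Suc q) \<Longrightarrow> frag_eval z (chain_boundary (Suc q) (frag_of s)) = 0"
    using z unfolding small_cochains_eq small_d_def singular_cocycles_iff[OF V face_complex_small] by blast
  let ?x = "\<lambda>u\<in>tuples (coset_cover W) q. frag_eval z (L (list_of q u))"
  have x: "?x (tuple_of q l) = frag_eval z (L l)" if "small_list (coset_cover W) q l" for l
    using that tuple_of_small_list[OF that] by (simp add: small_list_def list_of_tuple_of)
  have "?x \<in> cocycles (cover_cochains (coset_cover W) V) (cover_d (coset_cover W)) q"
    unfolding cover_cocycles_iff[OF V]
  proof (intro conjI allI impI)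
    fix l assume l: "small_list (coset_cover W) (Suc q) l"
    then obtain C where C: "length l = Suc (Suc q)" "C \<in> coset_cover W" "set l \<subseteq> C" by (auto simp: small_list_def)
    note Ll = L[OF order_refl C(1) close_points_subset[OF close[OF C(2)] C(3)]]
    have "frag_eval (\<lambda>m. ?x (tuple_of q m)) (list_boundary l) = frag_eval (\<lambda>m. frag_eval z (L m)) (list_boundary l)"
      by (rule frag_eval_cong) (rule x[OF small_list_boundary[OF l]])
    also have "\<dots> = frag_eval z (chain_boundary (Suc q) (L l))" using Ll by (simp add: frag_eval_extend)
    also have "\<dots> = 0" by (rule frag_eval_boundary_zero[OF z]) (use Ll in auto)
    finally show "frag_eval (\<lambda>m. ?x (tuple_of q m)) (list_boundary l) = 0" .
  qed simp
  moreover
  let ?T = "small_simplices euclidean (coset_cover W) q :: ((nat \<Rightarrow> real) \<Rightarrow> 'g) set"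
  let ?b = "\<lambda>s\<in>?T. frag_eval z (L (vertex_list q s)) - z s"
  have Es: "frag_eval z (L (vertex_list q s)) - z s = frag_eval (\<lambda>t. frag_eval z (E (q - 1) t)) (chain_boundary q (frag_of s))"
    if s: "s \<in> ?T" for s
  proof -
    obtain C where C: "C \<in> coset_cover W" "s ` standard_simplex q \<subseteq> C" and ss: "singular_simplex q euclidean s"
      using s by (auto simp: small_simplices_def)
    note Eq = E[OF order_refl ss close_points_subset[OF close[OF C(1)] C(2)]]
    have "frag_eval z (chain_boundary (Suc q) (E q s)) = 0" by (rule frag_eval_boundary_zero[OF z]) (use Eq in auto)
    then show ?thesis using Eq by (simp add: frag_eval_diff frag_eval_extend)
  qed
  have "?b \<in> coboundaries (small_cochains euclidean (coset_cover W) V) (small_d euclidean (coset_cover W)) q"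
    unfolding small_cochains_eq small_d_def singular_coboundaries_iff[OF V face_complex_small]
    using Es by (intro conjI exI[of _ "\<lambda>t. frag_eval z (E (q - 1) t)"]) auto
  moreover have "vertex_map euclidean (coset_cover W) q ?x =
      ?b \<otimes>\<^bsub>small_cochains euclidean (coset_cover W) V q\<^esub> restrict z ?T"
    unfolding small_cochains_def mult_function_group
  proof (rule extensionalityI[of _ ?T])
    fix s assume s: "s \<in> ?T"
    have sl: "small_list (coset_cover W) q (vertex_list q s)"
      using vertices_in_tuples[OF s] unfolding tuple_of_vertex_list[symmetric] by (simp add: small_list_def tuple_of_in_tuples_iff)
    have "vertex_map euclidean (coset_cover W) q ?x s = frag_eval z (L (vertex_list q s))"
      unfolding vertex_map_eq[OF s] by (rule x[OF sl])
    also have "\<dots> = (\<lambda>s\<in>?T. ?b s + restrict z ?T s) s" using s by simp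
    finally show "vertex_map euclidean (coset_cover W) q ?x s = (\<lambda>s\<in>?T. ?b s + restrict z ?T s) s" .
  qed (auto simp: vertex_map_def)
  ultimately show ?thesis using W(1,2) by blast
qed

text \<open>If \<open>x\<close> becomes a coboundary on vertices of small simplices, then it is one on the vertices of the chains \<open>L l\<close>,
  and the homotopy \<open>D\<close> replaces these by the list \<open>l\<close> itself.\<close>

lemma cover_to_small_inj:
  fixes \<B> :: "'g::topological_group_add set set" and V :: "'v::ab_group_add topology"
  assumes lc: "locally_contractible_space (euclidean :: 'g topology)" and B: "open_identity_filterbase \<B>"
    and V: "topspace V = UNIV" and U: "U \<in> \<B>"
    and x: "x \<in> cocycles (cover_cochains (coset_cover U) V) (cover_d (coset_cover U)) q"
    and vx: "vertex_map euclidean (coset_cover U) q x \<in>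
      coboundaries (small_cochains euclidean (coset_cover U) V) (small_d euclidean (coset_cover U)) q"
  shows "\<exists>W\<in>\<B>. W \<subseteq> U \<and> restrict x (tuples (coset_cover W) q) \<in>
    coboundaries (cover_cochains (coset_cover W) V) (cover_d (coset_cover W)) q"
proof -
  obtain N L D where N: "open N" "0 \<in> N" and fL: "fills_lists U q N L" and fD: "contracts_lists U q N L D"
    using small_fillings[OF lc filterbaseD(1,2)[OF B U], of q] by blast
  have L0: "L [] = 0" and D0: "D 0 [] = 0" using fL fD by (auto simp: fills_lists_def contracts_lists_def)
  note L = fL[unfolded fills_lists_def, THEN conjunct2, rule_format] and D = fD[unfolded contracts_lists_def, THEN conjunct2, rule_format]
  obtain A where A: "open A" "0 \<in> A" "\<And>x y. x \<in> A \<Longrightarrow> y \<in> A \<Longrightarrow> - x + y \<in> N"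
    using close_neighbourhood[OF N] by metis
  obtain W where W: "W \<in> \<B>" "W \<subseteq> U" "W \<subseteq> A" by (rule filterbase_below[OF B U A(1,2)])
  have close: "close_points N C" if "C \<in> coset_cover W" for C
    by (rule close_points_coset[OF _ that]) (use A(3) W(3) in blast)
  let ?f = "\<lambda>m. x (tuple_of q m)"
  have xc: "\<And>l. small_list (coset_cover U) (Suc q) l \<Longrightarrow> frag_eval ?f (list_boundary l) = 0"
    using x unfolding cover_cocycles_iff[OF V] by blast
  obtain \<beta> where \<beta>: "\<And>s. s \<in> small_simplices euclidean (coset_cover U) q \<Longrightarrow>
      ?f (vertex_list q s) = frag_eval \<beta> (chain_boundary q (frag_of s))"
    using vx unfolding small_cochains_eq small_d_def singular_coboundaries_iff[OF V face_complex_small]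
    by (metis vertex_map_eq)
  let ?b = "\<lambda>m. frag_eval \<beta> (L m) - (if m = [] then 0 else frag_eval ?f (D (q - 1) m))"
  have "restrict x (tuples (coset_cover W) q) (tuple_of q l) = frag_eval ?b (list_boundary l)"
    if l: "small_list (coset_cover W) q l" for l
  proof -
    obtain C where C: "length l = Suc q" "C \<in> coset_cover W" "set l \<subseteq> C" using l by (auto simp: small_list_def)
    note cl = close_points_subset[OF close[OF C(2)] C(3)]
    note Ll = L[OF _ C(1) cl] and Dl = D[OF order_refl C(1) cl]
    have "frag_eval ?f (frag_extend (frag_of \<circ> vertex_list q) (L l)) = frag_eval (\<lambda>s. ?f (vertex_list q s)) (L l)"
      by (simp add: frag_eval_extend)
    also have "\<dots> = frag_eval \<beta> (chain_boundary q (L l))"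
      by (rule frag_eval_boundary_eq[OF \<beta>]) (use Ll in auto)
    also have "\<dots> = frag_eval (\<lambda>m. frag_eval \<beta> (L m)) (list_boundary l)" using Ll by (simp add: frag_eval_extend)
    finally have 1: "frag_eval ?f (frag_extend (frag_of \<circ> vertex_list q) (L l)) = frag_eval (\<lambda>m. frag_eval \<beta> (L m)) (list_boundary l)" .
    have 2: "frag_eval ?f (frag_extend list_boundary (D q l)) = 0"
      unfolding frag_eval_extend by (rule frag_eval_eq_0) (use Dl xc in auto)
    have 3: "frag_eval ?f (frag_extend (D (q - 1)) (list_boundary l)) =
        frag_eval (\<lambda>m. if m = [] then 0 else frag_eval ?f (D (q - 1) m)) (list_boundary l)"
      unfolding frag_eval_extend
    proof (rule frag_eval_cong)
      fix m assume "m \<in> Poly_Mapping.keys (list_boundary l)"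
      then have "length m = q" using keys_list_boundary(1)[of m l] C(1) by simp
      then show "frag_eval ?f (D (q - 1) m) = (if m = [] then 0 else frag_eval ?f (D (q - 1) m))" using D0 by auto
    qed
    have "frag_eval ?f (frag_extend list_boundary (D q l)) =
        frag_eval ?f (frag_extend (frag_of \<circ> vertex_list q) (L l)) - ?f l - frag_eval ?f (frag_extend (D (q - 1)) (list_boundary l))"
      using Dl by (simp only: frag_eval_diff frag_eval_of)
    then have "?f l = frag_eval (\<lambda>m. frag_eval \<beta> (L m)) (list_boundary l) -
        frag_eval (\<lambda>m. if m = [] then 0 else frag_eval ?f (D (q - 1) m)) (list_boundary l)"
      unfolding 1 2 3 by (simp add: algebra_simps)
    also have "\<dots> = frag_eval ?b (list_boundary l)"
      using frag_eval_add_fun[of "\<lambda>m. frag_eval \<beta> (L m)" "\<lambda>m. - (if m = [] then 0 else frag_eval ?f (D (q - 1) m))"]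
      by (simp only: frag_eval_uminus_fun diff_conv_add_uminus)
    finally show ?thesis using tuple_of_small_list[OF l] by simp
  qed
  moreover have "?b [] = 0" by (simp add: L0)
  ultimately have "restrict x (tuples (coset_cover W) q) \<in> coboundaries (cover_cochains (coset_cover W) V) (cover_d (coset_cover W)) q"
    unfolding cover_coboundaries_iff[OF V] by (intro conjI exI[of _ ?b]) auto
  then show ?thesis using W(1,2) by blast
qed

section \<open>Continuous cochains compared with all cochains\<close>

context averaging
begin

text \<open>With \<open>y = g + w\<close> and \<open>u = - x + y\<close> one has \<open>x = g + (w - u)\<close>.\<close>

lemma near_coset:
  assumes W: "\<forall>w\<in>W. \<forall>u\<in>U. w - u \<in> U'" and g: "y \<in> (+) g ` W" and "near x y"
  shows "x \<in> (+) g ` U'"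
proof -
  obtain w where w: "w \<in> W" "y = g + w" using g by blast
  have "x = y - (- x + y)" by (simp only: eq_diff_eq add_minus_cancel)
  also have "\<dots> = g + (w - (- x + y))" unfolding w(2) by (simp only: add_diff_eq)
  finally have x: "x = g + (w - (- x + y))" .
  have "w - (- x + y) \<in> U'" using W w(1) assms(3) by blast
  then show ?thesis by (rule rev_image_eqI) (rule x)
qed

lemma near_lists_coset:
  assumes W: "\<forall>w\<in>W. \<forall>u\<in>U. w - u \<in> U'" and "list_all2 near xs ys" "set ys \<subseteq> (+) g ` W"
  shows "set xs \<subseteq> (+) g ` U'"
  using assms(2,3)
proof (induction rule: list_all2_induct)
  case (Cons x xs y ys)
  have "x \<in> (+) g ` U'" by (rule near_coset[OF W _ Cons(1)]) (use Cons(4) in simp)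
  then show ?case using Cons by simp
qed simp

text \<open>Smoothing and the prism operator only see centres near the given points, hence lists in a coset of \<open>U'\<close>, where
  the coboundary of \<open>F\<close> vanishes.\<close>

lemma smooth_cocycle:
  assumes W: "\<forall>w\<in>W. \<forall>u\<in>U. w - u \<in> U'" "W \<subseteq> U'"
    and F: "\<forall>l. small_list (coset_cover U') (Suc q) l \<longrightarrow> frag_eval F (list_boundary l) = 0"
  shows "small_list (coset_cover W) (Suc q) l \<Longrightarrow> frag_eval (\<lambda>m. smooth m F) (list_boundary l) = 0"
    and "small_list (coset_cover W) q l \<Longrightarrow> F l = smooth l F + frag_eval (\<lambda>m. prism m F) (list_boundary l)"
proof -
  have F': "frag_eval F (list_boundary zs) = 0"
    if "set zs \<subseteq> (+) g ` U'" "length zs = Suc (Suc q)" for zs g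
    by (rule F[rule_format]) (use that coset_in_cover in \<open>auto simp: small_list_def\<close>)
  { assume l: "small_list (coset_cover W) (Suc q) l"
    then obtain g where g: "length l = Suc (Suc q)" "set l \<subseteq> (+) g ` W" by (auto simp: small_list_def coset_cover_def)
    have "frag_eval (\<lambda>m. smooth m F) (list_boundary l) = smooth l (\<lambda>m. frag_eval F (list_boundary m))"
      by (rule smooth_boundary[symmetric])
    also have "\<dots> = smooth l (\<lambda>_. 0)"
    proof (rule smooth_cong)
      fix zs assume "list_all2 near zs l"
      then show "frag_eval F (list_boundary zs) = 0"
        using near_lists_coset[OF W(1) _ g(2)] g(1) by (intro F') (auto dest: list_all2_lengthD)
    qed
    finally show "frag_eval (\<lambda>m. smooth m F) (list_boundary l) = 0" by (simp add: smooth_zero) }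
  { assume l: "small_list (coset_cover W) q l"
    then obtain g where g: "length l = Suc q" "set l \<subseteq> (+) g ` W" by (auto simp: small_list_def coset_cover_def)
    have "prism l (\<lambda>m. frag_eval F (list_boundary m)) = prism l (\<lambda>_. 0)"
    proof (rule prism_cong)
      fix xs as b bs assume lab: "l = as @ b # bs" and xs: "list_all2 near xs (as @ [b])"
      have "set xs \<subseteq> (+) g ` U'" by (rule near_lists_coset[OF W(1) xs]) (use g(2) lab in auto)
      moreover have "set (b # bs) \<subseteq> (+) g ` U'"
        by (rule order_trans[OF _ image_mono[OF W(2)]]) (use g(2) lab in auto)
      moreover have "length (xs @ b # bs) = Suc (Suc q)" using list_all2_lengthD[OF xs] g(1) lab by simp
      ultimately show "frag_eval F (list_boundary (xs @ b # bs)) = 0" by (intro F'[of _ g]) auto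
    qed
    then show "F l = smooth l F + frag_eval (\<lambda>m. prism m F) (list_boundary l)"
      using prism_boundary[of F l] by (simp add: prism_zero) }
qed

text \<open>With the centres held fixed, \<open>F\<close> contributes constants, so the average varies through its weights only.\<close>

lemma k_cochain_smooth:
  "k_cochain euclidean \<UU> V q (\<lambda>u. smooth (list_of q u) F)"
proof -
  have "k_cochain euclidean \<UU> V q (\<lambda>u. smooth (map (\<lambda>a. a u) (projections q)) F)"
    by (rule k_continuous_smooth[where F = "\<lambda>_. F"])
      (auto intro: continuous_map_projections k_continuous_imp_near[OF k_continuous_const])
  then show ?thesis by (simp add: map_projections)
qed

text \<open>With the centres held fixed, the tuples that occur depend continuously on the given one as long as it stays near
  these centres, which is an open condition.\<close>

lemma k_cochain_prism:
  assumes W: "\<forall>w\<in>W. \<forall>u\<in>U. w - u \<in> U'" "W \<subseteq> U'"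
    and f: "k_cochain euclidean (coset_cover U') V (Suc p) f"
  shows "k_cochain euclidean (coset_cover W) V p (\<lambda>u. prism (list_of p u) (\<lambda>l. f (tuple_of (Suc p) l)))"
proof -
  let ?Y = "tuple_space euclidean (coset_cover W) p"
  have "k_cochain euclidean (coset_cover W) V p
      (\<lambda>u. prism (map (\<lambda>a. a u) (projections p)) (\<lambda>l. f (tuple_of (Suc p) l)))"
  proof (rule k_continuous_prism[where F = "\<lambda>_ l. f (tuple_of (Suc p) l)"])
    show "continuous_map ?Y euclidean a" if "a \<in> set (projections p)" for a
      by (rule continuous_map_projections[OF that])
    fix y :: "nat \<Rightarrow> 'g" and xs as1 b as2
    assume y: "y \<in> topspace ?Y" and as: "projections p = as1 @ b # as2"
      and xs: "list_all2 (\<lambda>x a. near x (a y)) xs (as1 @ [b])"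
    have cont: "continuous_map ?Y euclidean a" if "a \<in> set (as1 @ b # as2)" for a
      using continuous_map_projections[of a p] that as by metis
    define O' where "O' = {u \<in> topspace ?Y. list_all2 (\<lambda>x a. near x (a u)) xs (as1 @ [b])}"
    have open_list: "openin ?Y {u \<in> topspace ?Y. list_all2 (\<lambda>x a. near x (a u)) ys bs}"
      if "\<forall>a\<in>set bs. continuous_map ?Y euclidean a" "length ys = length bs" for ys bs
      using that(2,1)
    proof (induction ys bs rule: list_induct2)
      case Nil
      show ?case by (simp only: list_all2_Nil simp_thms Collect_mem_eq openin_topspace)
    next
      case (Cons x ys a bs)
      have "{u \<in> topspace ?Y. list_all2 (\<lambda>x a. near x (a u)) (x # ys) (a # bs)} =
          {u \<in> topspace ?Y. near x (a u)} \<inter> {u \<in> topspace ?Y. list_all2 (\<lambda>x a. near x (a u)) ys bs}" by auto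
      then show ?case using Cons openin_near[of ?Y a x] by auto
    qed
    have O': "openin ?Y O'"
      unfolding O'_def by (rule open_list) (use cont list_all2_lengthD[OF xs] in auto)
    let ?bs = "map (\<lambda>x _. x) xs @ b # as2"
    have "continuous_map (subtopology ?Y O') (tuple_space euclidean (coset_cover U') (Suc p)) (\<lambda>u. tuple_of (Suc p) (map (\<lambda>a. a u) ?bs))"
    proof (rule continuous_map_tuple_of)
      show "length ?bs = Suc (Suc p)"
        using list_all2_lengthD[OF xs] arg_cong[OF as, of length] by simp
      show "continuous_map (subtopology ?Y O') euclidean a" if "a \<in> set ?bs" for a
        using that cont by (auto intro: continuous_map_from_subtopology)
      fix u assume u: "u \<in> topspace (subtopology ?Y O')"
      then have uO: "u \<in> O'" and uT: "u \<in> tuples (coset_cover W) p" using topspace_tuple_space by auto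
      obtain g where g: "set (list_of p u) \<subseteq> (+) g ` W"
        using small_list_of[OF uT] by (auto simp: small_list_def coset_cover_def)
      have lu: "list_of p u = map (\<lambda>a. a u) as1 @ b u # map (\<lambda>a. a u) as2"
        unfolding map_projections[symmetric] as by simp
      have "list_all2 near xs (map (\<lambda>a. a u) (as1 @ [b]))"
        using uO by (simp only: O'_def mem_Collect_eq list_all2_map2)
      then have "set xs \<subseteq> (+) g ` U'" by (rule near_lists_coset[OF W(1)]) (use g lu in auto)
      moreover have "set (b u # map (\<lambda>a. a u) as2) \<subseteq> (+) g ` U'"
        by (rule order_trans[OF _ image_mono[OF W(2)]]) (use g lu in auto)
      ultimately have "set (map (\<lambda>a. a u) ?bs) \<subseteq> (+) g ` U'" by auto
      then show "\<exists>A\<in>coset_cover U'. set (map (\<lambda>a. a u) ?bs) \<subseteq> A" using coset_in_cover by blast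
    qed
    from k_continuous_compose[OF this f]
    have "k_continuous (subtopology ?Y O') V (\<lambda>u. f (tuple_of (Suc p) (xs @ b u # map (\<lambda>a. a u) as2)))"
      by (simp add: o_def)
    moreover have "y \<in> O'" using y xs by (simp add: O'_def)
    ultimately show "k_continuous_near ?Y V (\<lambda>u. f (tuple_of (Suc p) (xs @ b u # map (\<lambda>a. a u) as2))) y"
      unfolding k_continuous_near_def using O' by blast
  qed
  then show ?thesis by (simp add: map_projections)
qed

end

lemma (in contraction) averaging_exists:
  fixes U :: "'g::topological_group_add set"
  assumes B: "open_identity_filterbase \<B>" and U: "U \<in> \<B>"
  shows "\<exists>A T c W. averaging V \<Phi> A T c \<and> W \<in> \<B> \<and> W \<subseteq> U \<and> (\<forall>w\<in>W. \<forall>u\<in>A. w - u \<in> U)"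
proof -
  obtain A where A: "open A" "0 \<in> A" "\<And>x y. x \<in> A \<Longrightarrow> y \<in> A \<Longrightarrow> x - y \<in> U"
    using close_neighbourhood[OF filterbaseD(1,2)[OF B U]] by metis
  obtain W where W: "W \<in> \<B>" "W \<subseteq> U" "W \<subseteq> A" by (rule filterbase_below[OF B U A(1,2)])
  have "\<exists>T c. averaging V \<Phi> A T c"
    using step_partition_exists[OF A(1,2)] contraction_axioms by (auto simp: averaging_def)
  then show ?thesis using W A(3) by blast
qed

text \<open>The smoothed cocycle is k-continuous, and it differs from \<open>z\<close> by the coboundary of the prism.\<close>

lemma (in contraction) kc_to_cover_surj:
  fixes U :: "'g::topological_group_add set"
  assumes B: "open_identity_filterbase \<B>" and U: "U \<in> \<B>"
    and z: "z \<in> cocycles (cover_cochains (coset_cover U) V) (cover_d (coset_cover U)) q"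
  shows "\<exists>W\<in>\<B>. W \<subseteq> U \<and> (\<exists>x\<in>cocycles (kc_cochains euclidean (coset_cover W) V) (cover_d (coset_cover W)) q.
    \<exists>b\<in>coboundaries (cover_cochains (coset_cover W) V) (cover_d (coset_cover W)) q.
      x = b \<otimes>\<^bsub>cover_cochains (coset_cover W) V q\<^esub> restrict z (tuples (coset_cover W) q))"
proof -
  obtain A T c W where "averaging V \<Phi> A T c" and W: "W \<in> \<B>" "W \<subseteq> U" and WA: "\<forall>w\<in>W. \<forall>u\<in>A. w - u \<in> U"
    using averaging_exists[OF B U] by blast
  then interpret averaging V \<Phi> A T c by simp
  let ?F = "\<lambda>l. z (tuple_of q l)" and ?T = "tuples (coset_cover W) q"
  have F: "\<forall>l. small_list (coset_cover U) (Suc q) l \<longrightarrow> frag_eval ?F (list_boundary l) = 0"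
    using z unfolding cover_cocycles_iff[OF V_UNIV] by blast
  note sm = smooth_cocycle[OF WA W(2) F]
  let ?x = "\<lambda>u\<in>?T. smooth (list_of q u) ?F"
  have x: "?x (tuple_of q l) = smooth l ?F" if "small_list (coset_cover W) q l" for l
    using that tuple_of_small_list[OF that] by (simp add: small_list_def list_of_tuple_of)
  have xk: "k_cochain euclidean (coset_cover W) V q ?x"
    by (rule k_continuous_cong[OF _ k_cochain_smooth]) simp
  have xc: "?x \<in> cocycles (cover_cochains (coset_cover W) V) (cover_d (coset_cover W)) q"
    unfolding cover_cocycles_iff[OF V_UNIV]
  proof (intro conjI allI impI)
    fix l assume l: "small_list (coset_cover W) (Suc q) l"
    have "frag_eval (\<lambda>m. ?x (tuple_of q m)) (list_boundary l) = frag_eval (\<lambda>m. smooth m ?F) (list_boundary l)"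
      by (rule frag_eval_cong) (rule x[OF small_list_boundary[OF l]])
    then show "frag_eval (\<lambda>m. ?x (tuple_of q m)) (list_boundary l) = 0" using sm(1)[OF l] by simp
  qed simp
  then have "?x \<in> cocycles (kc_cochains euclidean (coset_cover W) V) (cover_d (coset_cover W)) q"
    using xk unfolding cocycles_def kc_cochains_def by simp
  moreover
  let ?b = "\<lambda>u\<in>?T. ?x u - z u"
  have "?b \<in> coboundaries (cover_cochains (coset_cover W) V) (cover_d (coset_cover W)) q"
    unfolding cover_coboundaries_iff[OF V_UNIV]
  proof (intro conjI exI[of _ "\<lambda>m. - prism m ?F"] allI impI)
    fix l assume l: "small_list (coset_cover W) q l"
    have "?b (tuple_of q l) = smooth l ?F - ?F l" using x[OF l] tuple_of_small_list[OF l] by simp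
    also have "\<dots> = frag_eval (\<lambda>m. - prism m ?F) (list_boundary l)"
      using sm(2)[OF l] by (simp add: frag_eval_uminus_fun)
    finally show "?b (tuple_of q l) = frag_eval (\<lambda>m. - prism m ?F) (list_boundary l)" .
  qed simp_all
  moreover have "?x = ?b \<otimes>\<^bsub>cover_cochains (coset_cover W) V q\<^esub> restrict z ?T"
    unfolding cover_cochains_def mult_function_group by (auto simp: fun_eq_iff)
  ultimately show ?thesis using W by blast
qed

text \<open>If \<open>x\<close> is the coboundary of an arbitrary cochain \<open>\<beta>\<close>, then the smoothed \<open>x\<close> is the coboundary of the smoothed \<open>\<beta>\<close>,
  and the prism of the continuous cochain \<open>x\<close>, which accounts for the difference, is continuous as well.\<close>

lemma (in contraction) kc_to_cover_inj:
  fixes U :: "'g::topological_group_add set"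
  assumes B: "open_identity_filterbase \<B>" and U: "U \<in> \<B>"
    and x: "x \<in> cocycles (kc_cochains euclidean (coset_cover U) V) (cover_d (coset_cover U)) q"
    and bx: "x \<in> coboundaries (cover_cochains (coset_cover U) V) (cover_d (coset_cover U)) q"
  shows "\<exists>W\<in>\<B>. W \<subseteq> U \<and> restrict x (tuples (coset_cover W) q) \<in>
    coboundaries (kc_cochains euclidean (coset_cover W) V) (cover_d (coset_cover W)) q"
proof -
  obtain A T c W where "averaging V \<Phi> A T c" and W: "W \<in> \<B>" "W \<subseteq> U" and WA: "\<forall>w\<in>W. \<forall>u\<in>A. w - u \<in> U"
    using averaging_exists[OF B U] by blast
  then interpret averaging V \<Phi> A T c by simp
  let ?F = "\<lambda>l. x (tuple_of q l)" and ?T = "tuples (coset_cover W) q"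
  have xk: "k_cochain euclidean (coset_cover U) V q x"
    and "x \<in> cocycles (cover_cochains (coset_cover U) V) (cover_d (coset_cover U)) q"
    using x unfolding cocycles_def kc_cochains_def by auto
  then have F: "\<forall>l. small_list (coset_cover U) (Suc q) l \<longrightarrow> frag_eval ?F (list_boundary l) = 0"
    unfolding cover_cocycles_iff[OF V_UNIV] by blast
  obtain \<beta> where \<beta>0: "\<beta> [] = 0" and \<beta>: "\<And>l. small_list (coset_cover U) q l \<Longrightarrow> ?F l = frag_eval \<beta> (list_boundary l)"
    using bx unfolding cover_coboundaries_iff[OF V_UNIV] by blast
  let ?b = "\<lambda>m. smooth m \<beta> + prism m ?F"
  have "restrict x ?T \<in> coboundaries (kc_cochains euclidean (coset_cover W) V) (cover_d (coset_cover W)) q"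
  proof (rule kc_coboundaryI[where \<beta> = ?b])
    show "?b [] = 0" by (simp add: \<beta>0)
    show "k_cochain euclidean (coset_cover W) V p (\<lambda>u. ?b (list_of p u))" if q: "q = Suc p" for p
      using k_continuous_add[OF k_cochain_smooth k_cochain_prism[OF WA W(2), of p x]] xk q by simp
    fix l assume l: "small_list (coset_cover W) q l"
    then obtain g where g: "length l = Suc q" "set l \<subseteq> (+) g ` W" by (auto simp: small_list_def coset_cover_def)
    have "smooth l ?F = smooth l (\<lambda>m. frag_eval \<beta> (list_boundary m))"
    proof (rule smooth_cong)
      fix zs assume zs: "list_all2 near zs l"
      show "?F zs = frag_eval \<beta> (list_boundary zs)"
        using near_lists_coset[OF WA zs g(2)] list_all2_lengthD[OF zs] g(1) coset_in_cover[of g U]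
        by (intro \<beta>) (auto simp: small_list_def)
    qed
    then have "?F l = frag_eval (\<lambda>m. smooth m \<beta>) (list_boundary l) + frag_eval (\<lambda>m. prism m ?F) (list_boundary l)"
      using smooth_cocycle(2)[OF WA W(2) F l] by (simp add: smooth_boundary)
    then show "restrict x ?T (tuple_of q l) = frag_eval ?b (list_boundary l)"
      using tuple_of_small_list[OF l] by (simp add: frag_eval_add_fun)
  qed simp
  then show ?thesis using W by blast
qed


section \<open>The comparison theorem\<close>

lemma contraction_exists:
  assumes "abelian_k_group V" "loop_contractible V"
  shows "\<exists>\<Phi>. contraction V \<Phi>"
  using assms unfolding abelian_k_group_def loop_contractible_def contraction_def by blast

lemma restrict_restrict_subset: "B \<subseteq> A \<Longrightarrow> restrict (restrict f A) B = restrict f B"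
  by (auto simp: fun_eq_iff)

lemma cochain_map_inclusion:
  assumes "\<And>q f g. f \<otimes>\<^bsub>C q\<^esub> g = f \<otimes>\<^bsub>C' q\<^esub> g" "\<And>q. carrier (C q) \<subseteq> carrier (C' q)"
  shows "cochain_map C d C' d (\<lambda>q f. f)"
  using assms(1) subsetD[OF assms(2)] unfolding cochain_map_def by (auto simp: hom_def)

lemma mult_cover_cochains: "f \<otimes>\<^bsub>cover_cochains \<UU> V q\<^esub> g = (\<lambda>u\<in>tuples \<UU> q. f u + g u)"
  by (simp add: cover_cochains_def mult_function_group del: mult_product_group)

lemma mult_kc_cochains: "f \<otimes>\<^bsub>kc_cochains X \<UU> V q\<^esub> g = (\<lambda>u\<in>tuples \<UU> q. f u + g u)"
  by (simp add: kc_cochains_def mult_cover_cochains)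

lemma mult_small_cochains: "f \<otimes>\<^bsub>small_cochains X \<UU> V q\<^esub> g = (\<lambda>u\<in>small_simplices X \<UU> q. f u + g u)"
  by (simp add: small_cochains_def mult_function_group del: mult_product_group)

lemma carrier_cover_cochains: "topspace V = UNIV \<Longrightarrow> carrier (cover_cochains \<UU> V q) = extensional (tuples \<UU> q)"
  unfolding cover_cochains_def by (rule carrier_function_group)

lemma carrier_small_cochains: "topspace V = UNIV \<Longrightarrow> carrier (small_cochains X \<UU> V q) = extensional (small_simplices X \<UU> q)"
  unfolding small_cochains_def by (rule carrier_function_group)

lemma cochain_map_restrict_cover:
  assumes V: "topspace V = UNIV" and WU: "W \<subseteq> U"
  shows "cochain_map (cover_cochains (coset_cover U) V) (cover_d (coset_cover U))
    (cover_cochains (coset_cover W) V) (cover_d (coset_cover W)) (\<lambda>q f. restrict f (tuples (coset_cover W) q))"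
  unfolding cover_d_def
  by (rule cochain_map_pullback[OF face_complex_tuples face_complex_tuples, where p = "\<lambda>q s. s"])
    (use tuples_mono[OF WU] in \<open>auto simp: mult_cover_cochains carrier_cover_cochains[OF V]\<close>)

lemma cochain_map_restrict_kc:
  assumes V: "topspace V = UNIV" and WU: "W \<subseteq> U"
  shows "cochain_map (kc_cochains X (coset_cover U) V) (cover_d (coset_cover U))
    (kc_cochains X (coset_cover W) V) (cover_d (coset_cover W)) (\<lambda>q f. restrict f (tuples (coset_cover W) q))"
  unfolding cover_d_def
proof (rule cochain_map_pullback[OF face_complex_tuples face_complex_tuples, where p = "\<lambda>q s. s"])
  fix q f assume "f \<in> carrier (kc_cochains X (coset_cover U) V q)"
  then have "k_cochain X (coset_cover U) V q f" by (simp add: carrier_kc_cochains[OF V])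
  then have "k_cochain X (coset_cover W) V q f" by (rule k_continuous_subtopology_mono[OF _ tuples_mono[OF WU]])
  then have "k_cochain X (coset_cover W) V q (restrict f (tuples (coset_cover W) q))"
    by (rule k_continuous_cong[rotated]) simp
  then show "restrict f (tuples (coset_cover W) q) \<in> carrier (kc_cochains X (coset_cover W) V q)"
    by (simp add: carrier_kc_cochains[OF V])
qed (use tuples_mono[OF WU] in \<open>auto simp: mult_kc_cochains\<close>)

lemma cochain_map_restrict_small:
  assumes V: "topspace V = UNIV" and WU: "W \<subseteq> U"
  shows "cochain_map (small_cochains X (coset_cover U) V) (small_d X (coset_cover U))
    (small_cochains X (coset_cover W) V) (small_d X (coset_cover W)) (\<lambda>q f. restrict f (small_simplices X (coset_cover W) q))"
  unfolding small_d_def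
  by (rule cochain_map_pullback[OF face_complex_small face_complex_small, where p = "\<lambda>q s. s"])
    (use small_simplices_mono[OF WU] in \<open>auto simp: mult_small_cochains carrier_small_cochains[OF V]\<close>)

lemma cochain_map_vertex:
  assumes V: "topspace V = UNIV" and C: "\<And>q f g. f \<otimes>\<^bsub>C q\<^esub> g = (\<lambda>u\<in>tuples \<UU> q. f u + g u)"
  shows "cochain_map C (cover_d \<UU>) (small_cochains X \<UU> V) (small_d X \<UU>) (vertex_map X \<UU>)"
  unfolding vertex_map_def[abs_def] cover_d_def small_d_def
  by (rule cochain_map_pullback[OF face_complex_tuples face_complex_small,
        where p = "\<lambda>q \<tau>. \<lambda>i\<in>{..q}. \<tau> (simplex_vertex i)"])
    (auto simp: vertices_in_tuples vertices_face C mult_small_cochains carrier_small_cochains[OF V])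

lemma system_cover:
  fixes \<B> :: "'g::topological_group_add set set"
  assumes B: "open_identity_filterbase \<B>" and V: "topspace V = UNIV"
  shows "system_of_complexes \<B> (\<lambda>U. cover_cochains (coset_cover U) V) (\<lambda>U. cover_d (coset_cover U))
    (\<lambda>W q f. restrict f (tuples (coset_cover W) q))"
  by (intro system_of_complexes.intro filterbaseD[OF B] cochain_complex_cover[OF V] cochain_map_restrict_cover[OF V]
      restrict_restrict_subset tuples_mono)

lemma system_small:
  fixes \<B> :: "'g::topological_group_add set set"
  assumes B: "open_identity_filterbase \<B>" and V: "topspace V = UNIV"
  shows "system_of_complexes \<B> (\<lambda>U. small_cochains euclidean (coset_cover U) V) (\<lambda>U. small_d euclidean (coset_cover U))
    (\<lambda>W q f. restrict f (small_simplices euclidean (coset_cover W) q))"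
  by (intro system_of_complexes.intro filterbaseD[OF B] cochain_complex_small[OF V] cochain_map_restrict_small[OF V]
      restrict_restrict_subset small_simplices_mono)

lemma (in contraction) system_kc:
  fixes \<B> :: "'g::topological_group_add set set"
  assumes B: "open_identity_filterbase \<B>"
  shows "system_of_complexes \<B> (\<lambda>U. kc_cochains euclidean (coset_cover U) V) (\<lambda>U. cover_d (coset_cover U))
    (\<lambda>W q f. restrict f (tuples (coset_cover W) q))"
  by (intro system_of_complexes.intro filterbaseD[OF B] cochain_complex_kc cochain_map_restrict_kc[OF V_UNIV]
      restrict_restrict_subset tuples_mono)

lemma vertex_map_restrict:
  assumes "W \<subseteq> U"
  shows "vertex_map X (coset_cover W) q (restrict f (tuples (coset_cover W) q)) =
    restrict (vertex_map X (coset_cover U) q f) (small_simplices X (coset_cover W) q)"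
  using small_simplices_mono[OF assms, of X q] vertices_in_tuples[of _ X "coset_cover W" q]
  by (auto simp: vertex_map_def fun_eq_iff)

lemma natural_vertex:
  fixes \<B> :: "'g::topological_group_add set set"
  assumes S: "system_of_complexes \<B> C (\<lambda>U. cover_d (coset_cover U)) (\<lambda>W q f. restrict f (tuples (coset_cover W) q))"
    and B: "open_identity_filterbase \<B>" and V: "topspace V = UNIV"
    and C: "\<And>U q f g. f \<otimes>\<^bsub>C U q\<^esub> g = (\<lambda>u\<in>tuples (coset_cover U) q. f u + g u)"
  shows "natural_cochain_map \<B> C (\<lambda>U. cover_d (coset_cover U)) (\<lambda>W q f. restrict f (tuples (coset_cover W) q))
    (\<lambda>U. small_cochains euclidean (coset_cover U) V) (\<lambda>U. small_d euclidean (coset_cover U))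
    (\<lambda>W q f. restrict f (small_simplices euclidean (coset_cover W) q)) (\<lambda>U. vertex_map euclidean (coset_cover U))"
  by (intro natural_cochain_map.intro natural_cochain_map_axioms.intro S system_small[OF B V]
      cochain_map_vertex[OF V C] vertex_map_restrict)

lemma (in contraction) natural_inclusion:
  fixes \<B> :: "'g::topological_group_add set set"
  assumes B: "open_identity_filterbase \<B>"
  shows "natural_cochain_map \<B> (\<lambda>U. kc_cochains euclidean (coset_cover U) V) (\<lambda>U. cover_d (coset_cover U))
    (\<lambda>W q f. restrict f (tuples (coset_cover W) q))
    (\<lambda>U. cover_cochains (coset_cover U) V) (\<lambda>U. cover_d (coset_cover U))
    (\<lambda>W q f. restrict f (tuples (coset_cover W) q)) (\<lambda>U q f. f)"
proof (intro natural_cochain_map.intro natural_cochain_map_axioms.intro system_kc[OF B] system_cover[OF B V_UNIV])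
  show "cochain_map (kc_cochains euclidean (coset_cover U) V) (cover_d (coset_cover U))
      (cover_cochains (coset_cover U) V) (cover_d (coset_cover U)) (\<lambda>q f. f)" for U :: "'g set"
    by (rule cochain_map_inclusion)
      (auto simp: mult_kc_cochains mult_cover_cochains carrier_kc_cochains[OF V_UNIV] carrier_cover_cochains[OF V_UNIV])
qed (rule refl)

lemma open_coset_cover:
  fixes U :: "'g::topological_group_add set"
  assumes U: "open U" and A: "A \<in> coset_cover U"
  shows "open A"
proof -
  obtain g where A: "A = (\<lambda>u. g + u) ` U" using A by (auto simp: coset_cover_def)
  have "(\<lambda>u. g + u) ` U = (\<lambda>u. - g + u) -` U"
  proof
    show "(\<lambda>u. g + u) ` U \<subseteq> (\<lambda>u. - g + u) -` U" by (auto simp: add.assoc[symmetric])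
    show "(\<lambda>u. - g + u) -` U \<subseteq> (\<lambda>u. g + u) ` U"
    proof
      fix x assume "x \<in> (\<lambda>u. - g + u) -` U"
      then show "x \<in> (\<lambda>u. g + u) ` U" by (intro image_eqI[of _ _ "- g + x"]) (simp_all add: add.assoc[symmetric])
    qed
  qed
  moreover have "open ((\<lambda>u. - g + u) -` U)" by (intro open_vimage U continuous_intros)
  ultimately show ?thesis unfolding A by simp
qed

lemma Union_coset_cover: "0 \<in> U \<Longrightarrow> \<Union>(coset_cover U) = UNIV"
  by (force simp: coset_cover_def)

theorem theorem6p27:
  fixes \<B> :: "'g::topological_group_add set set"
    and V :: "'v::ab_group_add topology"
    and q :: nat
  assumes "locally_contractible_space (euclidean :: 'g topology)"
    and "compactly_Hausdorff_generated (euclidean :: 'g topology)"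
    and "\<forall>p::nat. compactly_Hausdorff_generated (product_topology (\<lambda>_. euclidean :: 'g topology) {..p})"
    and "open_identity_filterbase \<B>"
    and "abelian_k_group V"
    and "loop_contractible V"
  shows "kc_to_cover \<B> V q \<in> iso (colim_H_kc \<B> V q) (colim_H_cover \<B> V q) \<and>
    sing_to_small \<B> V q \<in> iso (singular_cohomology euclidean V q) (colim_H_small \<B> V q) \<and>
    vertex_to_small \<B> V q \<in> iso (colim_H_kc \<B> V q) (colim_H_small \<B> V q) \<and>
    vertex_to_sing \<B> V q \<in> iso (colim_H_kc \<B> V q) (singular_cohomology euclidean V q) \<and>
    vertex_to_sing \<B> V q \<in> iso (colim_H_cover \<B> V q) (singular_cohomology euclidean V q)"
proof -
  note B = assms(4)
  obtain \<Phi> where "contraction V \<Phi>" using contraction_exists[OF assms(5,6)] by blast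
  then interpret contraction V \<Phi> .
  interpret inc: natural_cochain_map \<B> "\<lambda>U. kc_cochains euclidean (coset_cover U) V" "\<lambda>U. cover_d (coset_cover U)"
    "\<lambda>W q f. restrict f (tuples (coset_cover W) q)"
    "\<lambda>U. cover_cochains (coset_cover U) V" "\<lambda>U. cover_d (coset_cover U)"
    "\<lambda>W q f. restrict f (tuples (coset_cover W) q)" "\<lambda>U q f. f"
    by (rule natural_inclusion[OF B])
  interpret ver: natural_cochain_map \<B> "\<lambda>U. cover_cochains (coset_cover U) V" "\<lambda>U. cover_d (coset_cover U)"
    "\<lambda>W q f. restrict f (tuples (coset_cover W) q)"
    "\<lambda>U. small_cochains euclidean (coset_cover U) V" "\<lambda>U. small_d euclidean (coset_cover U)"
    "\<lambda>W q f. restrict f (small_simplices euclidean (coset_cover W) q)" "\<lambda>U. vertex_map euclidean (coset_cover U)"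
    by (rule natural_vertex[OF system_cover[OF B V_UNIV] B V_UNIV mult_cover_cochains])
  interpret kver: natural_cochain_map \<B> "\<lambda>U. kc_cochains euclidean (coset_cover U) V" "\<lambda>U. cover_d (coset_cover U)"
    "\<lambda>W q f. restrict f (tuples (coset_cover W) q)"
    "\<lambda>U. small_cochains euclidean (coset_cover U) V" "\<lambda>U. small_d euclidean (coset_cover U)"
    "\<lambda>W q f. restrict f (small_simplices euclidean (coset_cover W) q)" "\<lambda>U. vertex_map euclidean (coset_cover U)"
    by (rule natural_vertex[OF system_kc[OF B] B V_UNIV mult_kc_cochains])
  have H: "H_kc V q = inc.S.HH q" "H_cover V q = inc.S'.HH q" "H_small V q = ver.S'.HH q"
    by (simp_all add: fun_eq_iff H_kc_def H_cover_def H_small_def)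
  have r: "res_kc V q = inc.S.res q" "res_cover V q = inc.S'.res q" "(\<lambda>U W. res_small V q W) = ver.S'.res q"
    by (simp_all add: fun_eq_iff res_kc_def res_cover_def res_small_def)
  have inc_iso: "kc_to_cover \<B> V q \<in> iso (colim_H_kc \<B> V q) (colim_H_cover \<B> V q)"
    unfolding kc_to_cover_def H r
    by (rule inc.colim_hmap_iso) (fact kc_to_cover_surj[OF B] kc_to_cover_inj[OF B])+
  have ver_iso: "vertex_to_small \<B> V q \<in> iso (colim_H_cover \<B> V q) (colim_H_small \<B> V q)"
    unfolding vertex_to_small_def H r
    by (rule ver.colim_hmap_iso)
      (fact cover_to_small_surj[OF assms(1) B V_UNIV] cover_to_small_inj[OF assms(1) B V_UNIV])+
  have comp: "vertex_to_small \<B> V q P = (vertex_to_small \<B> V q \<circ> kc_to_cover \<B> V q) P"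
    if Pin: "P \<in> carrier (colim_H_kc \<B> V q)" for P
  proof -
    obtain U x where U: "U \<in> \<B>" and x: "x \<in> carrier (inc.S.HH q U)"
      and P: "P = colim_class \<B> (inc.S.HH q) (inc.S.res q) U x"
      using Pin unfolding H r direct_system.carrier_colim[OF inc.S.direct_system_cohomology] by blast
    obtain z where z: "z \<in> cocycles (kc_cochains euclidean (coset_cover U) V) (cover_d (coset_cover U)) q"
      and xz: "x = cohomology_class (kc_cochains euclidean (coset_cover U) V) (cover_d (coset_cover U)) q z"
      using x unfolding carrier_cohomology[OF inc.S.complex[OF U]] by blast
    have i: "inc.hmap q U x = cohomology_class (cover_cochains (coset_cover U) V) (cover_d (coset_cover U)) q z"
      unfolding xz by (rule cohomology_map_class[OF inc.S.complex[OF U] inc.S'.complex[OF U] inc.h[OF U] z])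
    have zc: "z \<in> cocycles (cover_cochains (coset_cover U) V) (cover_d (coset_cover U)) q"
      by (rule cochain_map_cocycles[OF inc.S.complex[OF U] inc.S'.complex[OF U] inc.h[OF U] z])
    have v: "ver.hmap q U (inc.hmap q U x) = kver.hmap q U x"
      unfolding i unfolding xz
        cohomology_map_class[OF inc.S'.complex[OF U] ver.S'.complex[OF U] ver.h[OF U] zc]
        cohomology_map_class[OF inc.S.complex[OF U] ver.S'.complex[OF U] kver.h[OF U] z] ..
    have ix: "inc.hmap q U x \<in> carrier (inc.S'.HH q U)" by (rule hom_in_carrier[OF inc.hmap_hom[OF U] x])
    have "kc_to_cover \<B> V q P = colim_class \<B> (inc.S'.HH q) (inc.S'.res q) U (inc.hmap q U x)"
      unfolding P kc_to_cover_def H r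
      by (rule colim_map_class[OF inc.S.direct_system_cohomology inc.S'.direct_system_cohomology
            inc.hmap_hom inc.hmap_natural U x])
    moreover have "vertex_to_small \<B> V q (colim_class \<B> (inc.S'.HH q) (inc.S'.res q) U (inc.hmap q U x)) =
        colim_class \<B> (ver.S'.HH q) (ver.S'.res q) U (ver.hmap q U (inc.hmap q U x))"
      unfolding vertex_to_small_def H r
      by (rule colim_map_class[OF inc.S'.direct_system_cohomology ver.S'.direct_system_cohomology
            ver.hmap_hom ver.hmap_natural U ix])
    moreover have "vertex_to_small \<B> V q P = colim_class \<B> (ver.S'.HH q) (ver.S'.res q) U (kver.hmap q U x)"
      unfolding P vertex_to_small_def H r
      by (rule colim_map_class[OF inc.S.direct_system_cohomology ver.S'.direct_system_cohomology
            kver.hmap_hom kver.hmap_natural U x])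
    ultimately show ?thesis by (simp only: o_apply v)
  qed
  have kver_iso: "vertex_to_small \<B> V q \<in> iso (colim_H_kc \<B> V q) (colim_H_small \<B> V q)"
  proof (rule iso_cong_carrier[OF iso_set_trans[OF inc_iso ver_iso] comp])
    show "P \<otimes>\<^bsub>colim_H_kc \<B> V q\<^esub> Q \<in> carrier (colim_H_kc \<B> V q)"
      if "P \<in> carrier (colim_H_kc \<B> V q)" "Q \<in> carrier (colim_H_kc \<B> V q)" for P Q
      using that unfolding H r by (rule direct_system.mult_closed_colim[OF inc.S.direct_system_cohomology])
  qed
  let ?S = "\<lambda>q. function_group (singular_simplex_set q (euclidean :: 'g topology)) V"
  let ?dS = "coboundary (\<lambda>q. singular_simplex_set q (euclidean :: 'g topology)) (\<lambda>q. singular_face (Suc q))"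
  have complex: "cochain_complex ?S ?dS"
    by (rule face_complex.cochain_complex_functions[OF face_complex_singular V_UNIV])
  have group: "Group.group (singular_cohomology (euclidean :: 'g topology) V q)"
    using comm_group_cohomology[OF complex, of q] unfolding singular_cohomology_def comm_group_def by blast
  have sing_iso: "sing_to_small \<B> V q \<in> iso (singular_cohomology euclidean V q) (colim_H_small \<B> V q)"
    unfolding sing_to_small_def[abs_def] H r
  proof (rule constant_to_colim_iso[OF ver.S'.direct_system_cohomology])
    show "res_small V q U \<in> hom (singular_cohomology euclidean V q) (ver.S'.HH q U)" if "U \<in> \<B>" for U
      unfolding res_small_def singular_cohomology_def
      by (rule cohomology_map_hom[OF complex ver.S'.complex[OF that] cochain_map_sing_small[OF V_UNIV]])
    show "ver.S'.res q U W (res_small V q U x) = res_small V q W x"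
      if U: "U \<in> \<B>" "W \<in> \<B>" "W \<subseteq> U" and x: "x \<in> carrier (singular_cohomology euclidean V q)" for U W x
    proof -
      obtain z where z: "z \<in> cocycles ?S ?dS q" and xz: "x = cohomology_class ?S ?dS q z"
        using x unfolding singular_cohomology_def carrier_cohomology[OF complex] by blast
      note mU = cohomology_map_class[OF complex ver.S'.complex[OF U(1)] cochain_map_sing_small[OF V_UNIV] z]
      note mW = cohomology_map_class[OF complex ver.S'.complex[OF U(2)] cochain_map_sing_small[OF V_UNIV] z]
      note zU = cochain_map_cocycles[OF complex ver.S'.complex[OF U(1)] cochain_map_sing_small[OF V_UNIV] z]
      show ?thesis
        unfolding res_small_def xz mU mW
          cohomology_map_class[OF ver.S'.complex[OF U(1)] ver.S'.complex[OF U(2)] ver.S'.restriction[OF U] zU]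
          restrict_restrict_subset[OF small_simplices_mono[OF U(3)]] ..
    qed
    show "bij_betw (res_small V q U) (carrier (singular_cohomology euclidean V q)) (carrier (ver.S'.HH q U))"
      if U: "U \<in> \<B>" for U
      unfolding res_small_def
    proof (rule sing_to_small_bij[OF V_UNIV])
      show "openin euclidean A" if "A \<in> coset_cover U" for A
        using open_coset_cover[OF filterbaseD(1)[OF B U] that] by (simp only: open_openin)
      show "topspace euclidean \<subseteq> \<Union> (coset_cover U)"
        using Union_coset_cover[OF filterbaseD(2)[OF B U]] by simp
    qed
    show "Group.group (singular_cohomology (euclidean :: 'g topology) V q)" by (rule group)
  qed
  have inv_iso: "inv_into (carrier (singular_cohomology euclidean V q)) (sing_to_small \<B> V q) \<in>
      iso (colim_H_small \<B> V q) (singular_cohomology euclidean V q)"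
    by (rule group.iso_set_sym[OF group sing_iso])
  show ?thesis
    unfolding vertex_to_sing_def
    using inc_iso sing_iso kver_iso iso_set_trans[OF kver_iso inv_iso] iso_set_trans[OF ver_iso inv_iso] by blast
qed

end
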